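(* Let $U\in\mathcal C^2(\mathbb R^d)$ and $0<m\le L$ be such that for all $x,y\in\mathbb R^d$, $|\nabla U(x)-\nabla U(y)|\le L|x-y|$ and $(x-y)\cdot(\nabla U(x)-\nabla U(y))\ge m|x-y|^2$. Suppose moreover that $\gamma\ge 2\sqrt L$ and $0<\delta\le m/(33\gamma^3)$. Let $\pi_\delta$ be the unique invariant probability measure of the OBABO chain with parameters $\delta,\gamma$ and potential $U$, let $\pi$ be the probability measure on $\mathbb R^{2d}$ with density proportional to $\exp(-U(x)-|v|^2/2)$, and let $P_V$ be the Verlet transition operator with time-step $\delta$. Set $$K_1=\sqrt3\max\left(L^{1/2},L^{-1/2}\right),\quad \kappa=\frac{m}{3\gamma},\quad K_2=\sqrt{\frac{\delta}{2\pi(1-\eta^2)}}\max\left(2+\frac{3\delta^2L}{2},3\delta\right),\quad \eta=e^{-\delta\gamma/2}$$ (in the expression of $K_2$, $\pi$ is the number). Then for all $p\ge1$, $$\mathcal W_p(\pi_\delta,\pi)\ \le\ \frac{2K_1}{\delta\kappa}\,\mathcal W_p(\pi,\pi P_V),$$ and for all integers $n\ge1$, $$\|\pi_\delta-\pi\|_{TV}\ \le\ \frac{K_1K_2}{\delta^{3/2}}(1-\delta\kappa)^{(n-1)/2}\,\mathcal W_1(\pi_\delta,\pi)+n\,\|\pi P_V-\pi\|_{TV}.$$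
   Context: Given a time-step $\delta>0$ and a friction $\gamma>0$, set $\eta=e^{-\delta\gamma/2}$. The OBABO chain is the time-homogeneous Markov chain on $\mathbb R^d\times\mathbb R^d$ whose transition from $(x_0,v_0)$ to $(x_1,v_1)$ is $$x_1=x_0+\delta\left(\eta v_0+\sqrt{1-\eta^2}\,G\right)-\frac{\delta^2}{2}\nabla U(x_0),$$ $$v_1=\eta^2v_0-\frac{\delta\eta}{2}\left(\nabla U(x_0)+\nabla U(x_1)\right)+\sqrt{1-\eta^2}\left(\eta G+G'\right),$$ where $G,G'$ are independent standard Gaussian vectors in $\mathbb R^d$. Under the hypotheses of the claim it has a unique invariant probability measure $\pi_\delta$, with finite moments of all orders. The Verlet map is $$\Phi_V(x,v)=\left(x',\ v-\tfrac{\delta}{2}\left(\nabla U(x)+\nabla U(x')\right)\right),\qquad x'=x+\delta v-\tfrac{\delta^2}{2}\nabla U(x),$$ and $P_V\varphi=\varphi\circ\Phi_V$, i.e. $\nu P_V$ is the push-forward of $\nu$ by $\Phi_V$. $\mathcal W_p$ is the $p$-Wasserstein distance for the Euclidean norm, and $\|\nu-\mu\|_{TV}=\inf_{X\sim\nu,Y\sim\mu}2\,\mathbb P(X\ne Y)$. *)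

theory Defs
  imports "HOL-Probability.Probability"
begin

text \<open>
  Phase space is the product type \<open>'a \<times> 'a\<close>, whose library norm is the Euclidean one,
  \<open>norm (x, v) = sqrt ((norm x)\<^sup>2 + (norm v)\<^sup>2)\<close>.
\<close>

definition grad :: "('a::euclidean_space \<Rightarrow> real) \<Rightarrow> 'a \<Rightarrow> 'a" where
  "grad U x = (THE D. GDERIV U x :> D)"

definition C2 :: "('a::euclidean_space \<Rightarrow> real) \<Rightarrow> bool" where
  "C2 U \<longleftrightarrow> (\<forall>x. GDERIV U x :> grad U x) \<and>
    (\<exists>H :: 'a \<Rightarrow> ('a \<Rightarrow>\<^sub>L 'a).
      (\<forall>x. (grad U has_derivative blinfun_apply (H x)) (at x)) \<and> continuous_on UNIV H)"

definition std_gaussian :: "'a::euclidean_space measure" where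
  "std_gaussian = density lborel (\<lambda>x. ennreal (\<Prod>b\<in>Basis. std_normal_density (x \<bullet> b)))"

definition eta :: "real \<Rightarrow> real \<Rightarrow> real" where
  "eta \<delta> \<gamma> = exp (- \<delta> * \<gamma> / 2)"

fun obabo_step ::
  "real \<Rightarrow> real \<Rightarrow> ('a::euclidean_space \<Rightarrow> real) \<Rightarrow> 'a \<times> 'a \<Rightarrow> 'a \<times> 'a \<Rightarrow> 'a \<times> 'a" where
  "obabo_step \<delta> \<gamma> U (x0, v0) (G, G') =
    (let \<eta> = eta \<delta> \<gamma>;
         x1 = x0 + \<delta> *\<^sub>R (\<eta> *\<^sub>R v0 + sqrt (1 - \<eta>\<^sup>2) *\<^sub>R G) - (\<delta>\<^sup>2 / 2) *\<^sub>R grad U x0;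
         v1 = \<eta>\<^sup>2 *\<^sub>R v0 - (\<delta> * \<eta> / 2) *\<^sub>R (grad U x0 + grad U x1)
                + sqrt (1 - \<eta>\<^sup>2) *\<^sub>R (\<eta> *\<^sub>R G + G')
     in (x1, v1))"

definition obabo_kernel ::
  "real \<Rightarrow> real \<Rightarrow> ('a::euclidean_space \<Rightarrow> real) \<Rightarrow> 'a \<times> 'a \<Rightarrow> ('a \<times> 'a) measure" where
  "obabo_kernel \<delta> \<gamma> U z = distr (std_gaussian \<Otimes>\<^sub>M std_gaussian) borel (obabo_step \<delta> \<gamma> U z)"

definition invariant_prob :: "('b::topological_space \<Rightarrow> 'b measure) \<Rightarrow> 'b measure \<Rightarrow> bool" where
  "invariant_prob K \<nu> \<longleftrightarrow> prob_space \<nu> \<and> sets \<nu> = sets borel \<and> \<nu> \<bind> K = \<nu>"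

definition target_measure :: "('a::euclidean_space \<Rightarrow> real) \<Rightarrow> ('a \<times> 'a) measure" where
  "target_measure U =
    (let f = (\<lambda>(x, v). exp (- U x - (norm v)\<^sup>2 / 2))
     in density lborel (\<lambda>z. ennreal (f z / (\<integral>w. f w \<partial>lborel))))"

fun verlet :: "real \<Rightarrow> ('a::euclidean_space \<Rightarrow> real) \<Rightarrow> 'a \<times> 'a \<Rightarrow> 'a \<times> 'a" where
  "verlet \<delta> U (x, v) =
    (let x' = x + \<delta> *\<^sub>R v - (\<delta>\<^sup>2 / 2) *\<^sub>R grad U x
     in (x', v - (\<delta> / 2) *\<^sub>R (grad U x + grad U x')))"

definition verlet_push ::
  "real \<Rightarrow> ('a::euclidean_space \<Rightarrow> real) \<Rightarrow> ('a \<times> 'a) measure \<Rightarrow> ('a \<times> 'a) measure" where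
  "verlet_push \<delta> U \<nu> = distr \<nu> borel (verlet \<delta> U)"

definition couplings :: "'b measure \<Rightarrow> 'b measure \<Rightarrow> ('b \<times> 'b) measure set" where
  "couplings \<nu> \<mu> =
    {\<Gamma>. sets \<Gamma> = sets (\<nu> \<Otimes>\<^sub>M \<mu>) \<and> distr \<Gamma> \<nu> fst = \<nu> \<and> distr \<Gamma> \<mu> snd = \<mu>}"

text \<open>The library has no real powers on \<open>ennreal\<close>; this is \<open>c\<close> to the power \<open>1/p\<close>.\<close>

definition ennroot :: "real \<Rightarrow> ennreal \<Rightarrow> ennreal" where
  "ennroot p c = (if c = \<top> then \<top> else ennreal (enn2real c powr (1 / p)))"

definition wasserstein ::
  "real \<Rightarrow> 'b::metric_space measure \<Rightarrow> 'b measure \<Rightarrow> ennreal" where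
  "wasserstein p \<nu> \<mu> =
    ennroot p (INF \<Gamma>\<in>couplings \<nu> \<mu>. \<integral>\<^sup>+ (x, y). ennreal (dist x y powr p) \<partial>\<Gamma>)"

text \<open>Total variation with the normalisation in which mutually singular laws are at distance 2.\<close>

definition tv_dist :: "'b measure \<Rightarrow> 'b measure \<Rightarrow> ennreal" where
  "tv_dist \<nu> \<mu> =
    (INF \<Gamma>\<in>couplings \<nu> \<mu>. 2 * emeasure \<Gamma> {(x, y) \<in> space \<Gamma>. x \<noteq> y})"

end

theory Submission
  imports Defs
begin

text \<open>
  One OBABO step is half an Ornstein--Uhlenbeck step, a Verlet step and another half Ornstein--Uhlenbeck
  step, and the target \<open>\<pi>\<close> is invariant under the Ornstein--Uhlenbeck part; so one step moves \<open>\<pi>\<close> by no more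
  than the Verlet step does. Two chains driven by the same noise contract by the factor
  \<open>sqrt (1 - \<delta> * \<kappa>)\<close> in the norm with square \<open>\<bar>x\<bar>\<^sup>2 + (2 / \<gamma>) x \<bullet> v + \<bar>v\<bar>\<^sup>2 / L\<close>,
  whose distortion with respect to the Euclidean norm is at most \<open>K1\<close>. The triangle inequality then bounds the optimal cost \<open>D\<close> between \<open>\<pi>\<delta>\<close> and \<open>\<pi>\<close>
  by a fraction of itself plus the defect of \<open>\<pi>\<close>, which gives the first claim because \<open>D\<close> is finite.

  For total variation, \<open>n\<close> steps applied to \<open>\<pi>\<close> cost \<open>n\<close> times the one-step defect, and \<open>n\<close> steps from two
  different laws are compared by \<open>n - 2\<close> contracting steps followed by two steps in which the Gaussian
  increments are shifted so that the chains meet.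
\<close>

subsection \<open>Gradients of smooth convex functions\<close>

text \<open>Several losses have to fit into constants that are fixed in advance. The factor
  \<open>2 / (\<delta> * \<kappa>)\<close> is available because \<open>1 - \<rho>\<close> strictly
  exceeds \<open>\<delta> * \<kappa> / 2\<close>, where
  \<open>\<rho> = sqrt (1 - \<delta> * \<kappa>)\<close>; the strict gap pays for gluing couplings
  only up to an error \<open>\<epsilon>\<close>. In place of Minkowski's inequality, Jensen's
  inequality acts on p-th powers, so that the coefficient of the optimal cost is exactly
  \<open>\<rho>\<close> for every \<open>p\<close> and the root is taken only at the end. Finiteness
  of that cost is a step of its own: invariance alone has to yield the moments of
  \<open>\<pi>\<delta>\<close>, by a truncated drift inequality. The mixed weight
  \<open>2 / \<gamma>\<close> in the norm is the one for which transport and friction cancel to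
  first order in the cross term of a step. For total variation, the exponent
  \<open>(n - 1) / 2\<close> does not allow for two steps spent on regularization; the lost power of
  \<open>\<rho>\<close> is recovered from the slack between \<open>1.2 * sqrt (3 / 2)\<close> and
  \<open>sqrt 3\<close>. The estimates are made on functions with values in \<open>[0, 1]\<close>
  and turned into a coupling only at the end.\<close>

lemma gderiv_line:
  fixes f :: "'a::euclidean_space \<Rightarrow> real"
  assumes "\<And>z. GDERIV f z :> g z"
  shows "((\<lambda>t. f (x + t *\<^sub>R h)) has_real_derivative (h \<bullet> g (x + t *\<^sub>R h))) (at t within S)"
proof -
  have 1: "((\<lambda>t. x + t *\<^sub>R h) has_derivative (\<lambda>s. s *\<^sub>R h)) (at t within S)"
    by (auto intro!: derivative_eq_intros)
  have 2: "(f has_derivative (\<lambda>k. k \<bullet> g (x + t *\<^sub>R h))) (at (x + t *\<^sub>R h))"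
    using assms by (simp add: gderiv_def)
  have "((\<lambda>t. f (x + t *\<^sub>R h)) has_derivative (\<lambda>s. (s *\<^sub>R h) \<bullet> g (x + t *\<^sub>R h))) (at t within S)"
    by (rule has_derivative_compose[OF 1 2])
  then show ?thesis
    by (simp add: has_field_derivative_def mult_commute_abs)
qed

text \<open>Descent lemma. Along the segment the slope of \<open>f\<close> exceeds its initial value
  by at most \<open>L * t * (norm h)\<^sup>2\<close>, so \<open>f\<close> minus its quadratic model
  is nonincreasing in \<open>t\<close>.\<close>

lemma smooth_upper_bound:
  fixes f :: "'a::euclidean_space \<Rightarrow> real"
  assumes d: "\<And>z. GDERIV f z :> g z"
    and lip: "\<And>x y. norm (g x - g y) \<le> L * norm (x - y)"
  shows "f (x + h) \<le> f x + h \<bullet> g x + L / 2 * (norm h)\<^sup>2"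
proof -
  define q where "q t = f (x + t *\<^sub>R h) - t * (h \<bullet> g x) - L * t\<^sup>2 / 2 * (norm h)\<^sup>2" for t
  have "q 1 \<le> q 0"
  proof (rule DERIV_nonpos_imp_nonincreasing[of 0 1 q])
    fix t :: real assume t: "0 \<le> t" "t \<le> 1"
    have "(q has_real_derivative (h \<bullet> g (x + t *\<^sub>R h) - h \<bullet> g x - L * t * (norm h)\<^sup>2)) (at t)"
      unfolding q_def by (rule derivative_eq_intros gderiv_line[OF d] refl | simp)+
    moreover have "h \<bullet> g (x + t *\<^sub>R h) - h \<bullet> g x \<le> L * t * (norm h)\<^sup>2"
    proof -
      have "h \<bullet> g (x + t *\<^sub>R h) - h \<bullet> g x = h \<bullet> (g (x + t *\<^sub>R h) - g x)" by (simp add: inner_diff_right)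
      also have "\<dots> \<le> norm h * norm (g (x + t *\<^sub>R h) - g x)" by (rule norm_cauchy_schwarz)
      also have "\<dots> \<le> norm h * (L * norm (t *\<^sub>R h))" using lip[of "x + t *\<^sub>R h" x] by (intro mult_left_mono) auto
      also have "\<dots> = L * t * (norm h)\<^sup>2" using t by (simp add: power2_eq_square)
      finally show ?thesis .
    qed
    ultimately show "\<exists>y. (q has_real_derivative y) (at t) \<and> y \<le> 0" by force
  qed simp
  then show ?thesis by (simp add: q_def)
qed

text \<open>Used for two values of the constant: \<open>m = 0\<close> is the tangent inequality of a
  convex function, and the true \<open>m\<close> later gives quadratic growth of
  \<open>U\<close>.\<close>

lemma strongly_convex_lower_bound:
  fixes f :: "'a::euclidean_space \<Rightarrow> real"
  assumes d: "\<And>z. GDERIV f z :> g z"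
    and mono: "\<And>x y. m * (norm (x - y))\<^sup>2 \<le> (x - y) \<bullet> (g x - g y)"
  shows "f x + h \<bullet> g x + m / 2 * (norm h)\<^sup>2 \<le> f (x + h)"
proof -
  define q where "q t = f (x + t *\<^sub>R h) - t * (h \<bullet> g x) - m * t\<^sup>2 / 2 * (norm h)\<^sup>2" for t
  have "q 0 \<le> q 1"
  proof (rule DERIV_nonneg_imp_nondecreasing[of 0 1 q])
    fix t :: real assume t: "0 \<le> t" "t \<le> 1"
    have "(q has_real_derivative (h \<bullet> g (x + t *\<^sub>R h) - h \<bullet> g x - m * t * (norm h)\<^sup>2)) (at t)"
      unfolding q_def by (rule derivative_eq_intros gderiv_line[OF d] refl | simp)+
    moreover have "m * t * (norm h)\<^sup>2 \<le> h \<bullet> g (x + t *\<^sub>R h) - h \<bullet> g x"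
    \<comment> \<open>Monotonicity between \<open>x + t *\<^sub>R h\<close> and \<open>x\<close>
      yields the inequality multiplied by \<open>t\<close>; hence the division, and the separate
      case \<open>t = 0\<close>, where both sides vanish.\<close>
    proof (cases "t = 0")
      case False
      with t have "0 < t" by simp
      have "t * (m * t * (norm h)\<^sup>2) \<le> t * (h \<bullet> g (x + t *\<^sub>R h) - h \<bullet> g x)"
        using mono[of "x + t *\<^sub>R h" x] t
        by (simp add: inner_diff_right power_mult_distrib power2_eq_square algebra_simps)
      then show ?thesis using \<open>0 < t\<close> by (rule mult_left_le_imp_le)
    qed simp
    ultimately show "\<exists>y. (q has_real_derivative y) (at t) \<and> 0 \<le> y" by force
  qed simp
  then show ?thesis by (simp add: q_def)
qed

text \<open>Baillon--Haddad: minimise the convex function \<open>z \<mapsto> f z - z \<bullet> g y\<close> by one gradient step.\<close>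

lemma gradient_cocoercive:
  fixes f :: "'a::euclidean_space \<Rightarrow> real"
  assumes d: "\<And>z. GDERIV f z :> g z" and L: "0 < L"
    and lip: "\<And>x y. norm (g x - g y) \<le> L * norm (x - y)"
    and mono: "\<And>x y. 0 \<le> (x - y) \<bullet> (g x - g y)"
  shows "(norm (g x - g y))\<^sup>2 \<le> L * ((x - y) \<bullet> (g x - g y))"
proof -
  have *: "f x - f y - (x - y) \<bullet> g y \<ge> (norm (g x - g y))\<^sup>2 / (2 * L)" for x y
  proof -
    \<comment> \<open>Minimiser of the quadratic model of
      \<open>z \<mapsto> f z - z \<bullet> g y\<close> at \<open>x\<close>, whose gradient there is
      \<open>g x - g y\<close>.\<close>
    define h where "h = (- 1 / L) *\<^sub>R (g x - g y)"
    have a: "f (x + h) \<le> f x + h \<bullet> g x + L / 2 * (norm h)\<^sup>2"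
      by (rule smooth_upper_bound[OF d lip])
    have b: "f y + (x + h - y) \<bullet> g y \<le> f (y + (x + h - y))"
      using strongly_convex_lower_bound[OF d, of 0 y "x + h - y"] mono by simp
    define D where "D = g x - g y"
    have hD: "h = (- 1 / L) *\<^sub>R D" by (simp add: h_def D_def)
    have "h \<bullet> D + L / 2 * (norm h)\<^sup>2 = - (norm D)\<^sup>2 / (2 * L)"
      unfolding hD using L by (simp add: power_divide dot_square_norm field_simps power2_eq_square)
    then have "h \<bullet> (g x - g y) + L / 2 * (norm h)\<^sup>2 = - (norm (g x - g y))\<^sup>2 / (2 * L)"
      by (simp add: D_def)
    with a b show ?thesis by (simp add: inner_diff_right inner_diff_left inner_add_left algebra_simps)
  qed
  \<comment> \<open>When the two instances are added, the values of \<open>f\<close> cancel and each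
    contributes half of the claim.\<close>
  from *[of x y] *[of y x] have "2 * ((norm (g x - g y))\<^sup>2 / (2 * L)) \<le> (x - y) \<bullet> (g x - g y)"
    by (simp add: norm_minus_commute inner_diff_right inner_diff_left algebra_simps)
  then show ?thesis using L by (simp add: field_simps)
qed

subsection \<open>Contraction of the synchronous coupling\<close>

text \<open>Young's inequality with a free weight \<open>c\<close>. The coefficient \<open>t\<close>
  enters through a bound on its absolute value, because the mixed coefficients of the energy
  estimate have no definite sign.\<close>

lemma weighted_cauchy_schwarz:
  fixes u w :: "'a::real_inner"
  assumes c: "0 < c" and t: "\<bar>t\<bar> \<le> b"
  shows "t * (u \<bullet> w) \<le> c * (norm w)\<^sup>2 + b\<^sup>2 / (4 * c) * (norm u)\<^sup>2"
proof -
  have "t * (u \<bullet> w) \<le> \<bar>t\<bar> * (norm u * norm w)"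
    using Cauchy_Schwarz_ineq2[of u w] by (metis abs_ge_self abs_ge_zero abs_mult mult_left_mono order_trans)
  also have "\<dots> \<le> b * (norm u * norm w)" using t by (intro mult_right_mono) auto
  also have "\<dots> \<le> c * (norm w)\<^sup>2 + b\<^sup>2 / (4 * c) * (norm u)\<^sup>2"
  proof -
    have "0 \<le> (2 * c * norm w - b * norm u)\<^sup>2 / (4 * c)" using c by simp
    also have "\<dots> = c * (norm w)\<^sup>2 + b\<^sup>2 / (4 * c) * (norm u)\<^sup>2 - b * (norm u * norm w)"
      using c by (simp add: power2_eq_square field_simps)
    finally show ?thesis by simp
  qed
  finally show ?thesis .
qed

text \<open>The derivative of the difference is the square of \<open>exp (x/2) - exp (-x/2)\<close>.
  The lemma bounds \<open>r - \<eta>\<close> and \<open>r\<^sup>2 - \<eta>\<^sup>2\<close> from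
  below, which measures the damping of the two friction half-steps.\<close>

lemma two_sinh_ge: "0 \<le> y \<Longrightarrow> 2 * y \<le> exp y - exp (- y :: real)"
proof -
  assume "0 \<le> y"
  have "exp 0 - exp (-0) - 2 * 0 \<le> exp y - exp (-y) - 2 * y"
  proof (rule DERIV_nonneg_imp_nondecreasing[of 0 y "\<lambda>y. exp y - exp (-y) - 2 * y", OF \<open>0 \<le> y\<close>])
    fix x :: real
    have "((\<lambda>y. exp y - exp (-y) - 2 * y) has_real_derivative exp x + exp (-x) - 2) (at x)"
      by (auto intro!: derivative_eq_intros)
    moreover have "0 \<le> (exp (x/2) - exp (-x/2))\<^sup>2" by simp
    then have "0 \<le> exp x + exp (-x) - 2"
      by (simp add: power2_diff flip: exp_double) (simp add: mult.assoc flip: exp_add)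
    ultimately show "\<exists>z. ((\<lambda>y. exp y - exp (-y) - 2 * y) has_real_derivative z) (at x) \<and> 0 \<le> z" by blast
  qed
  then show ?thesis by simp
qed

text \<open>Units in which \<open>L = 1\<close>; then \<open>g\<close> is the friction, \<open>d\<close> the time-step and \<open>\<mu>\<close> the convexity constant.\<close>

locale scaled_parameters =
  fixes g d \<mu> \<eta> r k :: real
  assumes g: "2 \<le> g" and \<mu>: "0 < \<mu>" "\<mu> \<le> 1" and d: "0 < d" "d \<le> \<mu> / (33 * g ^ 3)"
    and \<eta>: "\<eta> = exp (- (d * g / 2))" and r: "r = exp (d * g / 2)" and k: "k = \<mu> / (3 * g)"
begin

text \<open>The product of time-step and friction is the small parameter of the estimate. With
  \<open>g \<ge> 2\<close> and \<open>\<mu> \<le> 1\<close> it yields the numbers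
  \<open>1/132\<close>, \<open>1/264\<close> and \<open>1/1584\<close> below.\<close>

lemma dg_le: "d * g \<le> \<mu> / (33 * g\<^sup>2)"
proof -
  have "d * g \<le> \<mu> / (33 * g ^ 3) * g" using g d by (intro mult_right_mono) auto
  also have "\<dots> = \<mu> / (33 * g\<^sup>2)" using g by (simp add: power2_eq_square power3_eq_cube)
  finally show ?thesis .
qed

lemma g2: "4 \<le> g\<^sup>2"
  using power_mono[OF g, of 2] by simp

lemma dg: "d * g \<le> 1 / 132"
proof -
  have "\<mu> / (33 * g\<^sup>2) \<le> 1 / (33 * 4)" using \<mu> g2 by (intro frac_le) auto
  then show ?thesis using dg_le by simp
qed

lemma d_le: "d \<le> 1 / 264"
proof -
  have "d * 2 \<le> d * g" using g d by (intro mult_left_mono) auto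
  then show ?thesis using dg by simp
qed

lemma dk: "0 < d * k" "d * k \<le> 1 / 1584"
proof -
  show "0 < d * k" using d \<mu> g by (simp add: k)
  have "k \<le> 1 / (3 * 2)" unfolding k using \<mu> g by (intro frac_le) auto
  moreover have "0 \<le> k" using \<mu> g by (simp add: k)
  ultimately have "d * k \<le> 1/264 * (1/6)" using d_le d by (intro mult_mono) auto
  then show "d * k \<le> 1 / 1584" by simp
qed

lemma \<eta>_bounds: "1 - d * g / 2 \<le> \<eta>" "263/264 \<le> \<eta>" "\<eta> \<le> 1" "0 < \<eta>"
proof -
  show 1: "1 - d * g / 2 \<le> \<eta>" using exp_ge_add_one_self[of "- (d * g / 2)"] by (simp add: \<eta>)
  then show "263/264 \<le> \<eta>" using dg by simp
  show "\<eta> \<le> 1" "0 < \<eta>" using d g by (auto simp: \<eta>)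
qed

lemma \<eta>r: "\<eta> * r = 1"
  by (simp add: \<eta> r flip: exp_add)

lemma r_bounds: "1 \<le> r" "r \<le> 1 + d * g / 2 + (d * g / 2)\<^sup>2" "r \<le> 1.005" "r\<^sup>2 \<le> 1.02"
proof -
  show 1: "1 \<le> r" using d g by (simp add: r)
  show 2: "r \<le> 1 + d * g / 2 + (d * g / 2)\<^sup>2"
    unfolding r using dg d g by (intro exp_bound) auto
  have "(d * g / 2)\<^sup>2 \<le> (1/264)\<^sup>2" using dg d g by (intro power_mono) auto
  then have "(d * g / 2)\<^sup>2 \<le> 1/2640" by (rule order_trans) (simp add: power2_eq_square)
  then show 3: "r \<le> 1.005" using 2 dg by simp
  have "r\<^sup>2 \<le> 1.005\<^sup>2" using 1 3 by (intro power_mono) auto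
  then show "r\<^sup>2 \<le> 1.02" by (rule order_trans) (simp add: power2_eq_square)
qed

text \<open>The factor of \<open>u \<bullet> x\<close> in the energy balance. Since
  \<open>r - \<eta>\<close> is \<open>d * g\<close> to first order, \<open>2 * d\<close> and
  \<open>2 * (r - \<eta>) / g\<close> cancel up to a nonpositive remainder; the rest, due to the
  rate \<open>k\<close>, is nonnegative. It therefore suffices to bound each of the two separately,
  and \<open>0.68\<close> covers \<open>1.005 * 2 / 3\<close>.\<close>

lemma cross_coefficient:
  "\<bar>2 * d + 2 * \<eta> / g - 2 * r * (1 - d * k) / g\<bar> \<le> d * (0.68 * \<mu> / g\<^sup>2)"
proof -
  have "2 * (d * g / 2) \<le> r - \<eta>"
    using two_sinh_ge[of "d * g / 2"] d g by (simp add: r \<eta>)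
  then have lo: "2 * d \<le> 2 * (r - \<eta>) / g" using g by (simp add: field_simps)
  have "r - \<eta> \<le> d * g + (d * g / 2)\<^sup>2" using r_bounds \<eta>_bounds by simp
  also have "\<dots> = d * (g + d * g\<^sup>2 / 4)" by (simp add: power2_eq_square algebra_simps)
  finally have "2 * (r - \<eta>) / g \<le> 2 * (d * (g + d * g\<^sup>2 / 4)) / g"
    using g by (intro divide_right_mono mult_left_mono) auto
  also have "\<dots> = 2 * d + d * (d * g) / 2" using g by (simp add: power2_eq_square field_simps)
  finally have hi: "2 * (r - \<eta>) / g \<le> 2 * d + d * (d * g) / 2" .
  have "d * (d * g) / 2 \<le> d * (\<mu> / (33 * g\<^sup>2)) / 2"
    using dg_le d by (intro divide_right_mono mult_left_mono) auto
  also have "\<dots> \<le> d * (0.68 * \<mu> / g\<^sup>2)" using d \<mu> g by (simp add: field_simps)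
  finally have a: "d * (d * g) / 2 \<le> d * (0.68 * \<mu> / g\<^sup>2)" .
  have "2 * r * (d * k) / g = r * (d * (2 * \<mu> / (3 * g\<^sup>2)))" using g by (simp add: k power2_eq_square)
  also have "\<dots> \<le> 1.005 * (d * (2 * \<mu> / (3 * g\<^sup>2)))" using r_bounds d \<mu> by (intro mult_right_mono) auto
  also have "\<dots> \<le> d * (0.68 * \<mu> / g\<^sup>2)" using d \<mu> g by (simp add: field_simps)
  finally have b: "2 * r * (d * k) / g \<le> d * (0.68 * \<mu> / g\<^sup>2)" .
  have c: "0 \<le> 2 * r * (d * k) / g" using r_bounds dk g by simp
  have "2 * d + 2 * \<eta> / g - 2 * r * (1 - d * k) / g = 2 * d - 2 * (r - \<eta>) / g + 2 * r * (d * k) / g"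
    using g by (simp add: field_simps)
  with lo hi a b c show ?thesis by linarith
qed

text \<open>The factor of \<open>(norm u)\<^sup>2\<close>. Friction contributes
  \<open>\<eta>\<^sup>2 - r\<^sup>2 \<le> - 2 * d * g\<close>; the other terms take back at most
  \<open>0.5 + 0.085 + 1/264\<close> times \<open>d * g\<close>.\<close>

lemma velocity_coefficient:
  "d\<^sup>2 + 2 * \<eta> * d / g + \<eta>\<^sup>2 - r\<^sup>2 * (1 - d * k) \<le> - 1.4 * d * g"
proof -
  have "2 * (d * g) \<le> r\<^sup>2 - \<eta>\<^sup>2"
    using two_sinh_ge[of "d * g"] d g by (simp add: r \<eta> flip: exp_double)
  moreover have "\<eta> * d / g \<le> 1 * d / 2 / (g / 2)" using \<eta>_bounds d g by (simp add: field_simps)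
  moreover have "d / g \<le> d * g / 4"
    using d g g2 by (simp add: field_simps power2_eq_square)
  moreover have "r\<^sup>2 * (d * k) \<le> 1.02 * (d * (g / 12))"
  proof -
    have "k \<le> g / 12" using \<mu> g g2 by (simp add: k field_simps power2_eq_square)
    then show ?thesis using r_bounds d g \<mu> by (intro mult_mono) (auto simp: k)
  qed
  moreover have "d\<^sup>2 \<le> d * g / 264"
  proof -
    have "d * d \<le> d * (1/264)" using d d_le by (intro mult_left_mono) auto
    also have "\<dots> \<le> d * (g/264)" using d g by (intro mult_left_mono) auto
    finally show ?thesis by (simp add: power2_eq_square)
  qed
  moreover have "0 < d * g" using d g by simp
  ultimately show ?thesis by (simp add: algebra_simps)
qed

text \<open>\<open>x\<close>, \<open>v\<close>, \<open>F0\<close>, \<open>F1\<close> stand for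
  differences between two chains, from which the common noise has gone, and \<open>u\<close> for the
  velocity difference in the middle of the Verlet step. Written in terms of \<open>u\<close>, the
  energy decay has two sources: \<open>d / g * (x \<bullet> F0)\<close> from convexity and
  \<open>d * g * (norm u)\<^sup>2\<close> from friction; \<open>x1 \<bullet> F1\<close> compensates
  the second kick.\<close>

lemma contraction:
  fixes x v u F0 F1 x1 v1 :: "'a::real_inner"
  assumes u: "u = \<eta> *\<^sub>R v - (d / 2) *\<^sub>R F0" and x1: "x1 = x + d *\<^sub>R u"
    and v1: "v1 = \<eta> *\<^sub>R (u - (d / 2) *\<^sub>R F1)"
    and F0: "(norm F0)\<^sup>2 \<le> x \<bullet> F0" "\<mu> * (norm x)\<^sup>2 \<le> x \<bullet> F0"
    and F1: "(norm F1)\<^sup>2 \<le> x1 \<bullet> F1"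
  shows "(norm x1)\<^sup>2 + 2 / g * (x1 \<bullet> v1) + (norm v1)\<^sup>2
    \<le> (1 - d * k) * ((norm x)\<^sup>2 + 2 / g * (x \<bullet> v) + (norm v)\<^sup>2)"
proof -
  have v: "v = r *\<^sub>R (u + (d / 2) *\<^sub>R F0)"
    using \<eta>r by (simp add: u mult.commute)
  define X Y S a0 a1 b0 b1 f0 f1 where
    "X = (norm x)\<^sup>2" and "Y = (norm u)\<^sup>2" and "S = u \<bullet> x" and "a0 = x \<bullet> F0" and "a1 = x1 \<bullet> F1" and
    "b0 = u \<bullet> F0" and "b1 = u \<bullet> F1" and "f0 = (norm F0)\<^sup>2" and "f1 = (norm F1)\<^sup>2"
  note defs = X_def Y_def S_def a0_def a1_def b0_def b1_def f0_def f1_def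
  have n0: "(norm x)\<^sup>2 + 2 / g * (x \<bullet> v) + (norm v)\<^sup>2
      = X + 2 * r / g * S + d * r / g * a0 + r\<^sup>2 * (Y + d * b0 + d\<^sup>2 / 4 * f0)"
    unfolding v defs power2_norm_eq_inner using g
    by (simp add: inner_add_left inner_add_right inner_commute field_simps power2_eq_square)
  have x1v1: "x1 \<bullet> v1 = \<eta> * (S + d * Y) - d * \<eta> / 2 * a1"
    unfolding v1 defs power2_norm_eq_inner
    by (subst inner_scaleR_right, subst inner_diff_right, subst (1) x1)
       (simp add: inner_add_left inner_commute algebra_simps)
  have n1: "(norm x1)\<^sup>2 = X + 2 * d * S + d\<^sup>2 * Y"
    unfolding x1 defs power2_norm_eq_inner
    by (simp add: inner_add_left inner_add_right inner_commute algebra_simps power2_eq_square)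
  have n2: "(norm v1)\<^sup>2 = \<eta>\<^sup>2 * (Y - d * b1 + d\<^sup>2 / 4 * f1)"
    unfolding v1 defs power2_norm_eq_inner
    by (simp add: inner_diff_left inner_diff_right inner_commute algebra_simps power2_eq_square)
  have pos: "0 \<le> Y" "0 \<le> X" "0 \<le> f0" "0 \<le> f1" "f0 \<le> a0" "\<mu> * X \<le> a0" "f1 \<le> a1" "0 < g" "0 < d"
    using F0 F1 g d by (auto simp: defs)
  have pos': "0 \<le> a0" "0 \<le> a1" using pos by auto
  \<comment> \<open>The new energy minus \<open>1 - d * k\<close> times the old one, sorted by
    monomials; the goal becomes \<open>E \<le> 0\<close>.\<close>
  define E where "E = d * k * X + (2 * d + 2 * \<eta> / g - 2 * r * (1 - d * k) / g) * S
      + (d\<^sup>2 + 2 * \<eta> * d / g + \<eta>\<^sup>2 - r\<^sup>2 * (1 - d * k)) * Y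
      + (- d * \<eta> / g * a1 + d\<^sup>2 * \<eta>\<^sup>2 / 4 * f1 - d * \<eta>\<^sup>2 * b1)
      + (- (1 - d * k) * d * r / g * a0) + (- (1 - d * k) * r\<^sup>2 * d * b0)
      + (- (1 - d * k) * r\<^sup>2 * d\<^sup>2 / 4 * f0)"
  have eq: "((norm x1)\<^sup>2 + 2 / g * (x1 \<bullet> v1) + (norm v1)\<^sup>2)
    - (1 - d * k) * ((norm x)\<^sup>2 + 2 / g * (x \<bullet> v) + (norm v)\<^sup>2) = E"
    unfolding n0 n1 n2 x1v1 E_def using g by (simp add: field_simps power2_eq_square)
  \<comment> \<open>As \<open>k = \<mu> / (3 * g)\<close>, the demanded rate uses a third of
    \<open>d / g * a0\<close>.\<close>
  have T1: "d * k * X \<le> d / (3 * g) * a0"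
    using mult_left_mono[OF pos(6), of "d / (3 * g)"] pos by (simp add: k)
  have T2: "(2 * d + 2 * \<eta> / g - 2 * r * (1 - d * k) / g) * S \<le> 0.15 * d / g * a0 + 0.05 * d * g * Y"
  proof -
    \<comment> \<open>The Young weight \<open>0.15 * d * \<mu> / g\<close> charges the position part
      to \<open>a0\<close> through \<open>\<mu> * X \<le> a0\<close>; the velocity part is then of
      order \<open>d * \<mu> / g ^ 3\<close>, small against \<open>d * g\<close>.\<close>
    have "(2 * d + 2 * \<eta> / g - 2 * r * (1 - d * k) / g) * S
       \<le> (0.15 * d * \<mu> / g) * X + (d * (0.68 * \<mu> / g\<^sup>2))\<^sup>2 / (4 * (0.15 * d * \<mu> / g)) * Y"
      unfolding defs using pos \<mu> by (intro weighted_cauchy_schwarz cross_coefficient) auto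
    also have "(0.15 * d * \<mu> / g) * X \<le> 0.15 * d / g * a0"
      using mult_left_mono[OF pos(6), of "0.15 * d / g"] pos by (simp add: mult_ac)
    also have "(d * (0.68 * \<mu> / g\<^sup>2))\<^sup>2 / (4 * (0.15 * d * \<mu> / g)) = d * (289 / 375 * (\<mu> / g ^ 3))"
      using pos \<mu> by (simp add: power2_eq_square power3_eq_cube field_simps)
    also have "d * (289 / 375 * (\<mu> / g ^ 3)) * Y \<le> d * (0.05 * g) * Y"
    proof (intro mult_right_mono mult_left_mono)
      have "2 ^ 4 \<le> g ^ 4" using g by (intro power_mono) auto
      then have "\<mu> \<le> g ^ 4 / 16" using \<mu> by simp
      then have "\<mu> / g ^ 3 \<le> g / 16" using pos by (simp add: field_simps power3_eq_cube eval_nat_numeral)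
      then show "289 / 375 * (\<mu> / g ^ 3) \<le> 0.05 * g" using pos by simp
    qed (use pos in auto)
    finally show ?thesis by (simp add: mult_ac)
  qed
  have T3: "(d\<^sup>2 + 2 * \<eta> * d / g + \<eta>\<^sup>2 - r\<^sup>2 * (1 - d * k)) * Y \<le> - 1.4 * d * g * Y"
    using velocity_coefficient pos by (intro mult_right_mono) auto
  \<comment> \<open>\<open>F1\<close> occurs only here. Its share \<open>0.9\<close> from Young's
    inequality and \<open>0.01\<close> from the quadratic term stay below
    \<open>\<eta> \<ge> 0.99\<close>, so \<open>a1\<close> disappears and a velocity term is
    left.\<close>
  have T4: "- d * \<eta> / g * a1 + d\<^sup>2 * \<eta>\<^sup>2 / 4 * f1 - d * \<eta>\<^sup>2 * b1 \<le> 0.28 * d * g * Y"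
  proof -
    have e1: "\<eta>\<^sup>2 \<le> 1" using \<eta>_bounds by (simp add: power_le_one)
    have "- d * \<eta>\<^sup>2 * b1 \<le> (0.9 * d / g) * f1 + d\<^sup>2 / (4 * (0.9 * d / g)) * Y"
      unfolding defs
      using pos e1 by (intro weighted_cauchy_schwarz) (auto simp: abs_mult mult_left_le)
    also have "d\<^sup>2 / (4 * (0.9 * d / g)) = d * g / 3.6" using pos by (simp add: power2_eq_square field_simps)
    also have "(0.9 * d / g) * f1 \<le> (0.9 * d / g) * a1" using pos by (intro mult_left_mono) auto
    finally have 1: "- d * \<eta>\<^sup>2 * b1 \<le> (0.9 * d / g) * a1 + d * g / 3.6 * Y" by simp
    have "d\<^sup>2 * \<eta>\<^sup>2 / 4 * f1 \<le> d\<^sup>2 * 1 / 4 * a1" using pos e1 by (intro mult_mono divide_right_mono) auto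
    also have "d\<^sup>2 * 1 / 4 * a1 \<le> 0.01 * d / g * a1"
    proof (intro mult_right_mono)
      have "d * (d * g) \<le> d * (1/132)" using dg pos by (intro mult_left_mono) auto
      then show "d\<^sup>2 * 1 / 4 \<le> 0.01 * d / g" using pos by (simp add: field_simps power2_eq_square)
    qed (use pos' in auto)
    finally have 2: "d\<^sup>2 * \<eta>\<^sup>2 / 4 * f1 \<le> 0.01 * d / g * a1" .
    have "0.99 * (d / g * a1) \<le> \<eta> * (d / g * a1)" using \<eta>_bounds pos pos' by (intro mult_right_mono) auto
    moreover have "0 \<le> d * g * Y" "0 \<le> d / g * a1" using pos pos' by simp_all
    ultimately show ?thesis using 1 2 by (simp add: algebra_simps)
  qed
  have t: "0.99 \<le> 1 - d * k" "1 - d * k \<le> 1" using dk by auto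
  have T5: "- (1 - d * k) * d * r / g * a0 \<le> - 0.99 * d / g * a0"
  proof -
    have "0.99 * 1 * (d / g * a0) \<le> (1 - d * k) * r * (d / g * a0)"
      using t r_bounds pos pos' by (intro mult_right_mono mult_mono) auto
    moreover have "- (1 - d * k) * d * r / g * a0 = - ((1 - d * k) * r * (d / g * a0))" using pos by (simp add: field_simps)
    ultimately show ?thesis by simp
  qed
  have T6: "- (1 - d * k) * r\<^sup>2 * d * b0 \<le> 0.4 * d / g * a0 + 0.67 * d * g * Y"
  proof -
    have "(1 - d * k) * r\<^sup>2 * d \<le> 1 * 1.02 * d" using t r_bounds pos by (intro mult_mono) auto
    moreover have "0 \<le> (1 - d * k) * r\<^sup>2 * d" using t pos by (intro mult_nonneg_nonneg) auto
    ultimately have "- ((1 - d * k) * r\<^sup>2 * d) * b0 \<le> (0.4 * d / g) * f0 + (1.02 * d)\<^sup>2 / (4 * (0.4 * d / g)) * Y"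
      unfolding defs using pos by (intro weighted_cauchy_schwarz) auto
    also have "(0.4 * d / g) * f0 \<le> (0.4 * d / g) * a0" using pos by (intro mult_left_mono) auto
    also have "(1.02 * d)\<^sup>2 / (4 * (0.4 * d / g)) * Y \<le> 0.67 * d * g * Y"
    proof (intro mult_right_mono)
      have "(1.02 * d)\<^sup>2 / (4 * (0.4 * d / g)) = 1.0404 / 1.6 * (d * g)"
        using pos by (simp add: power2_eq_square field_simps)
      also have "\<dots> \<le> 0.67 * (d * g)" using pos by (intro mult_right_mono) auto
      finally show "(1.02 * d)\<^sup>2 / (4 * (0.4 * d / g)) \<le> 0.67 * d * g" by simp
    qed (use pos in auto)
    finally show ?thesis by (simp only: mult_minus_left)
  qed
  have T7: "- (1 - d * k) * r\<^sup>2 * d\<^sup>2 / 4 * f0 \<le> 0"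
  proof -
    have "0 \<le> (1 - d * k) * (r\<^sup>2 * d\<^sup>2 / 4 * f0)" using t pos by (intro mult_nonneg_nonneg) auto
    then show ?thesis by (simp add: algebra_simps)
  qed
  \<comment> \<open>The balance: \<open>d / g * a0\<close> receives
    \<open>1/3 + 0.15 - 0.99 + 0.4 = - 8/75\<close>, and \<open>d * g * Y\<close> receives
    \<open>0.05 - 1.4 + 0.28 + 0.67 = - 0.4\<close>.\<close>
  have "E \<le> d / (3 * g) * a0 + (0.15 * d / g * a0 + 0.05 * d * g * Y) + (- 1.4 * d * g * Y) + 0.28 * d * g * Y
      + (- 0.99 * d / g * a0) + (0.4 * d / g * a0 + 0.67 * d * g * Y) + 0"
    unfolding E_def by (intro add_mono T1 T2 T3 T4 T5 T6 T7)
  also have "\<dots> = - (8 / 75) * (d / g * a0) - 0.4 * (d * g * Y)"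
    using pos by (simp add: field_simps)
  also have "\<dots> \<le> 0"
  proof -
    have "0 \<le> d / g * a0" "0 \<le> d * g * Y" using pos pos' by simp_all
    then show ?thesis by linarith
  qed
  finally have "E \<le> 0" .
  with eq show ?thesis by simp
qed

end

subsection \<open>The standard Gaussian measure\<close>

lemma sets_std_gaussian [simp, measurable_cong]: "sets std_gaussian = sets borel"
  by (simp add: std_gaussian_def)

lemma space_std_gaussian [simp]: "space std_gaussian = UNIV"
  by (simp add: std_gaussian_def)

definition gaussian_density :: "'a::euclidean_space \<Rightarrow> real" where
  "gaussian_density x = (1 / sqrt (2 * pi)) ^ DIM('a) * exp (- (norm x)\<^sup>2 / 2)"

lemma gaussian_density_pos: "0 < gaussian_density x"
  by (simp add: gaussian_density_def)

lemma measurable_gaussian_density [measurable]: "gaussian_density \<in> borel_measurable borel"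
  unfolding gaussian_density_def[abs_def] by measurable

lemma prod_std_normal_density:
  "(\<Prod>b\<in>Basis. std_normal_density (x \<bullet> b)) = gaussian_density (x :: 'a::euclidean_space)"
proof -
  have "(\<Sum>b\<in>Basis. - (x \<bullet> b)\<^sup>2 / 2) = - (norm x)\<^sup>2 / 2"
  proof -
    have "(norm x)\<^sup>2 = (\<Sum>b\<in>Basis. (x \<bullet> b)\<^sup>2)"
      unfolding power2_norm_eq_inner by (subst euclidean_inner) (simp add: power2_eq_square)
    then show ?thesis by (simp add: sum_negf flip: sum_divide_distrib)
  qed
  moreover have "(\<Prod>b\<in>Basis. std_normal_density (x \<bullet> b))
      = (\<Prod>b\<in>(Basis::'a set). 1 / sqrt (2 * pi)) * (\<Prod>b\<in>Basis. exp (- (x \<bullet> b)\<^sup>2 / 2))"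
    by (simp add: std_normal_density_def prod.distrib[symmetric] del: prod_constant)
  ultimately show ?thesis by (simp add: gaussian_density_def flip: exp_sum)
qed

lemma std_gaussian_eq: "std_gaussian = density lborel (\<lambda>x. ennreal (gaussian_density x))"
  by (simp add: std_gaussian_def prod_std_normal_density)

text \<open>Fubini for the product density; total mass, marginals and independence of the
  coordinates all follow from boxes.\<close>

lemma emeasure_std_gaussian_box:
  fixes A :: "'a::euclidean_space \<Rightarrow> real set"
  assumes [measurable]: "\<And>b. b \<in> Basis \<Longrightarrow> A b \<in> sets borel"
  shows "emeasure std_gaussian {x. \<forall>b\<in>Basis. x \<bullet> b \<in> A b}
    = (\<Prod>b\<in>Basis. emeasure (density lborel std_normal_density) (A b))"
proof -
  have S: "{x::'a. \<forall>b\<in>Basis. x \<bullet> b \<in> A b} \<in> sets borel" by measurable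
  have "indicator {x. \<forall>b\<in>Basis. x \<bullet> b \<in> A b} x = (\<Prod>b\<in>Basis. indicator (A b) (x \<bullet> b) :: ennreal)" for x :: 'a
    by (auto simp: indicator_def)
  then have "emeasure std_gaussian {x. \<forall>b\<in>Basis. x \<bullet> b \<in> A b}
     = (\<integral>\<^sup>+x. (\<Prod>b\<in>Basis. ennreal (std_normal_density (x \<bullet> b)) * indicator (A b) (x \<bullet> b)) \<partial>lborel)"
    using S by (simp add: std_gaussian_def emeasure_density prod.distrib prod_ennreal)
  also have "\<dots> = (\<Prod>b\<in>Basis. (\<integral>\<^sup>+y. ennreal (std_normal_density y) * indicator (A b) y \<partial>lborel))"
    by (rule nn_integral_lborel_prod) auto
  also have "\<dots> = (\<Prod>b\<in>Basis. emeasure (density lborel std_normal_density) (A b))"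
    by (intro prod.cong refl) (simp add: emeasure_density)
  finally show ?thesis .
qed

lemma emeasure_std_normal_UNIV: "emeasure (density lborel std_normal_density) UNIV = 1"
  using prob_space.emeasure_space_1[OF prob_space_normal_density[of 1 0]] by simp

lemma prob_space_std_gaussian: "prob_space (std_gaussian :: 'a::euclidean_space measure)"
proof
  show "emeasure std_gaussian (space (std_gaussian :: 'a measure)) = 1"
    using emeasure_std_gaussian_box[of "\<lambda>_::'a. UNIV"] by (simp add: emeasure_std_normal_UNIV)
qed

interpretation std_gaussian: prob_space "std_gaussian :: 'a::euclidean_space measure"
  by (rule prob_space_std_gaussian)

lemma std_gaussian_coordinate:
  assumes b: "b \<in> Basis"
  shows "distributed std_gaussian lborel (\<lambda>x. x \<bullet> b) std_normal_density"
  unfolding distributed_def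
proof (intro conjI)
  show "distr std_gaussian lborel (\<lambda>x. x \<bullet> b) = density lborel (\<lambda>x. ennreal (std_normal_density x))"
  proof (rule measure_eqI)
    fix A assume "A \<in> sets (distr std_gaussian lborel (\<lambda>x. x \<bullet> b))"
    then have [measurable]: "A \<in> sets borel" by simp
    have "{x::'a. x \<bullet> b \<in> A} = {x. \<forall>c\<in>Basis. x \<bullet> c \<in> (if c = b then A else UNIV)}" using b by auto
    then have "emeasure std_gaussian {x. x \<bullet> b \<in> A}
        = (\<Prod>c\<in>Basis. emeasure (density lborel std_normal_density) (if c = b then A else UNIV))"
      by (simp only:) (rule emeasure_std_gaussian_box, auto)
    also have "\<dots> = emeasure (density lborel std_normal_density) A"
      using b by (subst prod.remove[OF finite_Basis b]) (simp add: emeasure_std_normal_UNIV)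
    finally show "emeasure (distr std_gaussian lborel (\<lambda>x. x \<bullet> b)) A = emeasure (density lborel std_normal_density) A"
      by (subst emeasure_distr) (auto simp: vimage_def)
  qed simp
qed auto

lemma indep_std_gaussian_coordinates:
  "prob_space.indep_vars (std_gaussian :: 'a::euclidean_space measure) (\<lambda>_. borel) (\<lambda>b x. x \<bullet> b) Basis"
proof -
  let ?F = "\<lambda>b. {(\<lambda>x::'a. x \<bullet> b) -` A \<inter> space std_gaussian |A. A \<in> sets borel}"
  have "std_gaussian.indep_sets ?F Basis"
  \<comment> \<open>Each system of events contains the whole space, so factorisation over all of
    \<open>Basis\<close> at once gives it for subfamilies too.\<close>
  proof (rule iffD2[OF std_gaussian.indep_sets_finite], goal_cases)
    case (3 b)
    show ?case by (auto intro!: measurable_sets_borel)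
  next
    case (4 b)
    show ?case by (auto intro!: exI[of _ UNIV])
  next
    case 5
    show ?case
    proof
    fix B assume B: "B \<in> Pi Basis ?F"
    then have "\<forall>b\<in>Basis. \<exists>A. B b = (\<lambda>x. x \<bullet> b) -` A \<and> A \<in> sets borel" by (auto simp: Pi_iff)
    then obtain A where A: "\<And>b. b \<in> Basis \<Longrightarrow> B b = (\<lambda>x. x \<bullet> b) -` A b" "\<And>b. b \<in> Basis \<Longrightarrow> A b \<in> sets borel"
      by metis
    have eq: "(\<Inter>b\<in>Basis. B b) = {x. \<forall>b\<in>Basis. x \<bullet> b \<in> A b}" using A by auto
    have one: "emeasure std_gaussian (B b) = emeasure (density lborel std_normal_density) (A b)" if b: "b \<in> Basis" for b
    proof -
      have "emeasure std_gaussian (B b) = emeasure (distr std_gaussian lborel (\<lambda>x. x \<bullet> b)) (A b)"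
        using A b by (subst emeasure_distr) auto
      then show ?thesis using std_gaussian_coordinate[OF b] by (simp add: distributed_def)
    qed
    have "ennreal (measure std_gaussian (\<Inter>b\<in>Basis. B b)) = (\<Prod>b\<in>Basis. ennreal (measure std_gaussian (B b)))"
      unfolding eq std_gaussian.emeasure_eq_measure[symmetric]
      by (subst emeasure_std_gaussian_box[OF A(2)]) (auto intro!: prod.cong simp: one)
    then show "measure std_gaussian (\<Inter>b\<in>Basis. B b) = (\<Prod>b\<in>Basis. measure std_gaussian (B b))"
      by (simp add: prod_ennreal prod_nonneg)
    qed
  qed auto
  then show ?thesis by (simp add: std_gaussian.indep_vars_def2)
qed

lemma std_gaussian_inner:
  fixes h :: "'a::euclidean_space"
  assumes h: "h \<noteq> 0"
  shows "distributed std_gaussian lborel (\<lambda>x. x \<bullet> h) (normal_density 0 (norm h))"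
proof -
  \<comment> \<open>Normal summands must have positive variance, so coordinates orthogonal to
    \<open>h\<close> are dropped; \<open>h \<noteq> 0\<close> keeps the sum nonempty.\<close>
  define B where "B = {b \<in> Basis. h \<bullet> b \<noteq> 0}"
  have B: "finite B" "B \<subseteq> Basis" by (auto simp: B_def)
  have sB: "(\<Sum>b\<in>B. f b * (h \<bullet> b)) = (\<Sum>b\<in>Basis. f b * (h \<bullet> b))" for f :: "'a \<Rightarrow> real"
    by (rule sum.mono_neutral_left) (auto simp: B_def)
  have "B \<noteq> {}" using h euclidean_eqI[of h 0] by (auto simp: B_def)
  have "distributed std_gaussian lborel (\<lambda>x. \<Sum>b\<in>B. (h \<bullet> b) * (x \<bullet> b))
      (normal_density (\<Sum>b\<in>B. 0) (sqrt (\<Sum>b\<in>B. \<bar>h \<bullet> b\<bar>\<^sup>2)))"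
  proof (rule std_gaussian.sum_indep_normal[OF B(1) \<open>B \<noteq> {}\<close>])
    have "std_gaussian.indep_vars (\<lambda>_. borel) (\<lambda>b x. x \<bullet> b) B"
      by (rule std_gaussian.indep_vars_subset[OF indep_std_gaussian_coordinates B(2)])
    then show "std_gaussian.indep_vars (\<lambda>_. borel) (\<lambda>b x. h \<bullet> b * (x \<bullet> b)) B"
      by (rule std_gaussian.indep_vars_compose2) auto
  next
    fix b assume b: "b \<in> B"
    then show "0 < \<bar>h \<bullet> b\<bar>" by (simp add: B_def)
    have "distributed std_gaussian lborel (\<lambda>x. 0 + (h \<bullet> b) * (x \<bullet> b)) (normal_density (0 + (h \<bullet> b) * 0) (\<bar>h \<bullet> b\<bar> * 1))"
      using b by (intro std_gaussian.normal_density_affine std_gaussian_coordinate) (auto simp: B_def)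
    then show "distributed std_gaussian lborel (\<lambda>x. (h \<bullet> b) * (x \<bullet> b)) (normal_density 0 \<bar>h \<bullet> b\<bar>)" by simp
  qed
  moreover have "(\<Sum>b\<in>B. (h \<bullet> b) * (x \<bullet> b)) = x \<bullet> h" for x
    using sB[of "\<lambda>b. x \<bullet> b"] by (simp add: euclidean_inner[of x h] mult.commute)
  moreover have "sqrt (\<Sum>b\<in>B. \<bar>h \<bullet> b\<bar>\<^sup>2) = norm h"
    using sB[of "\<lambda>b. h \<bullet> b"] by (simp add: norm_eq_sqrt_inner euclidean_inner[of h h] power2_eq_square)
  ultimately show ?thesis by simp
qed

text \<open>The law of \<open>x \<bullet> h\<close> has density at most
  \<open>1 / (norm h * sqrt (2 * pi))\<close>, and the interval has length
  \<open>2 * c\<close>.\<close>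

lemma std_gaussian_slab:
  fixes h :: "'a::euclidean_space"
  assumes h: "h \<noteq> 0" and c: "0 \<le> c"
  shows "measure std_gaussian {x. - c \<le> x \<bullet> h \<and> x \<bullet> h < c} \<le> 2 * c / (norm h * sqrt (2 * pi))"
proof -
  have "emeasure std_gaussian {x. - c \<le> x \<bullet> h \<and> x \<bullet> h < c} = emeasure (distr std_gaussian lborel (\<lambda>x. x \<bullet> h)) {- c..<c}"
    by (subst emeasure_distr) (auto simp: vimage_def)
  also have "\<dots> = (\<integral>\<^sup>+t. ennreal (normal_density 0 (norm h) t) * indicator {- c..<c} t \<partial>lborel)"
    using std_gaussian_inner[OF h] by (simp add: distributed_def emeasure_density)
  also have "\<dots> \<le> (\<integral>\<^sup>+t. ennreal (1 / (norm h * sqrt (2 * pi))) * indicator {- c..<c} t \<partial>lborel)"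
  proof (intro nn_integral_mono mult_right_mono ennreal_leI)
    fix t
    have "normal_density 0 (norm h) t \<le> 1 / sqrt (2 * pi * (norm h)\<^sup>2) * 1"
      unfolding normal_density_def by (intro mult_left_mono) auto
    then show "normal_density 0 (norm h) t \<le> 1 / (norm h * sqrt (2 * pi))"
      by (simp add: real_sqrt_mult mult_ac)
  qed simp
  also have "\<dots> = ennreal (2 * c / (norm h * sqrt (2 * pi)))"
    using c by (simp add: nn_integral_cmult ennreal_mult[symmetric])
  finally show ?thesis by (simp add: std_gaussian.emeasure_eq_measure c)
qed

section \<open>Total variation between translates of a Gaussian\<close>

lemma integral_std_gaussian:
  fixes f :: "'a::euclidean_space \<Rightarrow> real"
  assumes [measurable]: "f \<in> borel_measurable borel"
  shows "(\<integral>x. f x \<partial>std_gaussian) = (\<integral>x. gaussian_density x * f x \<partial>lborel)"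
  unfolding std_gaussian_eq
  by (subst integral_real_density) (auto intro!: less_imp_le gaussian_density_pos)

lemma integrable_gaussian_density: "integrable lborel (gaussian_density :: 'a::euclidean_space \<Rightarrow> real)"
proof (rule integrableI_nonneg)
  show "(\<integral>\<^sup>+x. ennreal (gaussian_density (x::'a)) \<partial>lborel) < \<infinity>"
    using std_gaussian.emeasure_space_1[where 'a='a] by (simp add: std_gaussian_eq emeasure_density)
qed (auto intro!: always_eventually less_imp_le gaussian_density_pos)

lemma integral_std_gaussian_shift:
  fixes f :: "'a::euclidean_space \<Rightarrow> real"
  assumes [measurable]: "f \<in> borel_measurable borel"
  shows "(\<integral>x. f (x + h) \<partial>std_gaussian) = (\<integral>x. gaussian_density (x - h) * f x \<partial>lborel)"
proof -
  have "(\<integral>x. gaussian_density (x - h) * f x \<partial>lborel) = (\<integral>x. gaussian_density (x - h) * f x \<partial>distr lborel borel ((+) h))"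
    by (simp add: lborel_distr_plus)
  also have "\<dots> = (\<integral>x. gaussian_density x * f (x + h) \<partial>lborel)"
    by (subst integral_distr) (auto simp: add.commute)
  also have "\<dots> = (\<integral>x. f (x + h) \<partial>std_gaussian)"
    by (rule integral_std_gaussian[symmetric]) measurable
  finally show ?thesis by simp
qed

text \<open>Neyman--Pearson: the half-space on which the shifted density is the larger one is extremal.\<close>

lemma gaussian_shift_bound:
  fixes f :: "'a::euclidean_space \<Rightarrow> real"
  assumes [measurable]: "f \<in> borel_measurable borel" and f: "\<And>x. 0 \<le> f x" "\<And>x. f x \<le> 1"
  shows "(\<integral>x. f (x + h) \<partial>std_gaussian) - (\<integral>x. f x \<partial>std_gaussian) \<le> norm h / sqrt (2 * pi)"
proof (cases "h = 0")
  case h: False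
  define A where "A = {x::'a. (norm h)\<^sup>2 / 2 \<le> x \<bullet> h}"
  have A [measurable]: "A \<in> sets borel" unfolding A_def by measurable
  have int: "integrable lborel (\<lambda>x. gaussian_density (x - a) * q x)"
    if [measurable]: "q \<in> borel_measurable borel" and "\<And>x. 0 \<le> q x" "\<And>x. q x \<le> 1" for q :: "'a \<Rightarrow> real" and a
  proof (rule Bochner_Integration.integrable_bound)
    have "integrable (distr lborel borel ((+) (-a))) (gaussian_density :: 'a \<Rightarrow> real)"
      by (simp add: lborel_distr_plus integrable_gaussian_density)
    then show "integrable lborel (\<lambda>x. gaussian_density (x - a))"
      by (subst (asm) integrable_distr_eq) auto
    show "AE x in lborel. norm (gaussian_density (x - a) * q x) \<le> norm (gaussian_density (x - a))"
      using that gaussian_density_pos by (auto simp: abs_mult intro!: mult_left_le)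
  qed measurable
  have pt: "(gaussian_density (x - h) - gaussian_density x) * f x
      \<le> (gaussian_density (x - h) - gaussian_density x) * indicator A x" for x
  proof -
    have n: "(norm (x - h))\<^sup>2 = (norm x)\<^sup>2 - 2 * (x \<bullet> h) + (norm h)\<^sup>2"
      by (simp add: power2_norm_eq_inner inner_diff_left inner_diff_right inner_commute)
    show ?thesis
    proof (cases "x \<in> A")
      case True
      then have "(norm (x - h))\<^sup>2 \<le> (norm x)\<^sup>2" by (simp add: n A_def)
      then have "gaussian_density x \<le> gaussian_density (x - h)"
        unfolding gaussian_density_def by (intro mult_left_mono) auto
      then show ?thesis using True f by (simp add: mult_left_le)
    next
      case False
      then have "(norm x)\<^sup>2 \<le> (norm (x - h))\<^sup>2" by (simp add: n A_def)
      then have "gaussian_density (x - h) \<le> gaussian_density x"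
        unfolding gaussian_density_def by (intro mult_left_mono) auto
      then show ?thesis using False f by (simp add: mult_nonpos_nonneg)
    qed
  qed
  have diff: "(\<integral>x. q (x + h) \<partial>std_gaussian) - (\<integral>x. q x \<partial>std_gaussian)
      = (\<integral>x. (gaussian_density (x - h) - gaussian_density x) * q x \<partial>lborel)"
    and ig: "integrable lborel (\<lambda>x. (gaussian_density (x - h) - gaussian_density x) * q x)"
    if q: "q \<in> borel_measurable borel" "\<And>x. 0 \<le> q x" "\<And>x. q x \<le> 1" for q :: "'a \<Rightarrow> real"
    using int[OF q, of h] int[OF q, of 0]
    by (simp_all add: integral_std_gaussian_shift integral_std_gaussian q left_diff_distrib)
  have "(\<integral>x. f (x + h) \<partial>std_gaussian) - (\<integral>x. f x \<partial>std_gaussian)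
     \<le> (\<integral>x. indicator A (x + h) \<partial>std_gaussian) - (\<integral>x. indicator A x \<partial>std_gaussian)"
    using f pt by (subst (1 2) diff) (auto intro!: integral_mono ig)
  also have "(\<integral>x. indicator A (x + h) \<partial>std_gaussian) = measure std_gaussian {x. - (norm h)\<^sup>2 / 2 \<le> x \<bullet> h}"
  proof -
    have "indicator A (x + h) = (indicator {x. - (norm h)\<^sup>2 / 2 \<le> x \<bullet> h} x :: real)" for x
      by (auto simp: A_def indicator_def inner_add_left power2_norm_eq_inner)
    then show ?thesis by simp
  qed
  also have "(\<integral>x. indicator A x \<partial>std_gaussian) = measure std_gaussian A" by simp
  also have "measure std_gaussian {x. - (norm h)\<^sup>2 / 2 \<le> x \<bullet> h} - measure std_gaussian A
     = measure std_gaussian ({x. - (norm h)\<^sup>2 / 2 \<le> x \<bullet> h} - A)"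
  proof (rule std_gaussian.finite_measure_Diff[symmetric])
    show "A \<subseteq> {x. - (norm h)\<^sup>2 / 2 \<le> x \<bullet> h}"
    proof
      fix x assume "x \<in> A"
      then have "(norm h)\<^sup>2 / 2 \<le> x \<bullet> h" by (simp add: A_def)
      then have "- (norm h)\<^sup>2 / 2 \<le> x \<bullet> h" using zero_le_power2[of "norm h"] by linarith
      then show "x \<in> {x. - (norm h)\<^sup>2 / 2 \<le> x \<bullet> h}" by blast
    qed
  qed auto
  also have "{x. - (norm h)\<^sup>2 / 2 \<le> x \<bullet> h} - A = {x. - ((norm h)\<^sup>2 / 2) \<le> x \<bullet> h \<and> x \<bullet> h < (norm h)\<^sup>2 / 2}"
    by (auto simp: A_def)
  \<comment> \<open>The two half-spaces differ by a slab on which \<open>x \<bullet> h\<close>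
    ranges over an interval of length \<open>(norm h)\<^sup>2\<close>; one factor
    \<open>norm h\<close> cancels against the peak of the density.\<close>
  also have "measure std_gaussian \<dots> \<le> 2 * ((norm h)\<^sup>2 / 2) / (norm h * sqrt (2 * pi))"
    by (rule std_gaussian_slab[OF h]) simp
  also have "\<dots> = norm h / sqrt (2 * pi)" using h by (simp add: power2_eq_square)
  finally show ?thesis .
qed simp

text \<open>The norm of the product is Euclidean, so the exponents add. The two increments of a step
  can then be shifted together, as one Gaussian vector.\<close>

lemma pair_std_gaussian:
  "std_gaussian \<Otimes>\<^sub>M std_gaussian = (std_gaussian :: ('a::euclidean_space \<times> 'b::euclidean_space) measure)"
proof -
  have "std_gaussian \<Otimes>\<^sub>M std_gaussian = density (lborel \<Otimes>\<^sub>M lborel)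
      (\<lambda>(x::'a, y::'b). ennreal (gaussian_density x) * ennreal (gaussian_density y))"
    unfolding std_gaussian_eq
    by (rule pair_measure_density)
       (auto simp flip: std_gaussian_eq intro: sigma_finite_lborel std_gaussian.sigma_finite_measure_axioms)
  also have "\<dots> = std_gaussian"
    unfolding std_gaussian_eq lborel_prod
  proof (intro arg_cong2[where f=density] refl ext, safe)
    fix x :: 'a and y :: 'b
    have "exp (- (norm x)\<^sup>2 / 2) * exp (- (norm y)\<^sup>2 / 2) = exp (- (norm (x, y))\<^sup>2 / 2)"
      unfolding exp_add[symmetric] by (simp add: norm_Pair field_simps)
    then have "gaussian_density x * gaussian_density y = gaussian_density (x, y)"
      by (simp add: gaussian_density_def power_add)
    then show "ennreal (gaussian_density x) * ennreal (gaussian_density y) = ennreal (gaussian_density (x, y))"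
      by (simp add: ennreal_mult[symmetric] gaussian_density_pos less_imp_le)
  qed
  finally show ?thesis .
qed

lemma nn_integral_lborel_affine:
  fixes f :: "'a::euclidean_space \<Rightarrow> ennreal"
  assumes [measurable]: "f \<in> borel_measurable borel" and c: "c \<noteq> 0"
  shows "(\<integral>\<^sup>+x. f x \<partial>lborel) = ennreal (\<bar>c\<bar> ^ DIM('a)) * (\<integral>\<^sup>+x. f (t + c *\<^sub>R x) \<partial>lborel)"
  by (subst lborel_affine[OF c, of t]) (simp add: nn_integral_density nn_integral_distr nn_integral_cmult)

text \<open>Completing the square: with \<open>w = a *\<^sub>R v + b *\<^sub>R u\<close>, the joint density of \<open>(v, w)\<close> factors through
  \<open>w\<close> and \<open>v - a *\<^sub>R w\<close>.\<close>

lemma std_gaussian_rotation: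
  fixes f :: "'a::euclidean_space \<Rightarrow> ennreal"
  assumes [measurable]: "f \<in> borel_measurable borel" and ab: "a\<^sup>2 + b\<^sup>2 = 1" "0 < b"
  shows "(\<integral>\<^sup>+v. \<integral>\<^sup>+u. f (a *\<^sub>R v + b *\<^sub>R u) \<partial>std_gaussian \<partial>std_gaussian) = (\<integral>\<^sup>+w. f w \<partial>std_gaussian)"
proof -
  let ?\<phi> = "\<lambda>x::'a. ennreal (gaussian_density x)"
  have key: "gaussian_density v * gaussian_density ((1/b) *\<^sub>R (w - a *\<^sub>R v))
      = gaussian_density w * gaussian_density ((1/b) *\<^sub>R (v - a *\<^sub>R w))" for v w :: 'a
  proof -
    have "(norm v)\<^sup>2 + (norm ((1/b) *\<^sub>R (w - a *\<^sub>R v)))\<^sup>2 = (norm w)\<^sup>2 + (norm ((1/b) *\<^sub>R (v - a *\<^sub>R w)))\<^sup>2"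
    proof -
      have 1: "(norm ((1/b) *\<^sub>R (p - a *\<^sub>R q)))\<^sup>2 = (p \<bullet> p - 2 * a * (p \<bullet> q) + (1 - b\<^sup>2) * (q \<bullet> q)) / b\<^sup>2" for p q :: 'a
      proof -
        have "(norm (p - a *\<^sub>R q))\<^sup>2 = p \<bullet> p - 2 * a * (p \<bullet> q) + a\<^sup>2 * (q \<bullet> q)"
          unfolding power2_norm_eq_inner
          by (simp add: inner_diff_left inner_diff_right inner_commute power2_eq_square)
        moreover have "a\<^sup>2 = 1 - b\<^sup>2" using ab by simp
        ultimately show ?thesis by (simp add: power_divide)
      qed
      have 2: "P + (W - 2 * a * C + (1 - b\<^sup>2) * P) / b\<^sup>2 = W + (P - 2 * a * C + (1 - b\<^sup>2) * W) / b\<^sup>2"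
        for P W C :: real using ab(2) by (simp add: field_simps)
      show ?thesis unfolding 1 unfolding inner_commute[of w v] power2_norm_eq_inner by (rule 2)
    qed
    then have "exp (- (norm v)\<^sup>2 / 2) * exp (- (norm ((1/b) *\<^sub>R (w - a *\<^sub>R v)))\<^sup>2 / 2)
       = exp (- (norm w)\<^sup>2 / 2) * exp (- (norm ((1/b) *\<^sub>R (v - a *\<^sub>R w)))\<^sup>2 / 2)"
      unfolding exp_add[symmetric] by (simp add: field_simps)
    then show ?thesis unfolding gaussian_density_def by (simp add: mult_ac)
  qed
  \<comment> \<open>Total mass of a Gaussian of variance \<open>b\<^sup>2\<close> centred at
    \<open>c\<close>, applied below with \<open>c = a *\<^sub>R w\<close>.\<close>
  have mass: "ennreal ((1/b) ^ DIM('a)) * (\<integral>\<^sup>+v. ?\<phi> ((1/b) *\<^sub>R (v - c)) \<partial>lborel) = 1" for c :: 'a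
  proof -
    have "(\<integral>\<^sup>+v. ?\<phi> v \<partial>lborel) = ennreal (\<bar>1/b\<bar> ^ DIM('a)) * (\<integral>\<^sup>+v. ?\<phi> ((- (1/b) *\<^sub>R c) + (1/b) *\<^sub>R v) \<partial>lborel)"
      using ab by (intro nn_integral_lborel_affine) auto
    moreover have "(\<integral>\<^sup>+v. ?\<phi> v \<partial>lborel) = 1"
      using std_gaussian.emeasure_space_1[where 'a='a] by (simp add: std_gaussian_eq emeasure_density)
    ultimately show ?thesis using ab by (simp add: scaleR_diff_right)
  qed
  have "(\<integral>\<^sup>+v. \<integral>\<^sup>+u. f (a *\<^sub>R v + b *\<^sub>R u) \<partial>std_gaussian \<partial>std_gaussian)
      = (\<integral>\<^sup>+v. ?\<phi> v * (\<integral>\<^sup>+u. ?\<phi> u * f (a *\<^sub>R v + b *\<^sub>R u) \<partial>lborel) \<partial>lborel)"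
    by (simp add: std_gaussian_eq nn_integral_density)
  also have "\<dots> = (\<integral>\<^sup>+v. \<integral>\<^sup>+w. ennreal ((1/b) ^ DIM('a)) * (?\<phi> v * ?\<phi> ((1/b) *\<^sub>R (w - a *\<^sub>R v)) * f w) \<partial>lborel \<partial>lborel)"
  proof (intro nn_integral_cong)
    fix v :: 'a
    have "(\<integral>\<^sup>+u. ?\<phi> u * f (a *\<^sub>R v + b *\<^sub>R u) \<partial>lborel)
       = ennreal (\<bar>1/b\<bar> ^ DIM('a)) * (\<integral>\<^sup>+w. ?\<phi> (- ((1/b) *\<^sub>R a *\<^sub>R v) + (1/b) *\<^sub>R w)
            * f (a *\<^sub>R v + b *\<^sub>R (- ((1/b) *\<^sub>R a *\<^sub>R v) + (1/b) *\<^sub>R w)) \<partial>lborel)"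
      using ab by (intro nn_integral_lborel_affine) auto
    also have "(\<lambda>w. ?\<phi> (- ((1/b) *\<^sub>R a *\<^sub>R v) + (1/b) *\<^sub>R w)
            * f (a *\<^sub>R v + b *\<^sub>R (- ((1/b) *\<^sub>R a *\<^sub>R v) + (1/b) *\<^sub>R w))) = (\<lambda>w. ?\<phi> ((1/b) *\<^sub>R (w - a *\<^sub>R v)) * f w)"
      using ab by (simp add: scaleR_diff_right scaleR_add_right)
    finally have sub: "(\<integral>\<^sup>+u. ?\<phi> u * f (a *\<^sub>R v + b *\<^sub>R u) \<partial>lborel)
       = ennreal (\<bar>1/b\<bar> ^ DIM('a)) * (\<integral>\<^sup>+w. ?\<phi> ((1/b) *\<^sub>R (w - a *\<^sub>R v)) * f w \<partial>lborel)" .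
    show "?\<phi> v * (\<integral>\<^sup>+u. ?\<phi> u * f (a *\<^sub>R v + b *\<^sub>R u) \<partial>lborel)
       = (\<integral>\<^sup>+w. ennreal ((1/b) ^ DIM('a)) * (?\<phi> v * ?\<phi> ((1/b) *\<^sub>R (w - a *\<^sub>R v)) * f w) \<partial>lborel)"
    proof -
      have "(\<integral>\<^sup>+w. ennreal ((1/b) ^ DIM('a)) * (?\<phi> v * ?\<phi> ((1/b) *\<^sub>R (w - a *\<^sub>R v)) * f w) \<partial>lborel)
          = (\<integral>\<^sup>+w. (?\<phi> v * ennreal ((1/b) ^ DIM('a))) * (?\<phi> ((1/b) *\<^sub>R (w - a *\<^sub>R v)) * f w) \<partial>lborel)"
        by (simp only: mult_ac)
      also have "\<dots> = (?\<phi> v * ennreal ((1/b) ^ DIM('a))) * (\<integral>\<^sup>+w. ?\<phi> ((1/b) *\<^sub>R (w - a *\<^sub>R v)) * f w \<partial>lborel)"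
        by (rule nn_integral_cmult) measurable
      also have "\<dots> = ?\<phi> v * (ennreal (\<bar>1/b\<bar> ^ DIM('a)) * (\<integral>\<^sup>+w. ?\<phi> ((1/b) *\<^sub>R (w - a *\<^sub>R v)) * f w \<partial>lborel))"
        using ab by (simp only: mult.assoc abs_of_pos zero_less_divide_1_iff)
      finally show ?thesis using sub by (simp only:)
    qed
  qed
  also have "\<dots> = (\<integral>\<^sup>+w. \<integral>\<^sup>+v. ennreal ((1/b) ^ DIM('a)) * (?\<phi> v * ?\<phi> ((1/b) *\<^sub>R (w - a *\<^sub>R v)) * f w) \<partial>lborel \<partial>lborel)"
    by (rule lborel_pair.Fubini') measurable
  also have "\<dots> = (\<integral>\<^sup>+w. ?\<phi> w * f w \<partial>lborel)"
  proof (intro nn_integral_cong)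
    fix w :: 'a
    have "ennreal ((1/b) ^ DIM('a)) * (?\<phi> v * ?\<phi> ((1/b) *\<^sub>R (w - a *\<^sub>R v)) * f w)
        = (?\<phi> w * f w) * (ennreal ((1/b) ^ DIM('a)) * ?\<phi> ((1/b) *\<^sub>R (v - a *\<^sub>R w)))" for v
    proof -
      have "?\<phi> v * ?\<phi> ((1/b) *\<^sub>R (w - a *\<^sub>R v)) = ?\<phi> w * ?\<phi> ((1/b) *\<^sub>R (v - a *\<^sub>R w))"
        using key[of v w] by (simp add: ennreal_mult[symmetric] gaussian_density_pos less_imp_le)
      then show ?thesis by (simp only: mult_ac)
    qed
    then show "(\<integral>\<^sup>+v. ennreal ((1/b) ^ DIM('a)) * (?\<phi> v * ?\<phi> ((1/b) *\<^sub>R (w - a *\<^sub>R v)) * f w) \<partial>lborel) = ?\<phi> w * f w"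
      using mass[of "a *\<^sub>R w"] by (simp add: nn_integral_cmult)
  qed
  also have "\<dots> = (\<integral>\<^sup>+w. f w \<partial>std_gaussian)" by (simp add: std_gaussian_eq nn_integral_density)
  finally show ?thesis .
qed

section \<open>Gaussian integrability and moments\<close>

lemma nn_integral_exp_neg_norm_sq:
  assumes c: "0 < c"
  shows "(\<integral>\<^sup>+x. ennreal (exp (- c * (norm (x::'a::euclidean_space))\<^sup>2)) \<partial>lborel) < \<infinity>"
proof -
  have "(\<integral>\<^sup>+x. ennreal (gaussian_density (x::'a)) \<partial>lborel)
     = ennreal (\<bar>sqrt (2*c)\<bar> ^ DIM('a)) * (\<integral>\<^sup>+x. ennreal (gaussian_density (0 + sqrt (2*c) *\<^sub>R (x::'a))) \<partial>lborel)"
    using c by (intro nn_integral_lborel_affine) auto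
  also have "(\<integral>\<^sup>+x. ennreal (gaussian_density (0 + sqrt (2*c) *\<^sub>R (x::'a))) \<partial>lborel)
     = ennreal ((1 / sqrt (2 * pi)) ^ DIM('a)) * (\<integral>\<^sup>+x. ennreal (exp (- c * (norm (x::'a))\<^sup>2)) \<partial>lborel)"
    using c by (simp add: gaussian_density_def power_mult_distrib ennreal_mult nn_integral_cmult)
  finally have "ennreal (\<bar>sqrt (2*c)\<bar> ^ DIM('a)) * (ennreal ((1 / sqrt (2 * pi)) ^ DIM('a)) *
     (\<integral>\<^sup>+x. ennreal (exp (- c * (norm (x::'a))\<^sup>2)) \<partial>lborel)) = 1"
    using std_gaussian.emeasure_space_1[where 'a='a] by (simp add: std_gaussian_eq emeasure_density)
  moreover have "ennreal (\<bar>sqrt (2*c)\<bar> ^ DIM('a)) \<noteq> 0" "ennreal ((1 / sqrt (2 * pi)) ^ DIM('a)) \<noteq> 0"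
    using c by (auto simp: ennreal_eq_0_iff not_le)
  ultimately have "(\<integral>\<^sup>+x. ennreal (exp (- c * (norm (x::'a))\<^sup>2)) \<partial>lborel) \<noteq> top"
    by (metis ennreal_mult_top ennreal_one_neq_top)
  then show ?thesis by (simp add: less_top)
qed

text \<open>By \<open>ln t \<le> t\<close> a power is at most \<open>exp (p * t)\<close>, and
  completing a square absorbs the linear exponent. This gives moments of every order under a
  Gaussian tail.\<close>

lemma powr_le_exp_sq:
  assumes "0 < c" "0 \<le> p" "0 \<le> (t::real)"
  shows "t powr p \<le> exp (p\<^sup>2 / (4 * c)) * exp (c * t\<^sup>2)"
proof (cases "t = 0")
  case False
  then have t: "0 < t" using assms by simp
  have "ln t \<le> t" using ln_le_minus_one[OF t] by simp
  then have "p * ln t \<le> p * t" using assms by (intro mult_left_mono) auto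
  also have "\<dots> \<le> p\<^sup>2 / (4 * c) + c * t\<^sup>2"
  proof -
    have "0 \<le> (2 * c * t - p)\<^sup>2 / (4 * c)" using assms by simp
    also have "\<dots> = p\<^sup>2 / (4 * c) + c * t\<^sup>2 - p * t" using assms by (simp add: power2_eq_square field_simps)
    finally show ?thesis by simp
  qed
  finally show ?thesis using t by (simp add: powr_def flip: exp_add)
qed simp

lemma std_gaussian_moment:
  assumes p: "0 \<le> p"
  shows "(\<integral>\<^sup>+x. ennreal (norm (x::'a::euclidean_space) powr p) \<partial>std_gaussian) < \<infinity>"
proof -
  \<comment> \<open>Half of the Gaussian exponent is spent on the power; the rate \<open>1/4\<close>
    remains.\<close>
  define K where "K = exp (p\<^sup>2 / (4 * (1/4)))"
  have "(\<integral>\<^sup>+x. ennreal (norm (x::'a) powr p) \<partial>std_gaussian)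
     = (\<integral>\<^sup>+x. ennreal (gaussian_density x * norm x powr p) \<partial>(lborel::'a measure))"
    by (simp add: std_gaussian_eq nn_integral_density ennreal_mult gaussian_density_pos less_imp_le)
  also have "\<dots> \<le> (\<integral>\<^sup>+x. ennreal ((1 / sqrt (2 * pi)) ^ DIM('a) * K) * ennreal (exp (- (1/4) * (norm (x::'a))\<^sup>2)) \<partial>lborel)"
  proof (intro nn_integral_mono)
    fix x :: 'a
    have "exp (- (norm x)\<^sup>2 / 2) * norm x powr p \<le> exp (- (norm x)\<^sup>2 / 2) * (K * exp ((1/4) * (norm x)\<^sup>2))"
      using powr_le_exp_sq[of "1/4" p "norm x"] p by (intro mult_left_mono) (auto simp: K_def)
    also have "\<dots> = K * (exp (- (norm x)\<^sup>2 / 2 + (1/4) * (norm x)\<^sup>2))"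
      by (simp only: exp_add mult_ac)
    also have "- (norm x)\<^sup>2 / 2 + (1/4) * (norm x)\<^sup>2 = - (1/4) * (norm x)\<^sup>2" by simp
    finally have "(1 / sqrt (2 * pi)) ^ DIM('a) * (exp (- (norm x)\<^sup>2 / 2) * norm x powr p)
       \<le> (1 / sqrt (2 * pi)) ^ DIM('a) * (K * exp (- (1/4) * (norm x)\<^sup>2))"
      by (intro mult_left_mono) auto
    then show "ennreal (gaussian_density x * norm x powr p)
       \<le> ennreal ((1 / sqrt (2 * pi)) ^ DIM('a) * K) * ennreal (exp (- (1/4) * (norm x)\<^sup>2))"
      unfolding gaussian_density_def by (subst ennreal_mult'[symmetric]) (auto simp: K_def mult_ac intro!: ennreal_leI)
  qed
  also have "\<dots> < \<infinity>"
    using nn_integral_exp_neg_norm_sq[of "1/4", where 'a='a]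
    by (subst nn_integral_cmult) (auto simp: ennreal_mult_less_top)
  finally show ?thesis .
qed

subsection \<open>Couplings\<close>

lemma couplingsD:
  assumes "\<Gamma> \<in> couplings \<nu> \<mu>"
  shows "sets \<Gamma> = sets (\<nu> \<Otimes>\<^sub>M \<mu>)" "space \<Gamma> = space \<nu> \<times> space \<mu>" "distr \<Gamma> \<nu> fst = \<nu>" "distr \<Gamma> \<mu> snd = \<mu>"
    "fst \<in> measurable \<Gamma> \<nu>" "snd \<in> measurable \<Gamma> \<mu>"
proof -
  show s: "sets \<Gamma> = sets (\<nu> \<Otimes>\<^sub>M \<mu>)" and "distr \<Gamma> \<nu> fst = \<nu>" "distr \<Gamma> \<mu> snd = \<mu>"
    using assms by (auto simp: couplings_def)
  show "space \<Gamma> = space \<nu> \<times> space \<mu>" using sets_eq_imp_space_eq[OF s] by (simp add: space_pair_measure)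
  show "fst \<in> measurable \<Gamma> \<nu>" "snd \<in> measurable \<Gamma> \<mu>"
    by (simp_all add: measurable_cong_sets[OF s refl])
qed

lemma couplings_nn_integral:
  assumes "\<Gamma> \<in> couplings \<nu> \<mu>"
  shows "f \<in> borel_measurable \<nu> \<Longrightarrow> (\<integral>\<^sup>+z. f (fst z) \<partial>\<Gamma>) = (\<integral>\<^sup>+x. f x \<partial>\<nu>)"
    and "g \<in> borel_measurable \<mu> \<Longrightarrow> (\<integral>\<^sup>+z. g (snd z) \<partial>\<Gamma>) = (\<integral>\<^sup>+x. g x \<partial>\<mu>)"
  using couplingsD[OF assms]
  by (metis nn_integral_distr)+

lemma couplings_integral:
  fixes f g :: "_ \<Rightarrow> real"
  assumes "\<Gamma> \<in> couplings \<nu> \<mu>"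
  shows "f \<in> borel_measurable \<nu> \<Longrightarrow> (\<integral>z. f (fst z) \<partial>\<Gamma>) = (\<integral>x. f x \<partial>\<nu>)"
    and "g \<in> borel_measurable \<mu> \<Longrightarrow> (\<integral>z. g (snd z) \<partial>\<Gamma>) = (\<integral>x. g x \<partial>\<mu>)"
  using couplingsD[OF assms]
  by (metis integral_distr)+

lemma couplings_prob_space:
  assumes "\<Gamma> \<in> couplings \<nu> \<mu>" "prob_space \<nu>"
  shows "prob_space \<Gamma>"
  using couplingsD[OF assms(1)] assms(2) prob_space_distrD by metis

lemma pair_measure_coupling:
  assumes "prob_space \<nu>" "prob_space \<mu>"
  shows "\<nu> \<Otimes>\<^sub>M \<mu> \<in> couplings \<nu> \<mu>"
proof -
  interpret \<nu>: prob_space \<nu> by fact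
  interpret \<mu>: prob_space \<mu> by fact
  interpret pair_prob_space \<nu> \<mu> ..
  have "distr (\<nu> \<Otimes>\<^sub>M \<mu>) \<nu> fst = \<nu>"
  proof (rule measure_eqI)
    fix A assume "A \<in> sets (distr (\<nu> \<Otimes>\<^sub>M \<mu>) \<nu> fst)"
    then have A: "A \<in> sets \<nu>" by simp
    then have "fst -` A \<inter> space (\<nu> \<Otimes>\<^sub>M \<mu>) = A \<times> space \<mu>"
      using sets.sets_into_space by (auto simp: space_pair_measure)
    then show "emeasure (distr (\<nu> \<Otimes>\<^sub>M \<mu>) \<nu> fst) A = emeasure \<nu> A"
      using A by (simp add: emeasure_distr \<mu>.emeasure_pair_measure_Times \<mu>.emeasure_space_1)
  qed simp
  moreover have "distr (\<nu> \<Otimes>\<^sub>M \<mu>) \<mu> snd = \<mu>"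
  proof (rule measure_eqI)
    fix A assume "A \<in> sets (distr (\<nu> \<Otimes>\<^sub>M \<mu>) \<mu> snd)"
    then have A: "A \<in> sets \<mu>" by simp
    then have "snd -` A \<inter> space (\<nu> \<Otimes>\<^sub>M \<mu>) = space \<nu> \<times> A"
      using sets.sets_into_space by (auto simp: space_pair_measure)
    then show "emeasure (distr (\<nu> \<Otimes>\<^sub>M \<mu>) \<mu> snd) A = emeasure \<mu> A"
      using A by (simp add: emeasure_distr \<mu>.emeasure_pair_measure_Times \<nu>.emeasure_space_1)
  qed simp
  ultimately show ?thesis by (simp add: couplings_def)
qed

lemma distr_coupling:
  assumes [measurable]: "X \<in> measurable M borel" "Y \<in> measurable M borel"
    and "distr M borel X = \<nu>" "distr M borel Y = \<mu>"
  shows "distr M (borel \<Otimes>\<^sub>M borel) (\<lambda>z. (X z, Y z)) \<in> couplings \<nu> \<mu>"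
proof -
  have s [measurable_cong]: "sets \<nu> = sets borel" "sets \<mu> = sets borel" using assms by auto
  have "distr (distr M (borel \<Otimes>\<^sub>M borel) (\<lambda>z. (X z, Y z))) \<nu> fst = distr M borel X"
    by (subst distr_distr) (auto simp: comp_def s intro!: distr_cong)
  moreover have "distr (distr M (borel \<Otimes>\<^sub>M borel) (\<lambda>z. (X z, Y z))) \<mu> snd = distr M borel Y"
    by (subst distr_distr) (auto simp: comp_def s intro!: distr_cong)
  moreover have "sets (borel \<Otimes>\<^sub>M borel) = sets (\<nu> \<Otimes>\<^sub>M \<mu>)"
    by (intro sets_pair_measure_cong) (simp_all add: s)
  ultimately show ?thesis using assms by (simp add: couplings_def)
qed

text \<open>A difference of two values in \<open>[0, 1]\<close> is at most the indicator that the
  arguments differ; integrate this against the coupling. The \<open>2\<close> is the normalisation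
  of \<open>tv_dist\<close>.\<close>

lemma ennreal_integral_diff_le_coupling:
  fixes f :: "'b::{second_countable_topology, t2_space} \<Rightarrow> real"
  assumes \<Gamma>: "\<Gamma> \<in> couplings \<nu> \<mu>" and P: "prob_space \<nu>"
    and S: "sets \<nu> = sets borel" "sets \<mu> = sets borel"
    and [measurable]: "f \<in> borel_measurable borel" and f: "\<And>x. 0 \<le> f x" "\<And>x. f x \<le> 1"
  shows "2 * ennreal ((\<integral>x. f x \<partial>\<nu>) - (\<integral>x. f x \<partial>\<mu>)) \<le> 2 * emeasure \<Gamma> {(x, y) \<in> space \<Gamma>. x \<noteq> y}"
proof -
  interpret \<Gamma>: prob_space \<Gamma> by (rule couplings_prob_space[OF \<Gamma> P])
  note c = couplingsD[OF \<Gamma>]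
  have sp: "space \<Gamma> = UNIV" using c S[THEN sets_eq_imp_space_eq] by (simp add: space_borel)
  have [measurable_cong]: "sets \<Gamma> = sets (borel \<Otimes>\<^sub>M borel)"
    unfolding c by (intro sets_pair_measure_cong S)
  have D: "{(x, y) \<in> space \<Gamma>. x \<noteq> y} = {z \<in> space \<Gamma>. fst z \<noteq> snd z}" by auto
  have [measurable]: "{(x, y) \<in> space \<Gamma>. x \<noteq> y} \<in> sets \<Gamma>" unfolding D by measurable
  have fm: "f \<in> borel_measurable \<nu>" "f \<in> borel_measurable \<mu>" using S by (simp_all cong: measurable_cong_sets)
  have i: "integrable \<Gamma> (\<lambda>z. f (fst z))" "integrable \<Gamma> (\<lambda>z. f (snd z))"
    by (auto intro!: \<Gamma>.integrable_const_bound[where B=1] simp: f)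
  have "(\<integral>x. f x \<partial>\<nu>) - (\<integral>x. f x \<partial>\<mu>) = (\<integral>z. f (fst z) - f (snd z) \<partial>\<Gamma>)"
    using i by (simp add: couplings_integral[OF \<Gamma>] fm)
  also have "\<dots> \<le> (\<integral>z. indicator {(x, y) \<in> space \<Gamma>. x \<noteq> y} z \<partial>\<Gamma>)"
  proof (intro integral_mono)
    fix z show "f (fst z) - f (snd z) \<le> indicator {(x, y) \<in> space \<Gamma>. x \<noteq> y} z"
      using f[of "fst z"] f[of "snd z"] by (auto simp: indicator_def sp split: prod.splits)
  next
    show "integrable \<Gamma> (indicator {(x, y) \<in> space \<Gamma>. x \<noteq> y} :: _ \<Rightarrow> real)"
      by (intro integrable_real_indicator) (simp_all add: \<Gamma>.emeasure_eq_measure)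
  qed (use i in auto)
  also have "\<dots> = measure \<Gamma> {(x, y) \<in> space \<Gamma>. x \<noteq> y}" by simp
  finally show ?thesis
    by (intro mult_left_mono) (simp_all add: \<Gamma>.emeasure_eq_measure ennreal_leI)
qed

lemma integral_diff_le_tv_dist:
  fixes f :: "'b::{second_countable_topology, t2_space} \<Rightarrow> real"
  assumes "prob_space \<nu>" "sets \<nu> = sets borel" "sets \<mu> = sets borel"
    and "f \<in> borel_measurable borel" "\<And>x. 0 \<le> f x" "\<And>x. f x \<le> 1"
  shows "2 * ennreal ((\<integral>x. f x \<partial>\<nu>) - (\<integral>x. f x \<partial>\<mu>)) \<le> tv_dist \<nu> \<mu>"
  unfolding tv_dist_def by (intro INF_greatest ennreal_integral_diff_le_coupling assms)

section \<open>The maximal coupling\<close>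

definition plus_measure :: "'a measure \<Rightarrow> 'a measure \<Rightarrow> 'a measure" where
  "plus_measure M N = measure_of (space M) (sets M) (\<lambda>A. emeasure M A + emeasure N A)"

lemma sets_plus_measure [simp, measurable_cong]: "sets (plus_measure M N) = sets M"
  and space_plus_measure [simp]: "space (plus_measure M N) = space M"
  by (simp_all add: plus_measure_def)

lemma emeasure_plus_measure:
  assumes "sets N = sets M" "A \<in> sets M"
  shows "emeasure (plus_measure M N) A = emeasure M A + emeasure N A"
  unfolding plus_measure_def
proof (rule emeasure_measure_of_sigma)
  show "sigma_algebra (space M) (sets M)" ..
  show "positive (sets M) (\<lambda>A. emeasure M A + emeasure N A)" by (simp add: positive_def)
  show "countably_additive (sets M) (\<lambda>A. emeasure M A + emeasure N A)"
  proof (rule countably_additiveI)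
    fix A :: "nat \<Rightarrow> _" assume A: "range A \<subseteq> sets M" "disjoint_family A"
    then show "(\<Sum>i. emeasure M (A i) + emeasure N (A i)) = emeasure M (\<Union>i. A i) + emeasure N (\<Union>i. A i)"
      using assms(1) by (simp add: suminf_add[symmetric] suminf_emeasure)
  qed
qed fact

text \<open>The maximal coupling: with a Hahn set \<open>Y\<close> (on which \<open>\<mu> \<le> \<nu>\<close>), put the common part \<open>\<nu> \<and> \<mu>\<close> on the
  diagonal and couple the two remainders independently.\<close>

lemma tv_dist_le:
  fixes \<nu> \<mu> :: "'b::{second_countable_topology, t2_space} measure"
  assumes P: "prob_space \<nu>" "prob_space \<mu>" and S: "sets \<nu> = sets borel" "sets \<mu> = sets borel"
    and t: "\<And>A. A \<in> sets borel \<Longrightarrow> measure \<nu> A - measure \<mu> A \<le> t"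
  shows "tv_dist \<nu> \<mu> \<le> 2 * ennreal t"
proof -
  interpret \<nu>: prob_space \<nu> by fact
  interpret \<mu>: prob_space \<mu> by fact
  note [measurable_cong] = S
  have sp [simp]: "space \<nu> = UNIV" "space \<mu> = UNIV" using S[THEN sets_eq_imp_space_eq] by auto
  obtain Y where Y: "Y \<in> sets \<nu>" and le1: "\<And>X. X \<in> sets \<nu> \<Longrightarrow> X \<subseteq> Y \<Longrightarrow> emeasure \<mu> X \<le> emeasure \<nu> X"
    and le2: "\<And>X. X \<in> sets \<nu> \<Longrightarrow> X \<inter> Y = {} \<Longrightarrow> emeasure \<nu> X \<le> emeasure \<mu> X"
    using finite_unsigned_Hahn_decomposition[of \<nu> \<mu>] S \<nu>.finite_measure_axioms \<mu>.finite_measure_axioms by auto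
  have [measurable]: "Y \<in> sets borel" using Y S by simp
  define \<nu>1 \<nu>2 \<mu>1 \<mu>2 where "\<nu>1 = density \<nu> (indicator Y)" and "\<nu>2 = density \<nu> (indicator (- Y))"
    and "\<mu>1 = density \<mu> (indicator Y)" and "\<mu>2 = density \<mu> (indicator (- Y))"
  note defs = \<nu>1_def \<nu>2_def \<mu>1_def \<mu>2_def
  have sets': "sets \<nu>1 = sets borel" "sets \<nu>2 = sets borel" "sets \<mu>1 = sets borel" "sets \<mu>2 = sets borel"
    by (auto simp: defs S)
  have em: "emeasure \<nu>1 A = emeasure \<nu> (Y \<inter> A)" "emeasure \<nu>2 A = emeasure \<nu> (- Y \<inter> A)"
    "emeasure \<mu>1 A = emeasure \<mu> (Y \<inter> A)" "emeasure \<mu>2 A = emeasure \<mu> (- Y \<inter> A)"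
    if "A \<in> sets borel" for A
    using that unfolding defs
    by (subst emeasure_density; simp add: S nn_integral_indicator indicator_inter_arith[symmetric])+
  have fin: "finite_measure \<nu>1" "finite_measure \<nu>2" "finite_measure \<mu>1" "finite_measure \<mu>2"
    using sets'[THEN sets_eq_imp_space_eq] by (auto intro!: finite_measureI simp: em)
  \<comment> \<open>The two excesses: \<open>\<alpha>\<close> is \<open>\<nu> - \<mu>\<close> on
    \<open>Y\<close> and \<open>\<beta>\<close> is \<open>\<mu> - \<nu>\<close> off
    \<open>Y\<close>. Both have mass \<open>d\<close>, because \<open>\<nu>\<close> and
    \<open>\<mu>\<close> have equal mass.\<close>
  define \<alpha> \<beta> where "\<alpha> = diff_measure \<nu>1 \<mu>1" and "\<beta> = diff_measure \<mu>2 \<nu>2"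
  have \<alpha>: "emeasure \<alpha> A = emeasure \<nu> (Y \<inter> A) - emeasure \<mu> (Y \<inter> A)" if "A \<in> sets borel" for A
    unfolding \<alpha>_def using that fin sets' em le1 S by (subst emeasure_diff_measure) auto
  have \<beta>: "emeasure \<beta> A = emeasure \<mu> (- Y \<inter> A) - emeasure \<nu> (- Y \<inter> A)" if "A \<in> sets borel" for A
    unfolding \<beta>_def using that fin sets' em le2 S by (subst emeasure_diff_measure) auto
  have s\<alpha>\<beta> [measurable_cong]: "sets \<alpha> = sets borel" "sets \<beta> = sets borel"
    by (simp_all add: \<alpha>_def \<beta>_def sets')
  have sp\<alpha>\<beta>: "space \<alpha> = UNIV" "space \<beta> = UNIV" using s\<alpha>\<beta>[THEN sets_eq_imp_space_eq] by auto
  define d where "d = measure \<nu> Y - measure \<mu> Y"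
  have dt: "d \<le> t" unfolding d_def by (rule t) simp
  have mle: "measure \<mu> Y \<le> measure \<nu> Y" using le1[of Y] Y by (simp add: \<nu>.emeasure_eq_measure \<mu>.emeasure_eq_measure)
  then have d0: "0 \<le> d" by (simp add: d_def)
  have \<alpha>U: "emeasure \<alpha> UNIV = ennreal d"
    by (simp add: \<alpha> d_def \<nu>.emeasure_eq_measure \<mu>.emeasure_eq_measure ennreal_minus)
  have \<beta>U: "emeasure \<beta> UNIV = ennreal d"
  proof -
    have "measure \<nu> (- Y) = 1 - measure \<nu> Y" "measure \<mu> (- Y) = 1 - measure \<mu> Y"
      using \<nu>.prob_compl[of Y] \<mu>.prob_compl[of Y] Y S by (simp_all add: Compl_eq_Diff_UNIV)
    then show ?thesis
      by (simp add: \<beta> d_def \<nu>.emeasure_eq_measure \<mu>.emeasure_eq_measure ennreal_minus)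
  qed
  interpret \<alpha>: finite_measure \<alpha> by (rule finite_measureI) (simp add: sp\<alpha>\<beta> \<alpha>U)
  interpret \<beta>: finite_measure \<beta> by (rule finite_measureI) (simp add: sp\<alpha>\<beta> \<beta>U)
  define \<theta> where "\<theta> = plus_measure \<mu>1 \<nu>2"
  have s\<theta> [measurable_cong]: "sets \<theta> = sets borel" by (simp add: \<theta>_def sets')
  have \<theta>: "emeasure \<theta> A = emeasure \<mu> (Y \<inter> A) + emeasure \<nu> (- Y \<inter> A)" if "A \<in> sets borel" for A
    unfolding \<theta>_def using that sets' by (subst emeasure_plus_measure) (auto simp: em)
  have split: "emeasure \<rho> A = emeasure \<rho> (Y \<inter> A) + emeasure \<rho> (- Y \<inter> A)"
    if "A \<in> sets borel" "sets \<rho> = sets borel" for A and \<rho> :: "'b measure"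
    using that by (subst plus_emeasure) (auto intro!: arg_cong[where f="emeasure \<rho>"])
  have \<nu>A: "emeasure \<theta> A + emeasure \<alpha> A = emeasure \<nu> A" if A: "A \<in> sets borel" for A
  proof -
    have "emeasure \<mu> (Y \<inter> A) + (emeasure \<nu> (Y \<inter> A) - emeasure \<mu> (Y \<inter> A)) = emeasure \<nu> (Y \<inter> A)"
      using A S le1[of "Y \<inter> A"] by (simp add: add_diff_inverse_ennreal Int_ac)
    then show ?thesis unfolding \<theta>[OF A] \<alpha>[OF A] split[OF A S(1)] by (metis add.assoc add.commute)
  qed
  have \<mu>A: "emeasure \<theta> A + emeasure \<beta> A = emeasure \<mu> A" if A: "A \<in> sets borel" for A
  proof -
    have "emeasure \<nu> (- Y \<inter> A) + (emeasure \<mu> (- Y \<inter> A) - emeasure \<nu> (- Y \<inter> A)) = emeasure \<mu> (- Y \<inter> A)"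
      using A S le2[of "- Y \<inter> A"] by (simp add: add_diff_inverse_ennreal Int_ac)
    then show ?thesis unfolding \<theta>[OF A] \<beta>[OF A] split[OF A S(2)] by (metis add.assoc add.commute)
  qed
  \<comment> \<open>The product of the excesses has mass \<open>d\<^sup>2\<close>; dividing by
    \<open>d\<close> restores the marginals \<open>\<alpha>\<close> and
    \<open>\<beta>\<close>.\<close>
  define \<Gamma> where "\<Gamma> = plus_measure (distr \<theta> (borel \<Otimes>\<^sub>M borel) (\<lambda>x. (x, x))) (scale_measure (ennreal (1 / d)) (\<alpha> \<Otimes>\<^sub>M \<beta>))"
  have sab: "sets (\<alpha> \<Otimes>\<^sub>M \<beta>) = sets (borel \<Otimes>\<^sub>M borel)" by (intro sets_pair_measure_cong s\<alpha>\<beta>)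
  have s\<Gamma> [measurable_cong]: "sets \<Gamma> = sets (borel \<Otimes>\<^sub>M borel)" by (simp add: \<Gamma>_def)
  have sp\<Gamma>: "space \<Gamma> = UNIV" using sets_eq_imp_space_eq[OF s\<Gamma>] by (simp add: space_pair_measure)
  have \<Gamma>: "emeasure \<Gamma> C = emeasure \<theta> {x. (x, x) \<in> C} + ennreal (1 / d) * emeasure (\<alpha> \<Otimes>\<^sub>M \<beta>) C"
    if C: "C \<in> sets (borel \<Otimes>\<^sub>M borel)" for C
    unfolding \<Gamma>_def using C sab
    by (subst emeasure_plus_measure) (auto simp: emeasure_distr vimage_def sets_eq_imp_space_eq[OF s\<theta>])
  \<comment> \<open>For \<open>d = 0\<close> the factor \<open>1 / d\<close> is \<open>0\<close>,
    and \<open>x \<le> ennreal d\<close> forces \<open>x = 0\<close>.\<close>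
  have cancel: "ennreal (1 / d) * (x * ennreal d) = x" if "x \<le> ennreal d" for x
  proof (cases "d = 0")
    case True then show ?thesis using that by simp
  next
    case False
    then have "ennreal (1 / d) * ennreal d = 1" using d0 by (simp add: ennreal_mult[symmetric])
    then show ?thesis by (metis mult.commute mult.left_commute mult.right_neutral)
  qed
  have "\<Gamma> \<in> couplings \<nu> \<mu>"
    unfolding couplings_def
  proof (intro CollectI conjI)
    show "sets \<Gamma> = sets (\<nu> \<Otimes>\<^sub>M \<mu>)" unfolding s\<Gamma> by (intro sets_pair_measure_cong S[symmetric])
    show "distr \<Gamma> \<nu> fst = \<nu>"
    proof (rule measure_eqI)
      fix A assume "A \<in> sets (distr \<Gamma> \<nu> fst)"
      then have A [measurable]: "A \<in> sets borel" using S by simp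
      have f: "fst -` A = A \<times> (UNIV :: 'b set)" by auto
      have "emeasure (distr \<Gamma> \<nu> fst) A = emeasure \<Gamma> (A \<times> UNIV)"
        using S by (subst emeasure_distr) (auto simp: f sp\<Gamma>)
      also have "\<dots> = emeasure \<theta> A + ennreal (1 / d) * (emeasure \<alpha> A * ennreal d)"
        using s\<alpha>\<beta> by (subst \<Gamma>) (auto simp: \<beta>.emeasure_pair_measure_Times \<beta>U)
      also have "ennreal (1 / d) * (emeasure \<alpha> A * ennreal d) = emeasure \<alpha> A"
        using emeasure_mono[of A UNIV \<alpha>] s\<alpha>\<beta> by (intro cancel) (simp add: \<alpha>U)
      finally show "emeasure (distr \<Gamma> \<nu> fst) A = emeasure \<nu> A" using \<nu>A[OF A] by simp
    qed simp
    show "distr \<Gamma> \<mu> snd = \<mu>"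
    proof (rule measure_eqI)
      fix A assume "A \<in> sets (distr \<Gamma> \<mu> snd)"
      then have A [measurable]: "A \<in> sets borel" using S by simp
      have f: "snd -` A = (UNIV :: 'b set) \<times> A" by auto
      have "emeasure (distr \<Gamma> \<mu> snd) A = emeasure \<Gamma> (UNIV \<times> A)"
        using S by (subst emeasure_distr) (auto simp: f sp\<Gamma>)
      also have "\<dots> = emeasure \<theta> A + ennreal (1 / d) * (emeasure \<beta> A * ennreal d)"
        using s\<alpha>\<beta> by (subst \<Gamma>) (auto simp: \<beta>.emeasure_pair_measure_Times \<alpha>U mult.commute)
      also have "ennreal (1 / d) * (emeasure \<beta> A * ennreal d) = emeasure \<beta> A"
        using emeasure_mono[of A UNIV \<beta>] s\<alpha>\<beta> by (intro cancel) (simp add: \<beta>U)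
      finally show "emeasure (distr \<Gamma> \<mu> snd) A = emeasure \<mu> A" using \<mu>A[OF A] by simp
    qed simp
  qed
  then have "tv_dist \<nu> \<mu> \<le> 2 * emeasure \<Gamma> {(x, y) \<in> space \<Gamma>. x \<noteq> y}"
    unfolding tv_dist_def by (rule INF_lower)
  also have "emeasure \<Gamma> {(x, y) \<in> space \<Gamma>. x \<noteq> y} \<le> ennreal d"
  proof -
    have D: "{(x, y) \<in> space \<Gamma>. x \<noteq> y} = {z \<in> space \<Gamma>. fst z \<noteq> snd z}" by auto
    have m: "{(x, y) \<in> space \<Gamma>. x \<noteq> y} \<in> sets (borel \<Otimes>\<^sub>M borel)" unfolding D s\<Gamma>[symmetric] by measurable
    have top: "UNIV \<times> UNIV \<in> sets (\<alpha> \<Otimes>\<^sub>M \<beta>)"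
      using sets.top[of "\<alpha> \<Otimes>\<^sub>M \<beta>"] by (simp add: space_pair_measure sp\<alpha>\<beta> del: UNIV_Times_UNIV)
    have "emeasure \<Gamma> {(x, y) \<in> space \<Gamma>. x \<noteq> y} = ennreal (1 / d) * emeasure (\<alpha> \<Otimes>\<^sub>M \<beta>) {(x, y) \<in> space \<Gamma>. x \<noteq> y}"
      by (subst \<Gamma>[OF m]) simp
    also have "\<dots> \<le> ennreal (1 / d) * emeasure (\<alpha> \<Otimes>\<^sub>M \<beta>) (UNIV \<times> UNIV)"
      by (intro mult_left_mono emeasure_mono top) auto
    also have "\<dots> = ennreal d"
      using s\<alpha>\<beta> by (subst \<beta>.emeasure_pair_measure_Times) (auto simp: \<alpha>U \<beta>U intro!: cancel)
    finally show ?thesis .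
  qed
  finally have "tv_dist \<nu> \<mu> \<le> 2 * ennreal d" by (simp add: mult_left_mono)
  also have "\<dots> \<le> 2 * ennreal t" using dt by (intro mult_left_mono ennreal_leI) auto
  finally show ?thesis .
qed

section \<open>Approximate gluing of couplings\<close>

lemma countable_measurable_partition:
  fixes \<epsilon> :: real
  assumes "0 < \<epsilon>"
  obtains idx :: "'b::{second_countable_topology, metric_space} \<Rightarrow> nat"
  where "idx \<in> measurable borel (count_space UNIV)" "\<And>x y. idx x = idx y \<Longrightarrow> dist x y < \<epsilon>"
proof -
  obtain B :: "'b set" where B: "countable B" "\<And>X. open X \<Longrightarrow> X \<noteq> {} \<Longrightarrow> \<exists>d\<in>B. d \<in> X"
    using countable_dense_setE by blast
  define q where "q = from_nat_into B"
  have ne: "B \<noteq> {}" using B(2)[of UNIV] by auto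
  have ex: "\<exists>n. dist x (q n) < \<epsilon> / 2" for x
  proof -
    obtain d where "d \<in> B" "d \<in> ball x (\<epsilon> / 2)" using B(2)[of "ball x (\<epsilon> / 2)"] assms by auto
    then show ?thesis using from_nat_into_surj[OF B(1)] unfolding q_def by (metis mem_ball)
  qed
  \<comment> \<open>The first point of a dense sequence within \<open>\<epsilon> / 2\<close>: points
    with the same index are less than \<open>\<epsilon>\<close> apart.\<close>
  define idx where "idx x = (LEAST n. dist x (q n) < \<epsilon> / 2)" for x
  have c: "dist x (q (idx x)) < \<epsilon> / 2" for x unfolding idx_def by (rule LeastI_ex[OF ex])
  show ?thesis
  proof
    show "idx \<in> measurable borel (count_space UNIV)" unfolding idx_def by measurable
    show "dist x y < \<epsilon>" if "idx x = idx y" for x y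
      using c[of x] c[of y] that dist_triangle_half_l[of x "q (idx x)" \<epsilon> y] by (simp add: dist_commute)
  qed
qed

text \<open>A substitute for the gluing lemma that needs no disintegration: condition both couplings on the cell
  of a fine countable partition that contains the common marginal.\<close>

lemma approximate_gluing:
  fixes \<alpha> \<beta> \<gamma> :: "'b::{second_countable_topology, metric_space} measure"
  assumes P: "prob_space \<alpha>" "prob_space \<beta>"
    and S: "sets \<alpha> = sets borel" "sets \<beta> = sets borel" "sets \<gamma> = sets borel"
    and \<Gamma>0: "\<Gamma>0 \<in> couplings \<alpha> \<beta>" and \<Gamma>1: "\<Gamma>1 \<in> couplings \<beta> \<gamma>" and \<epsilon>: "0 < \<epsilon>"
  obtains T where "T \<in> couplings \<Gamma>0 \<Gamma>1" "AE z in T. dist (snd (fst z)) (fst (snd z)) < \<epsilon>"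
proof -
  note c0 = couplingsD[OF \<Gamma>0] and c1 = couplingsD[OF \<Gamma>1]
  interpret \<beta>: prob_space \<beta> by fact
  interpret \<Gamma>0: prob_space \<Gamma>0 by (rule couplings_prob_space[OF \<Gamma>0 P(1)])
  interpret \<Gamma>1: prob_space \<Gamma>1 by (rule couplings_prob_space[OF \<Gamma>1 P(2)])
  interpret pair_prob_space \<Gamma>0 \<Gamma>1 ..
  have s0 [measurable_cong]: "sets \<Gamma>0 = sets (borel \<Otimes>\<^sub>M borel)" unfolding c0 by (intro sets_pair_measure_cong S)
  have s1 [measurable_cong]: "sets \<Gamma>1 = sets (borel \<Otimes>\<^sub>M borel)" unfolding c1 by (intro sets_pair_measure_cong S)
  note [measurable_cong] = S
  have sp: "space \<beta> = UNIV" using S[THEN sets_eq_imp_space_eq] by auto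
  obtain idx :: "'b \<Rightarrow> nat" where [measurable]: "idx \<in> measurable borel (count_space UNIV)"
    and idx: "\<And>x y. idx x = idx y \<Longrightarrow> dist x y < \<epsilon>"
    using countable_measurable_partition[OF \<epsilon>] by blast
  define k where "k n = measure \<beta> {x. idx x = n}" for n
  \<comment> \<open>Density of the gluing with respect to the independent product: nonzero only if
    both copies of the middle variable lie in the same cell, and normalised by the mass of that
    cell.\<close>
  define w where "w a b = ennreal ((if real (idx a) = real (idx b) then 1 else 0) / k (idx a))" for a b
  have [measurable]: "(\<lambda>x. k (idx x)) \<in> borel_measurable borel" "(\<lambda>x. real (idx x)) \<in> borel_measurable borel"
    by (rule measurable_compose[where N="count_space UNIV"]; simp)+
  have wm [measurable]: "(\<lambda>(p, q). w (snd p) (fst q)) \<in> borel_measurable (\<Gamma>0 \<Otimes>\<^sub>M \<Gamma>1)"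
    unfolding w_def by measurable
  \<comment> \<open>Cells of mass zero, where the normalisation breaks down, form a null set for the
    common marginal and hence for both couplings.\<close>
  have kpos: "AE x in \<beta>. 0 < k (idx x)"
  proof -
    have "AE x in \<beta>. \<forall>n. idx x = n \<longrightarrow> k n \<noteq> 0"
      unfolding AE_all_countable
    proof
      fix n show "AE x in \<beta>. idx x = n \<longrightarrow> k n \<noteq> 0"
      proof (cases "k n = 0")
        case True
        then have "{x. idx x = n} \<in> null_sets \<beta>"
          by (intro null_setsI) (auto simp: k_def \<beta>.emeasure_eq_measure S)
        from AE_not_in[OF this] show ?thesis by eventually_elim simp
      qed simp
    qed
    then show ?thesis by eventually_elim (auto simp: k_def zero_less_measure_iff order_less_le)
  qed
  have cell: "(\<integral>\<^sup>+b. w' (idx b) \<partial>\<beta>) = ennreal (k n) * c"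
    if "\<And>j. w' j = (if n = j then c else 0)" for w' :: "nat \<Rightarrow> ennreal" and n c
  proof -
    have "(\<integral>\<^sup>+b. w' (idx b) \<partial>\<beta>) = (\<integral>\<^sup>+b. c * indicator {x. idx x = n} b \<partial>\<beta>)"
      by (intro nn_integral_cong) (auto simp: that)
    also have "\<dots> = c * emeasure \<beta> {x. idx x = n}" by (rule nn_integral_cmult_indicator) (simp add: S)
    finally show ?thesis by (simp add: k_def \<beta>.emeasure_eq_measure mult.commute)
  qed
  have w1: "(\<integral>\<^sup>+b. w a b \<partial>\<beta>) = 1" if "0 < k (idx a)" for a
  proof -
    have "(\<integral>\<^sup>+b. w a b \<partial>\<beta>) = ennreal (k (idx a)) * ennreal (1 / k (idx a))"
      unfolding w_def by (rule cell) auto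
    then show ?thesis using that by (simp add: ennreal_mult[symmetric])
  qed
  have w2: "(\<integral>\<^sup>+a. w a b \<partial>\<beta>) = 1" if "0 < k (idx b)" for b
  proof -
    have "(\<integral>\<^sup>+a. w a b \<partial>\<beta>) = ennreal (k (idx b)) * ennreal (1 / k (idx b))"
      unfolding w_def by (rule cell) auto
    then show ?thesis using that by (simp add: ennreal_mult[symmetric])
  qed
  define T where "T = density (\<Gamma>0 \<Otimes>\<^sub>M \<Gamma>1) (\<lambda>(p, q). w (snd p) (fst q))"
  show thesis
  proof
    have [measurable]: "w a \<in> borel_measurable borel" "(\<lambda>a. w a b) \<in> borel_measurable borel" for a b
      unfolding w_def by measurable
    have "distr T \<Gamma>0 fst = \<Gamma>0"
    proof (rule measure_eqI)
      fix A assume "A \<in> sets (distr T \<Gamma>0 fst)"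
      then have A [measurable]: "A \<in> sets \<Gamma>0" by simp
      have "emeasure (distr T \<Gamma>0 fst) A = (\<integral>\<^sup>+p. indicator A p \<partial>distr T \<Gamma>0 fst)" by simp
      also have "\<dots> = (\<integral>\<^sup>+z. indicator A (fst z) \<partial>T)"
        using A by (subst nn_integral_distr) (auto simp: T_def)
      also have "\<dots> = (\<integral>\<^sup>+z. (case z of (p, q) \<Rightarrow> w (snd p) (fst q)) * indicator A (fst z) \<partial>(\<Gamma>0 \<Otimes>\<^sub>M \<Gamma>1))"
        unfolding T_def by (rule nn_integral_density) (rule wm, measurable)
      also have "\<dots> = (\<integral>\<^sup>+p. \<integral>\<^sup>+q. w (snd p) (fst q) * indicator A p \<partial>\<Gamma>1 \<partial>\<Gamma>0)"
        by (subst \<Gamma>1.nn_integral_fst[symmetric]) (auto intro!: borel_measurable_times wm)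
      also have "\<dots> = (\<integral>\<^sup>+p. indicator A p \<partial>\<Gamma>0)"
      proof (rule nn_integral_cong_AE)
        have "AE x in distr \<Gamma>0 \<beta> snd. 0 < k (idx x)" unfolding c0(4) by (rule kpos)
        then have "AE p in \<Gamma>0. 0 < k (idx (snd p))" by (subst (asm) AE_distr_iff) (use c0 in auto)
        then show "AE p in \<Gamma>0. (\<integral>\<^sup>+q. w (snd p) (fst q) * indicator A p \<partial>\<Gamma>1) = indicator A p"
        proof eventually_elim
          case (elim p)
          have "(\<integral>\<^sup>+q. w (snd p) (fst q) * indicator A p \<partial>\<Gamma>1) = (\<integral>\<^sup>+q. w (snd p) (fst q) \<partial>\<Gamma>1) * indicator A p"
            by (rule nn_integral_multc) measurable
          also have "(\<integral>\<^sup>+q. w (snd p) (fst q) \<partial>\<Gamma>1) = (\<integral>\<^sup>+b. w (snd p) b \<partial>\<beta>)"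
            by (rule couplings_nn_integral(1)[OF \<Gamma>1]) measurable
          finally show ?case using w1[OF elim] by simp
        qed
      qed
      finally show "emeasure (distr T \<Gamma>0 fst) A = emeasure \<Gamma>0 A" by simp
    qed simp
    moreover have "distr T \<Gamma>1 snd = \<Gamma>1"
    proof (rule measure_eqI)
      fix A assume "A \<in> sets (distr T \<Gamma>1 snd)"
      then have A [measurable]: "A \<in> sets \<Gamma>1" by simp
      have "emeasure (distr T \<Gamma>1 snd) A = (\<integral>\<^sup>+p. indicator A p \<partial>distr T \<Gamma>1 snd)" by simp
      also have "\<dots> = (\<integral>\<^sup>+z. indicator A (snd z) \<partial>T)"
        using A by (subst nn_integral_distr) (auto simp: T_def)
      also have "\<dots> = (\<integral>\<^sup>+z. (case z of (p, q) \<Rightarrow> w (snd p) (fst q)) * indicator A (snd z) \<partial>(\<Gamma>0 \<Otimes>\<^sub>M \<Gamma>1))"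
        unfolding T_def by (rule nn_integral_density) (rule wm, measurable)
      also have "\<dots> = (\<integral>\<^sup>+q. \<integral>\<^sup>+p. w (snd p) (fst q) * indicator A q \<partial>\<Gamma>0 \<partial>\<Gamma>1)"
        by (subst nn_integral_snd[symmetric]) (auto intro!: borel_measurable_times wm)
      also have "\<dots> = (\<integral>\<^sup>+q. indicator A q \<partial>\<Gamma>1)"
      proof (rule nn_integral_cong_AE)
        have "AE x in distr \<Gamma>1 \<beta> fst. 0 < k (idx x)" unfolding c1(3) by (rule kpos)
        then have "AE q in \<Gamma>1. 0 < k (idx (fst q))" by (subst (asm) AE_distr_iff) (use c1 in auto)
        then show "AE q in \<Gamma>1. (\<integral>\<^sup>+p. w (snd p) (fst q) * indicator A q \<partial>\<Gamma>0) = indicator A q"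
        proof eventually_elim
          case (elim q)
          have "(\<integral>\<^sup>+p. w (snd p) (fst q) * indicator A q \<partial>\<Gamma>0) = (\<integral>\<^sup>+p. w (snd p) (fst q) \<partial>\<Gamma>0) * indicator A q"
            by (rule nn_integral_multc) measurable
          also have "(\<integral>\<^sup>+p. w (snd p) (fst q) \<partial>\<Gamma>0) = (\<integral>\<^sup>+b. w b (fst q) \<partial>\<beta>)"
            by (rule couplings_nn_integral(2)[OF \<Gamma>0]) measurable
          finally show ?case using w2[OF elim] by simp
        qed
      qed
      finally show "emeasure (distr T \<Gamma>1 snd) A = emeasure \<Gamma>1 A" by simp
    qed simp
    ultimately show "T \<in> couplings \<Gamma>0 \<Gamma>1" by (simp add: couplings_def T_def)
    show "AE z in T. dist (snd (fst z)) (fst (snd z)) < \<epsilon>"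
      unfolding T_def AE_density[OF wm] by (auto simp: w_def intro!: AE_I2 idx split: if_splits)
  qed
qed

section \<open>Transfer of integrals, convexity of powers, Lipschitz test functions\<close>

lemma distr_eqI_nn_integral:
  assumes S: "sets N = sets borel" and X: "X \<in> measurable Q borel"
    and eq: "\<And>f. f \<in> borel_measurable borel \<Longrightarrow> (\<integral>\<^sup>+q. f (X q) \<partial>Q) = (\<integral>\<^sup>+x. f x \<partial>N)"
  shows "distr Q borel X = N"
proof (rule measure_eqI)
  fix A assume "A \<in> sets (distr Q borel X)"
  then have A: "A \<in> sets borel" by simp
  then have "emeasure (distr Q borel X) A = (\<integral>\<^sup>+q. indicator A (X q) \<partial>Q)"
    using X by (simp add: nn_integral_distr flip: nn_integral_indicator)
  then show "emeasure (distr Q borel X) A = emeasure N A" using A S eq[of "indicator A"] by simp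
qed (simp add: S)

lemma nn_integral_pair:
  assumes Q: "sigma_finite_measure Q" and X: "(\<lambda>p. X (fst p) (snd p)) \<in> measurable (M \<Otimes>\<^sub>M Q) B" and f: "f \<in> borel_measurable B"
  shows "(\<integral>\<^sup>+p. f (X (fst p) (snd p)) \<partial>(M \<Otimes>\<^sub>M Q)) = (\<integral>\<^sup>+z. \<integral>\<^sup>+x. f (X z x) \<partial>Q \<partial>M)"
proof -
  interpret sigma_finite_measure Q by fact
  have "(\<lambda>p. f (X (fst p) (snd p))) \<in> borel_measurable (M \<Otimes>\<^sub>M Q)" by (rule measurable_compose[OF X f])
  then show ?thesis by (simp add: nn_integral_fst[symmetric])
qed

lemma nn_integral_distr_pair:
  assumes Q: "sigma_finite_measure Q" and X: "(\<lambda>p. X (fst p) (snd p)) \<in> measurable (M \<Otimes>\<^sub>M Q) B" and f: "f \<in> borel_measurable B"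
  shows "(\<integral>\<^sup>+y. f y \<partial>distr (M \<Otimes>\<^sub>M Q) B (\<lambda>p. X (fst p) (snd p))) = (\<integral>\<^sup>+z. \<integral>\<^sup>+x. f (X z x) \<partial>Q \<partial>M)"
  using f by (simp add: nn_integral_distr[OF X] nn_integral_pair[OF Q X])

text \<open>Jensen's inequality with three weights. If \<open>a \<le> r * a'\<close>, the first term
  is at most \<open>r * a' powr p\<close>: a contraction by \<open>r\<close> survives as the factor
  \<open>r\<close> on p-th powers, whatever \<open>p \<ge> 1\<close>.\<close>

lemma powr_convex3:
  fixes a b c p :: real
  assumes p: "1 \<le> p" and nn: "0 \<le> a" "0 \<le> b" "0 \<le> c" and w: "0 < r" "0 < t" "0 < u" "r + t + u = 1"
  shows "(a + b + c) powr p \<le> r * (a / r) powr p + t * (b / t) powr p + u * (c / u) powr p"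
proof -
  \<comment> \<open>The boundary case of convexity, in which one of the two arguments
    vanishes.\<close>
  have scale: "(k * y) powr p \<le> k * y powr p" if "0 \<le> k" "k \<le> 1" "0 \<le> y" for k y :: real
    using that p powr_mono'[of 1 p k] by (simp add: powr_mult mult_right_mono)
  have two: "(l * x + k * y) powr p \<le> l * x powr p + k * y powr p"
    if "0 \<le> l" "0 \<le> k" "l + k = 1" "0 \<le> x" "0 \<le> y" for l k x y :: real
  proof (cases "0 < x \<and> 0 < y")
    case True
    then show ?thesis using powr_convex[OF p] that unfolding convex_on_def by auto
  next
    case False
    then have "x = 0 \<or> y = 0" using that by auto
    then show ?thesis using that scale[of k y] scale[of l x] by (elim disjE) simp_all
  qed
  have tu: "0 < t + u" using w by simp
  have "(t / (t + u) * (b / t) + u / (t + u) * (c / u)) powr p \<le> t / (t + u) * (b / t) powr p + u / (t + u) * (c / u) powr p"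
    using w nn tu by (intro two) (auto simp flip: add_divide_distrib)
  moreover have "t / (t + u) * (b / t) + u / (t + u) * (c / u) = (b + c) / (t + u)" using w tu by (simp add: add_divide_distrib)
  ultimately have 1: "((b + c) / (t + u)) powr p \<le> t / (t + u) * (b / t) powr p + u / (t + u) * (c / u) powr p" by simp
  have "(r * (a / r) + (t + u) * ((b + c) / (t + u))) powr p \<le> r * (a / r) powr p + (t + u) * ((b + c) / (t + u)) powr p"
    using w nn tu by (intro two) auto
  also have "(t + u) * ((b + c) / (t + u)) powr p \<le> (t + u) * (t / (t + u) * (b / t) powr p + u / (t + u) * (c / u) powr p)"
    using 1 tu by (intro mult_left_mono) auto
  also have "\<dots> = t * (b / t) powr p + u * (c / u) powr p" using tu by (simp add: distrib_left)
  also have "r * (a / r) + (t + u) * ((b + c) / (t + u)) = a + b + c" using w tu by simp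
  finally show ?thesis by simp
qed

text \<open>A crude constant is enough, since the inequality only serves to show that moments are
  finite.\<close>

lemma powr_add_le:
  fixes a b p :: real
  assumes "0 \<le> p" "0 \<le> a" "0 \<le> b"
  shows "(a + b) powr p \<le> 2 powr p * (a powr p + b powr p)"
proof -
  have "(a + b) powr p \<le> (2 * max a b) powr p" using assms by (intro powr_mono2) auto
  also have "\<dots> = 2 powr p * max a b powr p" using assms by (intro powr_mult)
  also have "max a b powr p \<le> a powr p + b powr p" by (simp add: max_def)
  finally show ?thesis by (simp add: mult_left_mono)
qed

lemma wasserstein_1:
  "wasserstein 1 \<nu> \<mu> = (INF \<Gamma>\<in>couplings \<nu> \<mu>. \<integral>\<^sup>+ (x, y). ennreal (dist x y) \<partial>\<Gamma>)"
proof -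
  have "ennroot 1 c = c" for c by (cases c) (auto simp: ennroot_def top.not_eq_extremum)
  then show ?thesis by (simp add: wasserstein_def)
qed

text \<open>The easy half of Kantorovich duality, obtained coupling by coupling. Values in
  \<open>[0, 1]\<close> make \<open>f\<close> integrable against every probability measure.\<close>

lemma kantorovich_bound:
  fixes f :: "'b::{second_countable_topology, real_normed_vector} \<Rightarrow> real"
  assumes P: "prob_space \<nu>" and S: "sets \<nu> = sets borel" "sets \<mu> = sets borel"
    and [measurable]: "f \<in> borel_measurable borel" and f: "\<And>x. 0 \<le> f x" "\<And>x. f x \<le> 1"
    and lip: "\<And>x y. f x - f y \<le> C * norm (x - y)" and C: "0 < C"
  shows "ennreal (((\<integral>x. f x \<partial>\<nu>) - (\<integral>x. f x \<partial>\<mu>)) / C) \<le> wasserstein 1 \<nu> \<mu>"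
  unfolding wasserstein_1
proof (rule INF_greatest)
  fix \<Gamma> assume \<Gamma>: "\<Gamma> \<in> couplings \<nu> \<mu>"
  interpret \<Gamma>: prob_space \<Gamma> by (rule couplings_prob_space[OF \<Gamma> P])
  have [measurable_cong]: "sets \<Gamma> = sets (borel \<Otimes>\<^sub>M borel)"
    unfolding couplingsD[OF \<Gamma>] by (intro sets_pair_measure_cong S)
  have fm: "f \<in> borel_measurable \<nu>" "f \<in> borel_measurable \<mu>" using S by (simp_all cong: measurable_cong_sets)
  have i: "integrable \<Gamma> (\<lambda>z. f (fst z))" "integrable \<Gamma> (\<lambda>z. f (snd z))"
    by (auto intro!: \<Gamma>.integrable_const_bound[where B=1] simp: f)
  have "(\<integral>x. f x \<partial>\<nu>) - (\<integral>x. f x \<partial>\<mu>) = (\<integral>z. f (fst z) - f (snd z) \<partial>\<Gamma>)"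
    using i by (simp add: couplings_integral[OF \<Gamma>] fm)
  then have "ennreal (((\<integral>x. f x \<partial>\<nu>) - (\<integral>x. f x \<partial>\<mu>)) / C) = ennreal (\<integral>z. (f (fst z) - f (snd z)) / C \<partial>\<Gamma>)"
    by simp
  \<comment> \<open>\<open>ennreal\<close> cuts off negative values, so the integrand is first
    replaced by its positive part.\<close>
  also have "\<dots> \<le> (\<integral>\<^sup>+z. ennreal ((f (fst z) - f (snd z)) / C) \<partial>\<Gamma>)"
  proof -
    have ii: "integrable \<Gamma> (\<lambda>z. (f (fst z) - f (snd z)) / C)" using i by simp
    have "(\<integral>z. (f (fst z) - f (snd z)) / C \<partial>\<Gamma>) \<le> (\<integral>z. max 0 ((f (fst z) - f (snd z)) / C) \<partial>\<Gamma>)"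
      using ii by (intro integral_mono) auto
    then have "ennreal (\<integral>z. (f (fst z) - f (snd z)) / C \<partial>\<Gamma>) \<le> ennreal (\<integral>z. max 0 ((f (fst z) - f (snd z)) / C) \<partial>\<Gamma>)"
      by (rule ennreal_leI)
    also have "\<dots> = (\<integral>\<^sup>+z. ennreal (max 0 ((f (fst z) - f (snd z)) / C)) \<partial>\<Gamma>)"
      using ii by (intro nn_integral_eq_integral[symmetric]) auto
    finally show ?thesis by (simp add: ennreal_max_0)
  qed
  also have "\<dots> \<le> (\<integral>\<^sup>+ (x, y). ennreal (dist x y) \<partial>\<Gamma>)"
    using lip C by (intro nn_integral_mono) (auto simp: dist_norm field_simps intro!: ennreal_leI)
  finally show "ennreal (((\<integral>x. f x \<partial>\<nu>) - (\<integral>x. f x \<partial>\<mu>)) / C) \<le> (\<integral>\<^sup>+ (x, y). ennreal (dist x y) \<partial>\<Gamma>)" .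
qed

lemma ennreal_double_le: "2 * ennreal x \<le> ennreal t \<Longrightarrow> 0 \<le> t \<Longrightarrow> 2 * x \<le> t"
proof -
  assume a: "2 * ennreal x \<le> ennreal t" "0 \<le> t"
  show "2 * x \<le> t"
  proof (cases "0 \<le> x")
    case True
    then have "ennreal (2 * x) \<le> ennreal t" using a by (simp add: ennreal_mult)
    then show ?thesis using a by (simp add: ennreal_le_iff)
  qed (use a in simp)
qed

lemma nn_integral_pair_prob:
  assumes Q: "prob_space Q" and f: "f \<in> borel_measurable M"
  shows "(\<integral>\<^sup>+z. f (fst z) \<partial>(M \<Otimes>\<^sub>M Q)) = (\<integral>\<^sup>+x. f x \<partial>M)"
proof -
  interpret prob_space Q by fact
  have "(\<lambda>z. f (fst z)) \<in> borel_measurable (M \<Otimes>\<^sub>M Q)" using f by measurable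
  then show ?thesis by (simp add: nn_integral_fst[symmetric] emeasure_space_1)
qed

lemma nn_integral_linear_combination:
  assumes "f \<in> borel_measurable Q" "g \<in> borel_measurable Q"
  shows "(\<integral>\<^sup>+t. (a * f t + c) + b * g t \<partial>Q) = a * (\<integral>\<^sup>+t. f t \<partial>Q) + c * emeasure Q (space Q) + b * (\<integral>\<^sup>+t. g t \<partial>Q)"
  using assms by (simp add: nn_integral_add nn_integral_cmult)

lemma ennroot_mono: "0 < p \<Longrightarrow> a \<le> b \<Longrightarrow> ennroot p a \<le> ennroot p b"
  by (auto simp: ennroot_def top.extremum_unique intro!: ennreal_leI powr_mono2 enn2real_mono simp: less_top)

lemma ennroot_mult:
  assumes "0 < p" "0 < k"
  shows "ennroot p (ennreal (k powr p) * b) = ennreal k * ennroot p b"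
proof (cases "b = \<top>")
  case True
  then show ?thesis using assms by (simp add: ennroot_def ennreal_mult_top)
next
  case False
  then have "ennreal (k powr p) * b \<noteq> \<top>" by (simp add: ennreal_mult_eq_top_iff)
  moreover have "(k powr p * enn2real b) powr (1 / p) = k * enn2real b powr (1 / p)"
    using assms by (simp add: powr_mult powr_powr)
  ultimately show ?thesis using False assms by (simp add: ennroot_def enn2real_mult ennreal_mult)
qed

subsection \<open>The OBABO chain\<close>

locale obabo_chain =
  fixes U :: "'a::euclidean_space \<Rightarrow> real" and m L \<gamma> \<delta> :: real
  assumes C2: "C2 U" and m: "0 < m" and mL: "m \<le> L"
    and lip: "\<And>x y. norm (grad U x - grad U y) \<le> L * norm (x - y)"
    and mono: "\<And>x y. m * (norm (x - y))\<^sup>2 \<le> (x - y) \<bullet> (grad U x - grad U y)"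
    and \<gamma>: "2 * sqrt L \<le> \<gamma>" and \<delta>: "0 < \<delta>" "\<delta> \<le> m / (33 * \<gamma> ^ 3)"
begin

definition \<eta> :: real where "\<eta> = eta \<delta> \<gamma>"
definition s :: real where "s = sqrt (1 - \<eta>\<^sup>2)"
definition \<kappa> :: real where "\<kappa> = m / (3 * \<gamma>)"
definition \<rho> :: real where "\<rho> = sqrt (1 - \<delta> * \<kappa>)"

abbreviation step :: "'a \<times> 'a \<Rightarrow> 'a \<times> 'a \<Rightarrow> 'a \<times> 'a" where
  "step \<equiv> obabo_step \<delta> \<gamma> U"

lemma L: "0 < L" using m mL by simp

lemma \<gamma>_pos: "0 < \<gamma>" using \<gamma> L by (smt (verit) real_sqrt_gt_zero)

lemma gderiv: "GDERIV U x :> grad U x"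
  using C2 by (simp add: C2_def)

lemma cocoercive: "(norm (grad U x - grad U y))\<^sup>2 \<le> L * ((x - y) \<bullet> (grad U x - grad U y))"
proof (rule gradient_cocoercive[OF gderiv L lip])
  show "0 \<le> (x - y) \<bullet> (grad U x - grad U y)" for x y
    using mono[of x y] m by (meson less_imp_le mult_nonneg_nonneg order_trans zero_le_power2)
qed

lemma continuous_grad: "continuous_on A (grad U)"
proof -
  have "L-lipschitz_on UNIV (grad U)"
    using lip L by (intro lipschitz_onI) (auto simp: dist_norm)
  then show ?thesis
    by (rule lipschitz_on_continuous_on[THEN continuous_on_subset]) simp
qed

text \<open>Units with \<open>L = 1\<close>: times are multiplied by \<open>sqrt L\<close>,
  velocities and rates divided by it, gradients divided by \<open>L\<close>. The products
  \<open>\<delta> * \<gamma>\<close> and \<open>\<delta> * \<kappa>\<close> do not change.\<close>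

sublocale scaled_parameters "\<gamma> / sqrt L" "\<delta> * sqrt L" "m / L" \<eta> "exp (\<delta> * \<gamma> / 2)" "m / L / (3 * (\<gamma> / sqrt L))"
proof
  have q: "0 < sqrt L" "sqrt L * sqrt L = L" using L by simp_all
  show "2 \<le> \<gamma> / sqrt L" using \<gamma> q by (simp add: field_simps)
  show "0 < m / L" "m / L \<le> 1" using m mL L by simp_all
  show "0 < \<delta> * sqrt L" using \<delta> q by simp
  have "\<delta> * sqrt L \<le> m / (33 * \<gamma> ^ 3) * sqrt L" using \<delta> q by (intro mult_right_mono) auto
  also have "\<dots> = m / L / (33 * (\<gamma> / sqrt L) ^ 3)"
    using q \<gamma>_pos by (simp add: field_simps power3_eq_cube)
  finally show "\<delta> * sqrt L \<le> m / L / (33 * (\<gamma> / sqrt L) ^ 3)" .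
  show "\<eta> = exp (- (\<delta> * sqrt L * (\<gamma> / sqrt L) / 2))" using q by (simp add: \<eta>_def eta_def)
  show "exp (\<delta> * \<gamma> / 2) = exp (\<delta> * sqrt L * (\<gamma> / sqrt L) / 2)" using q by simp
qed (rule refl)

lemma \<delta>\<kappa>: "\<delta> * sqrt L * (m / L / (3 * (\<gamma> / sqrt L))) = \<delta> * \<kappa>"
proof -
  have "sqrt L * sqrt L = L" using L by simp
  then show ?thesis using L \<gamma>_pos by (simp add: \<kappa>_def field_simps) 
qed

lemma \<delta>\<kappa>_bounds: "0 < \<delta> * \<kappa>" "\<delta> * \<kappa> \<le> 1 / 1584"
  using dk by (simp_all only: \<delta>\<kappa>)

text \<open>The third bound is strict because \<open>(1 - \<delta> * \<kappa> / 2)\<^sup>2\<close>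
  exceeds \<open>1 - \<delta> * \<kappa>\<close> by a positive square; this leaves a positive weight
  for the gluing error. The bound \<open>0.9\<close> is used where a missing power of
  \<open>\<rho>\<close> has to be made up.\<close>

lemma \<rho>_bounds: "0.9 \<le> \<rho>" "\<rho> < 1" "\<delta> * \<kappa> / 2 < 1 - \<rho>" "\<rho>\<^sup>2 = 1 - \<delta> * \<kappa>"
proof -
  show "\<rho>\<^sup>2 = 1 - \<delta> * \<kappa>" using \<delta>\<kappa>_bounds by (simp add: \<rho>_def)
  show "0.9 \<le> \<rho>" unfolding \<rho>_def using \<delta>\<kappa>_bounds by (intro real_le_rsqrt) (simp add: power2_eq_square)
  show "\<rho> < 1" using \<delta>\<kappa>_bounds by (simp add: \<rho>_def)
  have "(1 - \<delta> * \<kappa> / 2)\<^sup>2 = 1 - \<delta> * \<kappa> + (\<delta> * \<kappa>)\<^sup>2 / 4" by (simp add: power2_eq_square algebra_simps)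
  moreover have "0 < (\<delta> * \<kappa>)\<^sup>2" using \<delta>\<kappa>_bounds(1) by (rule zero_less_power)
  ultimately have "\<rho> < 1 - \<delta> * \<kappa> / 2" unfolding \<rho>_def
    using \<delta>\<kappa>_bounds by (intro real_less_lsqrt) auto
  then show "\<delta> * \<kappa> / 2 < 1 - \<rho>" by simp
qed

lemma \<delta>_sqrt_L: "\<delta> * sqrt L \<le> 1 / 264" by (rule d_le)

lemma \<delta>\<gamma>: "\<delta> * \<gamma> \<le> 1 / 132"
  using dg L by simp

lemma \<delta>2_L: "\<delta>\<^sup>2 * L \<le> 1 / 69696"
proof -
  have "(\<delta> * sqrt L)\<^sup>2 \<le> (1/264)\<^sup>2" using \<delta>_sqrt_L \<delta> L by (intro power_mono) auto
  moreover have "(\<delta> * sqrt L)\<^sup>2 = \<delta>\<^sup>2 * L" using L by (simp add: power_mult_distrib)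
  moreover have "(1/264)\<^sup>2 = (1/69696 :: real)" by (simp add: power2_eq_square)
  ultimately show ?thesis by (simp only:)
qed

lemma \<eta>2: "1 - \<delta> * \<gamma> \<le> \<eta>\<^sup>2" "\<eta>\<^sup>2 < 1"
proof -
  have e: "\<eta>\<^sup>2 = exp (- (\<delta> * \<gamma>))" by (simp add: \<eta>_def eta_def flip: exp_double)
  show "1 - \<delta> * \<gamma> \<le> \<eta>\<^sup>2" using exp_ge_add_one_self[of "- (\<delta> * \<gamma>)"] by (simp add: e)
  show "\<eta>\<^sup>2 < 1" using \<delta> \<gamma>_pos by (simp add: e)
qed

lemma s_pos: "0 < s" and s2: "s\<^sup>2 = 1 - \<eta>\<^sup>2"
  using \<eta>2 by (simp_all add: s_def)

section \<open>The modified norm\<close>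

definition T :: "'a \<times> 'a \<Rightarrow> 'a \<times> 'a" where
  "T z = (fst z + (1 / \<gamma>) *\<^sub>R snd z, sqrt (1 / L - 1 / \<gamma>\<^sup>2) *\<^sub>R snd z)"

text \<open>The square of the modified norm is \<open>\<bar>x\<bar>\<^sup>2 + (2 / \<gamma>) x \<bullet> v + \<bar>v\<bar>\<^sup>2 / L\<close>; the linear map \<open>T\<close> turns the modified norm into the Euclidean one.\<close>

definition N :: "'a \<times> 'a \<Rightarrow> real" where "N z = norm (T z)"

lemma N_triangle: "N (z + w) \<le> N z + N w"
proof -
  have "T (z + w) = T z + T w" by (simp add: T_def algebra_simps)
  then show ?thesis by (simp add: N_def norm_triangle_ineq)
qed

lemma N_nonneg [simp]: "0 \<le> N z" by (simp add: N_def)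

lemma N_zero [simp]: "N 0 = 0" by (simp add: N_def T_def zero_prod_def)

lemma continuous_N: "continuous_on A N"
  unfolding N_def[abs_def] T_def[abs_def] by (intro continuous_intros)

lemma measurable_N [measurable]: "N \<in> borel_measurable borel"
  by (intro borel_measurable_continuous_onI continuous_N)

lemma \<gamma>2: "4 * L \<le> \<gamma>\<^sup>2"
proof -
  have "(2 * sqrt L)\<^sup>2 \<le> \<gamma>\<^sup>2" using \<gamma> L by (intro power_mono) auto
  then show ?thesis using L by (simp add: power_mult_distrib)
qed

lemma N_sq: "(N (x, v))\<^sup>2 = (norm x)\<^sup>2 + 2 / \<gamma> * (x \<bullet> v) + (norm v)\<^sup>2 / L"
proof -
  have "0 \<le> 1 / L - 1 / \<gamma>\<^sup>2" using \<gamma>2 L \<gamma>_pos by (simp add: field_simps)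
  then have "(N (x, v))\<^sup>2 = (norm (x + (1 / \<gamma>) *\<^sub>R v))\<^sup>2 + (1 / L - 1 / \<gamma>\<^sup>2) * (norm v)\<^sup>2"
    by (simp add: N_def T_def norm_Pair power_mult_distrib)
  also have "(norm (x + (1 / \<gamma>) *\<^sub>R v))\<^sup>2 = (norm x)\<^sup>2 + 2 / \<gamma> * (x \<bullet> v) + (norm v)\<^sup>2 / \<gamma>\<^sup>2"
    unfolding power2_norm_eq_inner
    by (simp add: inner_add_left inner_add_right inner_commute power2_eq_square)
  finally show ?thesis by (simp add: algebra_simps)
qed

text \<open>Here \<open>\<gamma> \<ge> 2 * sqrt L\<close> enters the norm comparison, in the form
  \<open>2 / \<gamma> \<le> 1 / sqrt L\<close>.\<close>

lemma cross_term_bound: "2 / \<gamma> * \<bar>x \<bullet> v\<bar> \<le> norm x * (norm v / sqrt L)" for x v :: 'a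
proof -
  have "2 / \<gamma> * \<bar>x \<bullet> v\<bar> \<le> 1 / sqrt L * (norm x * norm v)"
    using \<gamma> \<gamma>_pos L Cauchy_Schwarz_ineq2[of x v] by (intro mult_mono) (auto simp: field_simps)
  then show ?thesis by simp
qed

text \<open>With \<open>X = norm x\<close>, \<open>V = norm v / sqrt L\<close> and a cross term
  between \<open>- X * V\<close> and \<open>X * V\<close>, each bound reduces to the nonnegativity
  of one of the squares of \<open>V - X / 2\<close>, \<open>X - V / 2\<close>,
  \<open>X - V\<close>.\<close>

lemma N_lower:
  "3 / 4 * (norm x)\<^sup>2 \<le> (N (x, v))\<^sup>2" "3 / 4 * ((norm v)\<^sup>2 / L) \<le> (N (x, v))\<^sup>2"
  "1 / 2 * ((norm x)\<^sup>2 + (norm v)\<^sup>2 / L) \<le> (N (x, v))\<^sup>2"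
  and N_upper: "(N (x, v))\<^sup>2 \<le> 3 / 2 * ((norm x)\<^sup>2 + (norm v)\<^sup>2 / L)"
proof -
  define X V where "X = norm x" and "V = norm v / sqrt L"
  have V2: "(norm v)\<^sup>2 / L = V\<^sup>2" using L by (simp add: V_def power_divide)
  have X2: "(norm x)\<^sup>2 = X\<^sup>2" by (simp add: X_def)
  define S where "S = 2 / \<gamma> * (x \<bullet> v)"
  have c: "\<bar>S\<bar> \<le> X * V"
    using cross_term_bound[of x v] \<gamma>_pos by (simp add: abs_mult X_def V_def S_def)
  have sq: "0 \<le> (V - X / 2)\<^sup>2" "0 \<le> (X - V / 2)\<^sup>2" "0 \<le> (X - V)\<^sup>2" by simp_all
  show "3 / 4 * (norm x)\<^sup>2 \<le> (N (x, v))\<^sup>2" "3 / 4 * ((norm v)\<^sup>2 / L) \<le> (N (x, v))\<^sup>2"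
    "1 / 2 * ((norm x)\<^sup>2 + (norm v)\<^sup>2 / L) \<le> (N (x, v))\<^sup>2"
    "(N (x, v))\<^sup>2 \<le> 3 / 2 * ((norm x)\<^sup>2 + (norm v)\<^sup>2 / L)"
    unfolding N_sq V2 X2 S_def[symmetric] using c sq by (simp_all add: power2_eq_square algebra_simps abs_le_iff)
qed

text \<open>\<open>1.16\<close> rounds up \<open>sqrt (4 / 3)\<close>, the constant of the bounds
  for a single component.\<close>

lemma norm_fst_le_N: "norm (fst z) \<le> 1.16 * N z"
  and norm_snd_le_N: "norm (snd z) \<le> 1.16 * sqrt L * N z"
proof -
  obtain x v where z: "z = (x, v)" by force
  have "(norm x)\<^sup>2 \<le> (1.16 * N z)\<^sup>2"
  proof -
    have "(norm x)\<^sup>2 \<le> 4 / 3 * (N z)\<^sup>2" using N_lower(1)[of x v] by (simp add: z)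
    also have "\<dots> \<le> 1.16\<^sup>2 * (N z)\<^sup>2" by (intro mult_right_mono) (auto simp: power2_eq_square)
    finally show ?thesis by (simp only: power_mult_distrib)
  qed
  then show "norm (fst z) \<le> 1.16 * N z" unfolding z fst_conv by (rule power2_le_imp_le) simp
  have "(norm v)\<^sup>2 \<le> (1.16 * sqrt L * N z)\<^sup>2"
  proof -
    have "(norm v)\<^sup>2 \<le> 4 / 3 * L * (N z)\<^sup>2" using N_lower(2)[of v x] L by (simp add: z field_simps)
    also have "\<dots> \<le> 1.16\<^sup>2 * L * (N z)\<^sup>2" using L by (intro mult_right_mono) (auto simp: power2_eq_square)
    also have "\<dots> = 1.16\<^sup>2 * (sqrt L)\<^sup>2 * (N z)\<^sup>2" using L by simp
    finally show ?thesis by (simp only: power_mult_distrib)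
  qed
  then show "norm (snd z) \<le> 1.16 * sqrt L * N z" unfolding z snd_conv by (rule power2_le_imp_le) (use L in simp)
qed

lemma N_le_norm: "N z \<le> sqrt (3 / 2) * max 1 (1 / sqrt L) * norm z"
proof -
  obtain x v where z: "z = (x, v)" by force
  define M where "M = max 1 (1 / sqrt L)"
  have M: "1 \<le> M" "1 / L \<le> M\<^sup>2"
  proof -
    show "1 \<le> M" by (simp add: M_def)
    have "(1 / sqrt L)\<^sup>2 \<le> M\<^sup>2" using L by (intro power_mono) (auto simp: M_def)
    then show "1 / L \<le> M\<^sup>2" using L by (simp add: power_divide)
  qed
  have "(N z)\<^sup>2 \<le> 3 / 2 * (M\<^sup>2 * (norm x)\<^sup>2 + M\<^sup>2 * (norm v)\<^sup>2)"
  proof -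
    have "(norm x)\<^sup>2 \<le> M\<^sup>2 * (norm x)\<^sup>2" using M one_le_power[of M 2] by (simp add: mult_right_mono[of 1 "M\<^sup>2" "(norm x)\<^sup>2", simplified])
    moreover have "(norm v)\<^sup>2 / L \<le> M\<^sup>2 * (norm v)\<^sup>2" using mult_right_mono[OF M(2), of "(norm v)\<^sup>2"] by simp
    ultimately show ?thesis using N_upper[of x v] by (simp add: z)
  qed
  also have "\<dots> = (sqrt (3 / 2) * M * norm z)\<^sup>2" by (simp add: power_mult_distrib z norm_Pair algebra_simps)
  finally show ?thesis unfolding M_def[symmetric] by (rule power2_le_imp_le) (use M in simp)
qed

lemma norm_le_N: "norm z \<le> sqrt 2 * max 1 (sqrt L) * N z"
proof -
  obtain x v where z: "z = (x, v)" by force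
  define M where "M = max 1 (sqrt L)"
  have M: "1 \<le> M" "L \<le> M\<^sup>2"
  proof -
    show "1 \<le> M" by (simp add: M_def)
    have "(sqrt L)\<^sup>2 \<le> M\<^sup>2" using L by (intro power_mono) (auto simp: M_def)
    then show "L \<le> M\<^sup>2" using L by simp
  qed
  have "(norm z)\<^sup>2 \<le> M\<^sup>2 * ((norm x)\<^sup>2 + (norm v)\<^sup>2 / L)"
  proof -
    have "1 * (norm x)\<^sup>2 \<le> M\<^sup>2 * (norm x)\<^sup>2" using M one_le_power[of M 2] by (intro mult_right_mono) auto
    moreover have "L * ((norm v)\<^sup>2 / L) \<le> M\<^sup>2 * ((norm v)\<^sup>2 / L)" using M(2) L by (intro mult_right_mono) auto
    ultimately show ?thesis using L by (simp add: z norm_Pair distrib_left)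
  qed
  also have "\<dots> \<le> M\<^sup>2 * (2 * (N z)\<^sup>2)" using N_lower(3)[of x v] by (intro mult_left_mono) (auto simp: z)
  also have "\<dots> = (sqrt 2 * M * N z)\<^sup>2" by (simp add: power_mult_distrib)
  finally show ?thesis unfolding M_def[symmetric] by (rule power2_le_imp_le) (use M in simp)
qed

definition M :: real where "M = max (sqrt L) (1 / sqrt L)"

text \<open>One of the two maxima is always \<open>1\<close>, so nothing is lost when the comparison
  constants of the two norms are multiplied; with \<open>sqrt (3 / 2) * sqrt 2 = sqrt 3\<close>
  their product is \<open>K1\<close>.\<close>

lemma M_eq: "max 1 (1 / sqrt L) * max 1 (sqrt L) = M"
  and M_ge: "1 \<le> M" "max 1 (1 / sqrt L) \<le> M"
proof -
  have "max 1 (1 / sqrt L) * max 1 (sqrt L) = M \<and> 1 \<le> M"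
  proof (cases "1 \<le> sqrt L")
    case True
    then have "1 / sqrt L \<le> 1" by simp
    moreover from this True have "1 / sqrt L \<le> sqrt L" by linarith
    ultimately show ?thesis using True by (simp only: M_def max_absorb1 max_absorb2 mult_1)
  next
    case False
    then have "1 \<le> 1 / sqrt L" using L by simp
    moreover from False have "sqrt L \<le> 1" by linarith
    moreover from calculation have "sqrt L \<le> 1 / sqrt L" by linarith
    ultimately show ?thesis by (simp only: M_def max_absorb1 max_absorb2 mult_1_right)
  qed
  then show "max 1 (1 / sqrt L) * max 1 (sqrt L) = M" and "1 \<le> M" by auto
  then show "max 1 (1 / sqrt L) \<le> M" by (auto simp: M_def)
qed

section \<open>One step of two chains with common noise\<close>

lemma fst_step: "fst (step z \<omega>) = fst z + \<delta> *\<^sub>R (\<eta> *\<^sub>R snd z + s *\<^sub>R fst \<omega>) - (\<delta>\<^sup>2 / 2) *\<^sub>R grad U (fst z)"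
  and snd_step: "snd (step z \<omega>) = \<eta>\<^sup>2 *\<^sub>R snd z - (\<delta> * \<eta> / 2) *\<^sub>R (grad U (fst z) + grad U (fst (step z \<omega>)))
      + s *\<^sub>R (\<eta> *\<^sub>R fst \<omega> + snd \<omega>)"
  by (cases z; cases \<omega>; simp add: Let_def \<eta>_def s_def)+

lemma step_diff:
  fixes z w \<omega>
  defines "F0 \<equiv> grad U (fst z) - grad U (fst w)" and "F1 \<equiv> grad U (fst (step z \<omega>)) - grad U (fst (step w \<omega>))"
  shows "fst (step z \<omega>) - fst (step w \<omega>) = fst (z - w) + (\<delta> * \<eta>) *\<^sub>R snd (z - w) - (\<delta>\<^sup>2 / 2) *\<^sub>R F0"
    and "snd (step z \<omega>) - snd (step w \<omega>) = \<eta>\<^sup>2 *\<^sub>R snd (z - w) - (\<delta> * \<eta> / 2) *\<^sub>R (F0 + F1)"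
  unfolding F0_def F1_def
  by (subst (1 2) fst_step, simp add: algebra_simps) (subst (1 2) snd_step, simp add: algebra_simps)

text \<open>The common noise cancels from the difference. Dividing velocities by
  \<open>sqrt L\<close> and gradients by \<open>L\<close> brings the remaining recursion into the
  form of \<open>contraction\<close>, whose hypotheses are cocoercivity and strong
  monotonicity.\<close>

lemma step_contraction: "N (step z \<omega> - step w \<omega>) \<le> \<rho> * N (z - w)"
proof -
  define x v F0 F1 where "x = fst (z - w)" and "v = snd (z - w)" and "F0 = grad U (fst z) - grad U (fst w)"
    and "F1 = grad U (fst (step z \<omega>)) - grad U (fst (step w \<omega>))"
  define q where "q = sqrt L"
  have q: "0 < q" "q * q = L" "L \<noteq> 0" "q\<^sup>2 = L" using L by (simp_all add: q_def)
  define v' f0 f1 u x1 v1 where "v' = (1 / q) *\<^sub>R v" and "f0 = (1 / L) *\<^sub>R F0" and "f1 = (1 / L) *\<^sub>R F1"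
    and "u = \<eta> *\<^sub>R v' - (\<delta> * q / 2) *\<^sub>R f0" and "x1 = x + (\<delta> * q) *\<^sub>R u"
    and "v1 = \<eta> *\<^sub>R (u - (\<delta> * q / 2) *\<^sub>R f1)"
  have x1: "fst (step z \<omega> - step w \<omega>) = x1"
  proof -
    have "(\<delta> * q) *\<^sub>R u = (\<delta> * \<eta>) *\<^sub>R v - (\<delta>\<^sup>2 / 2) *\<^sub>R F0"
      using q by (simp add: u_def v'_def f0_def scaleR_diff_right power2_eq_square field_simps)
    then show ?thesis using step_diff(1)[of z \<omega> w] by (simp add: x1_def x_def v_def F0_def)
  qed
  have v1: "snd (step z \<omega> - step w \<omega>) = q *\<^sub>R v1"
  proof -
    have "q *\<^sub>R v1 = \<eta>\<^sup>2 *\<^sub>R v - (\<delta> * \<eta> / 2) *\<^sub>R (F0 + F1)"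
      using q(1) by (simp add: v1_def u_def v'_def f0_def f1_def q(2)[symmetric] scaleR_diff_right scaleR_add_right power2_eq_square field_simps)
    then show ?thesis using step_diff(2)[of z \<omega> w] by (simp add: v_def F0_def F1_def)
  qed
  have coco: "(norm ((1 / L) *\<^sub>R (grad U a - grad U b)))\<^sup>2 \<le> (a - b) \<bullet> ((1 / L) *\<^sub>R (grad U a - grad U b))" for a b
  proof -
    define D where "D = grad U a - grad U b"
    have "(norm D)\<^sup>2 / L\<^sup>2 \<le> L * ((a - b) \<bullet> D) / L\<^sup>2"
      using cocoercive[of a b] by (intro divide_right_mono) (simp_all add: D_def)
    then show ?thesis unfolding D_def[symmetric] using L by (simp add: power_mult_distrib power_divide power2_eq_square)
  qed
  have "(norm x1)\<^sup>2 + 2 / (\<gamma> / q) * (x1 \<bullet> v1) + (norm v1)\<^sup>2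
    \<le> (1 - \<delta> * \<kappa>) * ((norm x)\<^sup>2 + 2 / (\<gamma> / q) * (x \<bullet> v') + (norm v')\<^sup>2)"
    unfolding \<delta>\<kappa>[symmetric] q_def
  proof (rule contraction)
    show "u = \<eta> *\<^sub>R v' - (\<delta> * sqrt L / 2) *\<^sub>R f0" "x1 = x + (\<delta> * sqrt L) *\<^sub>R u"
      "v1 = \<eta> *\<^sub>R (u - (\<delta> * sqrt L / 2) *\<^sub>R f1)" by (simp_all add: u_def x1_def v1_def q_def)
    show "(norm f0)\<^sup>2 \<le> x \<bullet> f0" using coco[of "fst z" "fst w"] by (simp add: x_def f0_def F0_def)
    show "m / L * (norm x)\<^sup>2 \<le> x \<bullet> f0"
    proof -
      have "m * (norm x)\<^sup>2 \<le> x \<bullet> F0" using mono[of "fst z" "fst w"] by (simp add: x_def F0_def)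
      then show ?thesis using L by (simp add: f0_def field_simps)
    qed
    show "(norm f1)\<^sup>2 \<le> x1 \<bullet> f1"
      using coco[of "fst (step z \<omega>)" "fst (step w \<omega>)"] by (simp add: x1[symmetric] f1_def F1_def)
  qed
  moreover have "(norm x1)\<^sup>2 + 2 / (\<gamma> / q) * (x1 \<bullet> v1) + (norm v1)\<^sup>2 = (N (step z \<omega> - step w \<omega>))\<^sup>2"
    using q by (subst (2) prod.collapse[symmetric], unfold N_sq x1 v1) (simp add: power_mult_distrib)
  moreover have "(norm x)\<^sup>2 + 2 / (\<gamma> / q) * (x \<bullet> v') + (norm v')\<^sup>2 = (N (z - w))\<^sup>2"
  proof -
    have "z - w = (x, q *\<^sub>R v')" using q by (simp add: x_def v_def v'_def prod_eq_iff)
    then show ?thesis using q by (simp add: N_sq power_mult_distrib)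
  qed
  ultimately have "(N (step z \<omega> - step w \<omega>))\<^sup>2 \<le> (\<rho> * N (z - w))\<^sup>2"
    by (simp add: power_mult_distrib \<rho>_bounds)
  then show ?thesis by (rule power2_le_imp_le) (use \<rho>_bounds in simp)
qed

end

subsection \<open>Regularization in total variation\<close>

context obabo_chain
begin

abbreviation noise :: "('a \<times> 'a) measure" where "noise \<equiv> std_gaussian"

lemma continuous_grad' [continuous_intros]:
  "continuous_on A f \<Longrightarrow> continuous_on A (\<lambda>x. grad U (f x))"
  by (rule continuous_on_compose2[OF continuous_grad[of UNIV]]) auto

lemma continuous_step: "continuous_on UNIV (\<lambda>p. step (fst p) (snd p))"
proof -
  have f: "continuous_on UNIV (\<lambda>p. fst (step (fst p) (snd p)))"
    unfolding fst_step by (intro continuous_intros)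
  have "continuous_on UNIV (\<lambda>p. snd (step (fst p) (snd p)))"
    unfolding snd_step by (intro continuous_intros f)
  with f have "continuous_on UNIV (\<lambda>p. (fst (step (fst p) (snd p)), snd (step (fst p) (snd p))))"
    by (rule continuous_on_Pair)
  then show ?thesis by simp
qed

lemma measurable_step [measurable]: "(\<lambda>p. step (fst p) (snd p)) \<in> measurable (borel \<Otimes>\<^sub>M borel) borel"
  unfolding borel_prod by (rule borel_measurable_continuous_onI[OF continuous_step])

lemma measurable_step' [measurable (raw)]:
  "f \<in> measurable Q borel \<Longrightarrow> g \<in> measurable Q borel \<Longrightarrow> (\<lambda>x. step (f x) (g x)) \<in> measurable Q borel"
  using measurable_compose[OF measurable_Pair[of f Q borel g borel] measurable_step] by simp

definition P :: "('a \<times> 'a \<Rightarrow> real) \<Rightarrow> 'a \<times> 'a \<Rightarrow> real" where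
  "P f z = (\<integral>\<omega>. f (step z \<omega>) \<partial>noise)"

text \<open>A class preserved by the transition operator, integrable for every probability measure
  and containing the indicators; it detects total variation without moment conditions.\<close>

definition test :: "('a \<times> 'a \<Rightarrow> real) \<Rightarrow> bool" where
  "test f \<longleftrightarrow> f \<in> borel_measurable borel \<and> (\<forall>z. 0 \<le> f z \<and> f z \<le> 1)"

lemma testD: assumes "test f" shows "f \<in> borel_measurable borel" "0 \<le> f z" "f z \<le> 1"
  using assms unfolding test_def by blast+

lemma integrable_test:
  assumes "test f" "prob_space Q" "X \<in> measurable Q borel"
  shows "integrable Q (\<lambda>x. f (X x))"
proof -
  interpret Q: prob_space Q by fact
  show ?thesis
    using testD[OF assms(1)] measurable_compose[OF assms(3) testD(1)[OF assms(1)]]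
    by (intro Q.integrable_const_bound[where B=1]) auto
qed

lemma test_integral:
  assumes "test f" "prob_space Q" and [measurable]: "(\<lambda>(z, x). X z x) \<in> measurable (borel \<Otimes>\<^sub>M Q) borel"
  shows "test (\<lambda>z. \<integral>x. f (X z x) \<partial>Q)"
proof -
  interpret Q: prob_space Q by fact
  note testD(1)[OF assms(1), measurable]
  have Xz: "X z \<in> measurable Q borel" for z
    using measurable_compose[OF measurable_Pair1'[of z borel Q] assms(3)] by simp
  have i: "integrable Q (\<lambda>x. f (X z x))" for z by (rule integrable_test[OF assms(1,2) Xz])
  have "(\<lambda>z. \<integral>x. f (X z x) \<partial>Q) \<in> borel_measurable borel"
    by (rule Q.borel_measurable_lebesgue_integral) measurable
  moreover have "0 \<le> (\<integral>x. f (X z x) \<partial>Q)" for z using testD[OF assms(1)] by simp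
  moreover have "(\<integral>x. f (X z x) \<partial>Q) \<le> 1" for z
    using testD[OF assms(1)] i by (intro Q.integral_le_const) auto
  ultimately show ?thesis by (auto simp: test_def)
qed

lemma test_P: "test f \<Longrightarrow> test (P f)"
  unfolding P_def by (rule test_integral[OF _ prob_space_std_gaussian]) simp_all

lemma test_P_pow: "test f \<Longrightarrow> test ((P ^^ n) f)"
  by (induction n) (auto intro: test_P)

text \<open>The synchronous coupling seen through test functions. The bound is one-sided; exchanging
  \<open>z\<close> and \<open>w\<close> gives the other side.\<close>

lemma P_contraction:
  assumes f: "test f" and lip: "\<And>z w. f z - f w \<le> C * N (z - w)" and C: "0 \<le> C"
  shows "P f z - P f w \<le> C * \<rho> * N (z - w)"
proof -
  have i: "integrable noise (\<lambda>\<omega>. f (step z \<omega>))" for z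
    by (rule integrable_test[OF f prob_space_std_gaussian]) simp
  have "P f z - P f w = (\<integral>\<omega>. f (step z \<omega>) - f (step w \<omega>) \<partial>noise)"
    unfolding P_def using i by simp
  also have "\<dots> \<le> C * \<rho> * N (z - w)"
  proof (rule std_gaussian.integral_le_const)
    show "AE \<omega> in noise. f (step z \<omega>) - f (step w \<omega>) \<le> C * \<rho> * N (z - w)"
    proof (rule AE_I2)
      fix \<omega>
      have "f (step z \<omega>) - f (step w \<omega>) \<le> C * N (step z \<omega> - step w \<omega>)" by (rule lip)
      also have "\<dots> \<le> C * (\<rho> * N (z - w))" using C by (intro mult_left_mono step_contraction)
      finally show "f (step z \<omega>) - f (step w \<omega>) \<le> C * \<rho> * N (z - w)" by simp
    qed
  qed (use i in auto)
  finally show ?thesis .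
qed

lemma noise_shift:
  assumes "test f"
  shows "(\<integral>\<omega>. f (step w (\<omega> + h)) \<partial>noise) - P f w \<le> norm h / sqrt (2 * pi)"
proof -
  have "(\<lambda>\<omega>. f (step w \<omega>)) \<in> borel_measurable borel" using testD(1)[OF assms] by measurable
  then show ?thesis unfolding P_def
    by (intro gaussian_shift_bound[where f="\<lambda>\<omega>. f (step w \<omega>)"]) (use testD[OF assms] in auto)
qed

text \<open>The gap between the positions after one step with common noise. It does not depend on
  the noise, so a deterministic shift can close it.\<close>

definition next_diff :: "'a \<times> 'a \<Rightarrow> 'a \<times> 'a \<Rightarrow> 'a" where
  "next_diff z w = fst (z - w) + (\<delta> * \<eta>) *\<^sub>R snd (z - w) - (\<delta>\<^sup>2 / 2) *\<^sub>R (grad U (fst z) - grad U (fst w))"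

text \<open>Shifting \<open>(G, G')\<close> so that both chains land on the same point after one step.\<close>

lemma P_regularizes:
  assumes f: "test f"
  shows "P f z - P f w \<le> norm (next_diff z w, \<eta> *\<^sub>R fst (z - w)) / (\<delta> * s * sqrt (2 * pi))"
proof -
  define a where "a = next_diff z w"
  \<comment> \<open>The shift of \<open>G\<close> moves the position by \<open>\<delta> * s\<close>
    times its value, which must equal \<open>a\<close>. Once the positions agree, the velocity gap
    still to be closed is \<open>(\<eta> / \<delta>) *\<^sub>R (a - fst (z - w))\<close>; the shift
    of \<open>G\<close> already contributes the part with \<open>a\<close>, which leaves the other
    part to \<open>G'\<close>.\<close>
  define h where "h = (1 / (\<delta> * s)) *\<^sub>R (a, - \<eta> *\<^sub>R fst (z - w))"
  have h: "s *\<^sub>R fst h = (1 / \<delta>) *\<^sub>R a" "s *\<^sub>R snd h = - (\<eta> / \<delta>) *\<^sub>R fst (z - w)"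
    using s_pos by (simp_all add: h_def)
  have 1: "fst (step w (\<omega> + h)) = fst (step z \<omega>)" for \<omega>
  proof -
    have "fst (step w (\<omega> + h)) = fst (step w \<omega>) + \<delta> *\<^sub>R (s *\<^sub>R fst h)"
      by (simp add: fst_step algebra_simps)
    also have "\<delta> *\<^sub>R (s *\<^sub>R fst h) = a" unfolding h using \<delta> by simp
    finally show ?thesis by (simp add: fst_step a_def next_diff_def algebra_simps)
  qed
  have 2: "snd (step w (\<omega> + h)) = snd (step z \<omega>)" for \<omega>
  proof -
    have "snd (step w (\<omega> + h)) = \<eta>\<^sup>2 *\<^sub>R snd w - (\<delta> * \<eta> / 2) *\<^sub>R (grad U (fst w) + grad U (fst (step z \<omega>)))
        + s *\<^sub>R (\<eta> *\<^sub>R fst \<omega> + snd \<omega>) + (\<eta> *\<^sub>R (s *\<^sub>R fst h) + s *\<^sub>R snd h)"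
      by (subst snd_step) (simp add: 1 algebra_simps)
    also have "\<eta> *\<^sub>R (s *\<^sub>R fst h) + s *\<^sub>R snd h = (\<eta> / \<delta>) *\<^sub>R (a - fst (z - w))"
      unfolding h by (simp add: algebra_simps)
    also have "\<dots> = \<eta>\<^sup>2 *\<^sub>R snd (z - w) - (\<delta> * \<eta> / 2) *\<^sub>R (grad U (fst z) - grad U (fst w))"
    proof -
      have "(\<eta> / \<delta>) * (\<delta> * \<eta>) = \<eta>\<^sup>2" "(\<eta> / \<delta>) * (\<delta>\<^sup>2 / 2) = \<delta> * \<eta> / 2"
        using \<delta> by (simp_all add: power2_eq_square)
      moreover have "a - fst (z - w) = (\<delta> * \<eta>) *\<^sub>R snd (z - w) - (\<delta>\<^sup>2 / 2) *\<^sub>R (grad U (fst z) - grad U (fst w))"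
        by (simp add: a_def next_diff_def)
      ultimately show ?thesis by (simp only: scaleR_diff_right scaleR_scaleR)
    qed
    finally show ?thesis by (simp add: snd_step[of z] algebra_simps)
  qed
  have "P f z - P f w = (\<integral>\<omega>. f (step w (\<omega> + h)) \<partial>noise) - P f w"
    unfolding P_def prod_eqI[OF 1 2] ..
  also have "\<dots> \<le> norm h / sqrt (2 * pi)" by (rule noise_shift[OF f])
  also have "norm h = norm (a, \<eta> *\<^sub>R fst (z - w)) / (\<delta> * s)"
  proof -
    have "norm (a, - \<eta> *\<^sub>R fst (z - w)) = norm (a, \<eta> *\<^sub>R fst (z - w))" by (simp add: norm_Pair)
    then show ?thesis unfolding h_def norm_scaleR using \<delta> s_pos by simp
  qed
  finally show ?thesis by (simp add: a_def)
qed

lemma norm_kick_le: "norm ((\<delta> * \<eta>) *\<^sub>R v) \<le> \<delta> * norm v" for v :: 'a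
proof -
  have "\<delta> * \<eta> \<le> \<delta> * 1" using \<delta> \<eta>_bounds by (intro mult_left_mono) auto
  then have "\<bar>\<delta> * \<eta>\<bar> \<le> \<delta>" using \<delta> \<eta>_bounds by (simp add: abs_mult)
  then show ?thesis unfolding norm_scaleR by (intro mult_right_mono) auto
qed

text \<open>By cocoercivity a gradient step of size \<open>\<delta>\<^sup>2 / 2\<close> does not
  expand distances, as \<open>\<delta>\<^sup>2 * L / 4 \<le> 1\<close>; only the velocity term can
  enlarge the gap.\<close>

lemma norm_next_diff_le: "norm (next_diff z w) \<le> norm (fst (z - w)) + \<delta> * norm (snd (z - w))"
proof -
  define x F where "x = fst (z - w)" and "F = grad U (fst z) - grad U (fst w)"
  have c: "(norm F)\<^sup>2 \<le> L * (x \<bullet> F)" using cocoercive[of "fst z" "fst w"] by (simp add: x_def F_def)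
  have F: "0 \<le> x \<bullet> F" using order_trans[OF zero_le_power2 c] L by (simp add: zero_le_mult_iff)
  have "(norm (x - (\<delta>\<^sup>2 / 2) *\<^sub>R F))\<^sup>2 = (norm x)\<^sup>2 - \<delta>\<^sup>2 * (x \<bullet> F) + (\<delta>\<^sup>2)\<^sup>2 / 4 * (norm F)\<^sup>2"
    unfolding power2_norm_eq_inner
    by (simp add: inner_diff_left inner_diff_right inner_commute power2_eq_square)
  also have "\<dots> \<le> (norm x)\<^sup>2"
  proof -
    have "(\<delta>\<^sup>2)\<^sup>2 / 4 * (norm F)\<^sup>2 \<le> (\<delta>\<^sup>2)\<^sup>2 / 4 * (L * (x \<bullet> F))" using c by (intro mult_left_mono) auto
    also have "\<dots> = (\<delta>\<^sup>2 * L / 4) * (\<delta>\<^sup>2 * (x \<bullet> F))" by (simp add: power2_eq_square)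
    also have "\<dots> \<le> 1 * (\<delta>\<^sup>2 * (x \<bullet> F))" using \<delta>2_L F by (intro mult_right_mono) auto
    finally show ?thesis by simp
  qed
  finally have 1: "norm (x - (\<delta>\<^sup>2 / 2) *\<^sub>R F) \<le> norm x" by (rule power2_le_imp_le) simp
  have "next_diff z w = (x - (\<delta>\<^sup>2 / 2) *\<^sub>R F) + (\<delta> * \<eta>) *\<^sub>R snd (z - w)"
    by (simp add: next_diff_def x_def F_def)
  also have "norm \<dots> \<le> norm (x - (\<delta>\<^sup>2 / 2) *\<^sub>R F) + norm ((\<delta> * \<eta>) *\<^sub>R snd (z - w))" by (rule norm_triangle_ineq)
  also have "norm ((\<delta> * \<eta>) *\<^sub>R snd (z - w)) \<le> \<delta> * norm (snd (z - w))"
    by (rule norm_kick_le)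
  finally show ?thesis using 1 by (simp add: x_def)
qed

text \<open>The price of moving the position by one unit: \<open>G\<close> is shifted by
  \<open>1 / (\<delta> * s)\<close>, and \<open>1 / sqrt (2 * pi)\<close> is the bound per unit of
  Gaussian shift. It equals the square root in \<open>K2\<close> divided by
  \<open>\<delta> powr (3 / 2)\<close>.\<close>

definition c0 :: real where "c0 = 1 / (\<delta> * s * sqrt (2 * pi))"

lemma c0_pos: "0 < c0" using \<delta> s_pos by (simp add: c0_def)

text \<open>The case \<open>n = 1\<close>, treated directly in the Euclidean norm. The
  \<open>sqrt 3\<close> arises from \<open>(X + \<delta> * V)\<^sup>2 + X\<^sup>2 \<le> 3 *
  X\<^sup>2 + 2 * \<delta>\<^sup>2 * V\<^sup>2\<close>, and \<open>1 \<le> M\<close>,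
  \<open>\<delta> \<le> M\<close> do the rest.\<close>

lemma P_lipschitz:
  assumes f: "test f"
  shows "P f z - P f w \<le> c0 * (sqrt 3 * M * norm (z - w))"
proof -
  define X V where "X = norm (fst (z - w))" and "V = norm (snd (z - w))"
  have "(norm (next_diff z w, \<eta> *\<^sub>R fst (z - w)))\<^sup>2 \<le> (X + \<delta> * V)\<^sup>2 + X\<^sup>2"
  proof -
    have "(norm (next_diff z w))\<^sup>2 \<le> (X + \<delta> * V)\<^sup>2"
      using norm_next_diff_le[of z w] by (intro power_mono) (auto simp: X_def V_def)
    moreover have "norm (\<eta> *\<^sub>R fst (z - w)) \<le> 1 * X"
      unfolding norm_scaleR X_def using \<eta>_bounds by (intro mult_right_mono) auto
    then have "(norm (\<eta> *\<^sub>R fst (z - w)))\<^sup>2 \<le> X\<^sup>2" by (intro power_mono) auto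
    moreover have "(norm (p, q))\<^sup>2 = (norm p)\<^sup>2 + (norm q)\<^sup>2" for p q :: 'a by (simp add: norm_Pair)
    ultimately show ?thesis by (simp only: add_mono)
  qed
  also have "\<dots> \<le> 3 * X\<^sup>2 + 2 * \<delta>\<^sup>2 * V\<^sup>2"
  proof -
    have "0 \<le> (X - \<delta> * V)\<^sup>2" by simp
    then show ?thesis by (simp add: power2_eq_square algebra_simps)
  qed
  also have "\<dots> \<le> 3 * M\<^sup>2 * (X\<^sup>2 + V\<^sup>2)"
  proof -
    have "X\<^sup>2 \<le> M\<^sup>2 * X\<^sup>2" using M_ge one_le_power[of M 2] by (simp add: mult_right_mono[of 1 "M\<^sup>2" "X\<^sup>2", simplified])
    moreover have "\<delta>\<^sup>2 * V\<^sup>2 \<le> M\<^sup>2 * V\<^sup>2"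
    proof (intro mult_right_mono power_mono)
      have "\<delta> * sqrt L / sqrt L \<le> (1/264) / sqrt L" using \<delta>_sqrt_L L by (intro divide_right_mono) auto
      then have "\<delta> \<le> (1/264) * (1 / sqrt L)" using L by simp
      also have "\<dots> \<le> (1/264) * M" by (simp add: M_def)
      finally show "\<delta> \<le> M" using M_ge by simp
    qed (use \<delta> in auto)
    moreover have "0 \<le> M\<^sup>2 * V\<^sup>2" by simp
    moreover have "3 * M\<^sup>2 * (X\<^sup>2 + V\<^sup>2) = 3 * (M\<^sup>2 * X\<^sup>2) + 3 * (M\<^sup>2 * V\<^sup>2)" by (simp add: algebra_simps)
    moreover have "2 * \<delta>\<^sup>2 * V\<^sup>2 = 2 * (\<delta>\<^sup>2 * V\<^sup>2)" by simp
    ultimately show ?thesis by linarith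
  qed
  also have "\<dots> = (sqrt 3 * M * norm (z - w))\<^sup>2"
    by (simp add: power_mult_distrib X_def V_def norm_prod_def)
  finally have "norm (next_diff z w, \<eta> *\<^sub>R fst (z - w)) \<le> sqrt 3 * M * norm (z - w)"
    by (rule power2_le_imp_le) (use M_ge in simp)
  then have "c0 * norm (next_diff z w, \<eta> *\<^sub>R fst (z - w)) \<le> c0 * (sqrt 3 * M * norm (z - w))"
    using c0_pos by (intro mult_left_mono) auto
  with P_regularizes[OF f, of z w] show ?thesis by (simp add: c0_def)
qed

text \<open>Two steps instead of one: half of the position gap is closed in each step, which avoids the factor
  \<open>sqrt 2\<close> that the one-step coupling loses and that the norm equivalence could not absorb.\<close>

lemma PP_lipschitz:
  assumes f: "test f"
  shows "P (P f) z - P (P f) w \<le> c0 * 1.2 * N (z - w)"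
proof -
  define a where "a = next_diff z w"
  define x v F0 where "x = fst (z - w)" and "v = snd (z - w)" and "F0 = grad U (fst z) - grad U (fst w)"
  \<comment> \<open>Only \<open>G\<close> is shifted, by half of what would close the position gap,
    which leaves the gap \<open>a / 2\<close>. Up to a gradient term the velocity gap becomes
    \<open>\<eta> / \<delta>\<close> times \<open>a / 2 - x\<close>, close to
    \<open>- x / (2 * \<delta>)\<close>, so the next step removes the rest of the position gap
    almost by itself.\<close>
  define k :: "'a \<times> 'a" where "k = ((1 / (2 * \<delta> * s)) *\<^sub>R a, 0)"
  have k: "s *\<^sub>R fst k = (1 / (2 * \<delta>)) *\<^sub>R a" "snd k = 0" using s_pos by (simp_all add: k_def)
  have a_alt: "a - x = (\<delta> * \<eta>) *\<^sub>R v - (\<delta>\<^sup>2 / 2) *\<^sub>R F0" by (simp add: a_def next_diff_def x_def v_def F0_def)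
  have Pf: "test (P f)" by (rule test_P[OF f])
  have shift: "(\<integral>\<omega>. P f (step w (\<omega> + k)) \<partial>noise) - P (P f) w \<le> c0 * (norm a / 2)"
  proof -
    have "norm k = norm a / (2 * \<delta> * s)" using \<delta> s_pos by (simp add: k_def norm_Pair)
    then show ?thesis using noise_shift[OF Pf, of w k] by (simp add: c0_def mult_ac)
  qed
  have a_le: "norm a \<le> norm x + \<delta> * norm v" using norm_next_diff_le[of z w] by (simp add: a_def x_def v_def)
  define n where "n = N (z - w)"
  have n: "0 \<le> n" by (simp add: n_def)
  have x_n: "norm x \<le> 1.16 * n" using norm_fst_le_N[of "z - w"] by (simp add: x_def n_def)
  have v_n: "\<delta> * norm v \<le> 0.0044 * n"
  proof -
    have "\<delta> * norm v \<le> \<delta> * (1.16 * sqrt L * n)"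
      using norm_snd_le_N[of "z - w"] \<delta> by (intro mult_left_mono) (auto simp: v_def n_def)
    also have "\<dots> = 1.16 * (\<delta> * sqrt L) * n" by simp
    also have "\<dots> \<le> 1.16 * (1 / 264) * n" using \<delta>_sqrt_L n by (intro mult_right_mono) auto
    also have "\<dots> \<le> 0.0044 * n" using n by simp
    finally show ?thesis .
  qed
  have ax: "norm (a - x) \<le> 0.0045 * n"
  proof -
    have "norm (a - x) \<le> norm ((\<delta> * \<eta>) *\<^sub>R v) + norm ((\<delta>\<^sup>2 / 2) *\<^sub>R F0)" unfolding a_alt by (rule norm_triangle_ineq4)
    also have "norm ((\<delta> * \<eta>) *\<^sub>R v) \<le> \<delta> * norm v"
      by (rule norm_kick_le)
    also have "norm ((\<delta>\<^sup>2 / 2) *\<^sub>R F0) \<le> \<delta>\<^sup>2 / 2 * (L * norm x)"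
      using lip[of "fst z" "fst w"] by (auto simp: F0_def x_def intro!: mult_left_mono)
    also have "\<delta>\<^sup>2 / 2 * (L * norm x) = \<delta>\<^sup>2 * L * (norm x / 2)" by simp
    also have "\<dots> \<le> 1 / 69696 * (norm x / 2)" using \<delta>2_L by (intro mult_right_mono) auto
    finally show ?thesis using x_n v_n n by simp
  qed
  have "(\<integral>\<omega>. P f (step z \<omega>) \<partial>noise) - (\<integral>\<omega>. P f (step w (\<omega> + k)) \<partial>noise)
     = (\<integral>\<omega>. P f (step z \<omega>) - P f (step w (\<omega> + k)) \<partial>noise)"
    by (intro Bochner_Integration.integral_diff[symmetric] integrable_test[OF Pf prob_space_std_gaussian]) measurable
  also have "\<dots> \<le> c0 * (norm a / 2 + 0.02 * n)"
  proof (rule std_gaussian.integral_le_const)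
    show "integrable noise (\<lambda>\<omega>. P f (step z \<omega>) - P f (step w (\<omega> + k)))"
      by (intro Bochner_Integration.integrable_diff integrable_test[OF Pf prob_space_std_gaussian]) measurable
    show "AE \<omega> in noise. P f (step z \<omega>) - P f (step w (\<omega> + k)) \<le> c0 * (norm a / 2 + 0.02 * n)"
    proof (rule AE_I2)
      fix \<omega>
      define z1 w1 where "z1 = step z \<omega>" and "w1 = step w (\<omega> + k)"
      define F1 where "F1 = grad U (fst z1) - grad U (fst w1)"
      have x1: "fst (z1 - w1) = (1/2) *\<^sub>R a"
      proof -
        have "fst w1 = fst (step w \<omega>) + \<delta> *\<^sub>R (s *\<^sub>R fst k)"
          by (simp add: w1_def fst_step algebra_simps)
        also have "\<delta> *\<^sub>R (s *\<^sub>R fst k) = (1/2) *\<^sub>R a" unfolding k using \<delta> by simp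
        finally have "fst (z1 - w1) = fst (step z \<omega>) - fst (step w \<omega>) - (1/2) *\<^sub>R a"
          by (simp add: z1_def)
        also have "fst (step z \<omega>) - fst (step w \<omega>) = a"
          unfolding step_diff(1) by (simp add: a_def next_diff_def)
        also have "a - (1/2) *\<^sub>R a = (1/2) *\<^sub>R a" by (metis scaleR_half_double add_diff_cancel_left' scaleR_add_right)
        finally show ?thesis .
      qed
      have v1: "snd (z1 - w1) = (\<eta> / \<delta>) *\<^sub>R ((1/2) *\<^sub>R a - x) - (\<delta> * \<eta> / 2) *\<^sub>R F1"
      proof -
        have A: "snd w1 = \<eta>\<^sup>2 *\<^sub>R snd w - (\<delta> * \<eta> / 2) *\<^sub>R (grad U (fst w) + grad U (fst w1))
             + s *\<^sub>R (\<eta> *\<^sub>R fst \<omega> + snd \<omega>) + \<eta> *\<^sub>R (s *\<^sub>R fst k)"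
          unfolding w1_def by (subst snd_step) (simp add: k(2) algebra_simps)
        have B: "snd z1 = \<eta>\<^sup>2 *\<^sub>R snd z - (\<delta> * \<eta> / 2) *\<^sub>R (grad U (fst z) + grad U (fst z1))
             + s *\<^sub>R (\<eta> *\<^sub>R fst \<omega> + snd \<omega>)"
          unfolding z1_def by (subst snd_step) simp
        have "snd (z1 - w1) = \<eta>\<^sup>2 *\<^sub>R v - (\<delta> * \<eta> / 2) *\<^sub>R F0 - (\<delta> * \<eta> / 2) *\<^sub>R F1 - \<eta> *\<^sub>R (s *\<^sub>R fst k)"
          unfolding snd_diff A B by (simp add: v_def F0_def F1_def algebra_simps)
        also have "\<eta>\<^sup>2 *\<^sub>R v - (\<delta> * \<eta> / 2) *\<^sub>R F0 = (\<eta> / \<delta>) *\<^sub>R (a - x)"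
        proof -
          have "(\<eta> / \<delta>) * (\<delta> * \<eta>) = \<eta>\<^sup>2" "(\<eta> / \<delta>) * (\<delta>\<^sup>2 / 2) = \<delta> * \<eta> / 2"
            using \<delta> by (simp_all add: power2_eq_square)
          then show ?thesis unfolding a_alt by (simp only: scaleR_diff_right scaleR_scaleR)
        qed
        also have "\<eta> *\<^sub>R (s *\<^sub>R fst k) = (\<eta> / \<delta>) *\<^sub>R ((1/2) *\<^sub>R a)" unfolding k by simp
        also have "(\<eta> / \<delta>) *\<^sub>R (a - x) - (\<delta> * \<eta> / 2) *\<^sub>R F1 - (\<eta> / \<delta>) *\<^sub>R ((1/2) *\<^sub>R a)
            = (\<eta> / \<delta>) *\<^sub>R ((a - (1/2) *\<^sub>R a) - x) - (\<delta> * \<eta> / 2) *\<^sub>R F1"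
          by (simp only: scaleR_diff_right) (simp add: algebra_simps)
        also have "a - (1/2) *\<^sub>R a = (1/2) *\<^sub>R a" by (metis scaleR_half_double add_diff_cancel_left' scaleR_add_right)
        finally show ?thesis .
      qed
      \<comment> \<open>Every term is small: \<open>a - x\<close> and
        \<open>1 - \<eta>\<^sup>2\<close> vanish with \<open>\<delta>\<close>, and the gradient term
        carries \<open>\<delta>\<^sup>2\<close>. Meeting in the second step therefore costs little
        more than the shift of \<open>G'\<close>, proportional to \<open>norm a / 2\<close>.\<close>
      have a1: "next_diff z1 w1 = ((1 + \<eta>\<^sup>2) / 2) *\<^sub>R (a - x) + ((1 - \<eta>\<^sup>2) / 2) *\<^sub>R x - ((1 + \<eta>\<^sup>2) * \<delta>\<^sup>2 / 2) *\<^sub>R F1"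
      proof -
        have "next_diff z1 w1 = (1/2) *\<^sub>R a + (\<delta> * \<eta>) *\<^sub>R ((\<eta> / \<delta>) *\<^sub>R ((1/2) *\<^sub>R a - x) - (\<delta> * \<eta> / 2) *\<^sub>R F1) - (\<delta>\<^sup>2 / 2) *\<^sub>R F1"
          unfolding next_diff_def x1 v1 F1_def ..
        also have "(\<delta> * \<eta>) *\<^sub>R ((\<eta> / \<delta>) *\<^sub>R ((1/2) *\<^sub>R a - x) - (\<delta> * \<eta> / 2) *\<^sub>R F1)
            = (\<eta>\<^sup>2) *\<^sub>R ((1/2) *\<^sub>R a - x) - (\<eta>\<^sup>2 * \<delta>\<^sup>2 / 2) *\<^sub>R F1"
          using \<delta> by (simp add: scaleR_diff_right[of "\<delta> * \<eta>"] power2_eq_square mult_ac)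
        also have "(1/2) *\<^sub>R a + (\<eta>\<^sup>2 *\<^sub>R ((1/2) *\<^sub>R a - x) - (\<eta>\<^sup>2 * \<delta>\<^sup>2 / 2) *\<^sub>R F1) - (\<delta>\<^sup>2 / 2) *\<^sub>R F1
           = ((1 + \<eta>\<^sup>2) / 2) *\<^sub>R (a - x) + ((1 - \<eta>\<^sup>2) / 2) *\<^sub>R x - ((1 + \<eta>\<^sup>2) * \<delta>\<^sup>2 / 2) *\<^sub>R F1"
          by (rule euclidean_eqI) (simp add: inner_add_left inner_diff_left field_simps)
        finally show ?thesis .
      qed
      have F1: "norm F1 \<le> L * (norm a / 2)"
        using lip[of "fst z1" "fst w1"] x1 by (simp add: F1_def)
      have e: "0 \<le> \<eta>\<^sup>2" "\<eta>\<^sup>2 \<le> 1" "1 - \<eta>\<^sup>2 \<le> 1/132" using \<eta>2 \<delta>\<gamma> by auto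
      have "norm (next_diff z1 w1) \<le> norm (((1 + \<eta>\<^sup>2) / 2) *\<^sub>R (a - x)) + norm (((1 - \<eta>\<^sup>2) / 2) *\<^sub>R x)
          + norm (((1 + \<eta>\<^sup>2) * \<delta>\<^sup>2 / 2) *\<^sub>R F1)"
        unfolding a1 by (rule order_trans[OF norm_triangle_ineq4]) (intro add_right_mono norm_triangle_ineq)
      also have "norm (((1 + \<eta>\<^sup>2) / 2) *\<^sub>R (a - x)) \<le> 1 * norm (a - x)"
        unfolding norm_scaleR using e by (intro mult_right_mono) auto
      also have "norm (((1 - \<eta>\<^sup>2) / 2) *\<^sub>R x) \<le> 1 / 264 * norm x"
        unfolding norm_scaleR using e by (intro mult_right_mono) auto
      also have "norm (((1 + \<eta>\<^sup>2) * \<delta>\<^sup>2 / 2) *\<^sub>R F1) \<le> 1 / 69696 * (norm a / 2)"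
      proof -
        have "norm (((1 + \<eta>\<^sup>2) * \<delta>\<^sup>2 / 2) *\<^sub>R F1) \<le> \<delta>\<^sup>2 * (L * (norm a / 2))"
          unfolding norm_scaleR using e F1 by (intro mult_mono) (auto simp: abs_mult field_simps mult_left_le)
        also have "\<dots> = \<delta>\<^sup>2 * L * (norm a / 2)" by simp
        also have "\<dots> \<le> 1 / 69696 * (norm a / 2)" using \<delta>2_L by (intro mult_right_mono) auto
        finally show ?thesis .
      qed
      finally have na1: "norm (next_diff z1 w1) \<le> 0.02 * n" using ax x_n v_n a_le n by simp
      have "norm (next_diff z1 w1, \<eta> *\<^sub>R fst (z1 - w1)) \<le> norm (next_diff z1 w1) + norm (\<eta> *\<^sub>R fst (z1 - w1))"
        by (rule norm_Pair_le)
      also have "norm (\<eta> *\<^sub>R fst (z1 - w1)) \<le> norm a / 2"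
        unfolding x1 using \<eta>_bounds by (simp add: mult_left_le_one_le)
      finally have "norm (next_diff z1 w1, \<eta> *\<^sub>R fst (z1 - w1)) \<le> norm a / 2 + 0.02 * n" using na1 by simp
      then have "c0 * norm (next_diff z1 w1, \<eta> *\<^sub>R fst (z1 - w1)) \<le> c0 * (norm a / 2 + 0.02 * n)"
        using c0_pos by (intro mult_left_mono) auto
      with P_regularizes[OF f, of z1 w1] show "P f (step z \<omega>) - P f (step w (\<omega> + k)) \<le> c0 * (norm a / 2 + 0.02 * n)"
        by (simp add: c0_def z1_def w1_def)
    qed
  qed
  finally have "P (P f) z - P (P f) w \<le> c0 * (norm a / 2 + 0.02 * n) + c0 * (norm a / 2)"
    using shift unfolding P_def[of "P f" z] by simp
  also have "\<dots> = c0 * (norm a + 0.02 * n)" by (simp add: algebra_simps)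
  \<comment> \<open>Each step costs about \<open>norm a / 2\<close>, in units of \<open>c0\<close>;
    the total fits since \<open>1.16 + 0.0044 + 0.02 < 1.2\<close>.\<close>
  also have "\<dots> \<le> c0 * (1.2 * n)" using c0_pos a_le x_n v_n n by (intro mult_left_mono) auto
  finally show ?thesis by (simp add: n_def)
qed

text \<open>For \<open>n \<ge> 2\<close> two steps regularize and only \<open>n - 2\<close>
  contract. The missing factor \<open>\<rho> \<ge> 0.9\<close> is made up by the constants:
  \<open>1.2 * sqrt (3 / 2)\<close> is below \<open>0.9 * sqrt 3\<close>.\<close>

lemma P_pow_lipschitz:
  assumes f: "test f" and n: "1 \<le> n"
  shows "(P ^^ n) f z - (P ^^ n) f w \<le> c0 * (sqrt 3 * M * \<rho> ^ (n - 1)) * norm (z - w)"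
proof (cases "n = 1")
  case True
  then show ?thesis using P_lipschitz[OF f, of z w] by (simp add: mult_ac)
next
  case False
  then obtain k where k: "n = Suc (Suc k)" using n by (metis One_nat_def Suc_le_D le_SucE not_less_eq_eq)
  have *: "(P ^^ Suc (Suc k)) f z - (P ^^ Suc (Suc k)) f w \<le> c0 * 1.2 * \<rho> ^ k * N (z - w)" for z w k
  proof (induction k arbitrary: z w)
    case 0
    then show ?case using PP_lipschitz[OF f] by simp
  next
    case (Suc k)
    have "P ((P ^^ Suc (Suc k)) f) z - P ((P ^^ Suc (Suc k)) f) w \<le> c0 * 1.2 * \<rho> ^ k * \<rho> * N (z - w)"
      using Suc c0_pos \<rho>_bounds by (intro P_contraction test_P_pow f) auto
    then show ?case by (simp add: mult_ac)
  qed
  have "c0 * 1.2 * \<rho> ^ k * N (z - w) \<le> c0 * 1.2 * \<rho> ^ k * (sqrt (3 / 2) * max 1 (1 / sqrt L) * norm (z - w))"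
    using c0_pos \<rho>_bounds by (intro mult_left_mono N_le_norm) auto
  also have "\<dots> \<le> c0 * 1.2 * \<rho> ^ k * (sqrt (3 / 2) * M * norm (z - w))"
    using c0_pos \<rho>_bounds M_ge by (intro mult_left_mono mult_right_mono) auto
  also have "\<dots> = 1.2 * sqrt (3 / 2) * (c0 * \<rho> ^ k * M * norm (z - w))" by simp
  also have "\<dots> \<le> sqrt 3 * \<rho> * (c0 * \<rho> ^ k * M * norm (z - w))"
  proof (intro mult_right_mono)
    have "1.2 * sqrt (3 / 2) \<le> sqrt 3 * 0.9"
    proof (rule power2_le_imp_le)
      show "(1.2 * sqrt (3 / 2))\<^sup>2 \<le> (sqrt 3 * 0.9)\<^sup>2" by (simp add: power_mult_distrib power2_eq_square)
    qed simp
    also have "\<dots> \<le> sqrt 3 * \<rho>" using \<rho>_bounds by simp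
    finally show "1.2 * sqrt (3 / 2) \<le> sqrt 3 * \<rho>" .
  qed (use c0_pos \<rho>_bounds M_ge in auto)
  finally show ?thesis using *[of k z w] unfolding k by (simp add: mult_ac)
qed

end

subsection \<open>The chain and its target as measures\<close>

context obabo_chain
begin

abbreviation kernel :: "'a \<times> 'a \<Rightarrow> ('a \<times> 'a) measure" where
  "kernel \<equiv> obabo_kernel \<delta> \<gamma> U"

lemma kernel_eq: "kernel z = distr noise borel (step z)"
  unfolding obabo_kernel_def pair_std_gaussian ..

lemma measurable_kernel: "kernel \<in> measurable borel (subprob_algebra borel)"
  unfolding kernel_eq[abs_def]
proof (rule measurable_distr2[where M=borel])
  have "noise \<in> space (subprob_algebra borel)"
    by (simp add: space_subprob_algebra prob_space_imp_subprob_space prob_space_std_gaussian)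
  then show "(\<lambda>_. noise) \<in> measurable borel (subprob_algebra borel)" by simp
  show "case_prod step \<in> measurable (borel \<Otimes>\<^sub>M borel) borel"
    using measurable_step by (simp add: case_prod_unfold)
qed

lemma nn_integral_invariant:
  assumes inv: "invariant_prob kernel \<nu>" and f[measurable]: "f \<in> borel_measurable borel"
  shows "(\<integral>\<^sup>+z. f z \<partial>\<nu>) = (\<integral>\<^sup>+z. \<integral>\<^sup>+\<omega>. f (step z \<omega>) \<partial>noise \<partial>\<nu>)"
proof -
  have [measurable_cong]: "sets \<nu> = sets borel" and bind: "\<nu> \<bind> kernel = \<nu>"
    using inv by (auto simp: invariant_prob_def)
  have k: "kernel \<in> measurable \<nu> (subprob_algebra borel)"
    using measurable_kernel by (simp cong: measurable_cong_sets)
  have "(\<integral>\<^sup>+z. f z \<partial>\<nu>) = (\<integral>\<^sup>+z. \<integral>\<^sup>+y. f y \<partial>kernel z \<partial>\<nu>)"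
    by (subst bind[symmetric], rule nn_integral_bind[OF f k])
  then show ?thesis by (simp add: kernel_eq nn_integral_distr)
qed

text \<open>Passes from nonnegative integrals of all measurable functions to real integrals of test
  functions, when \<open>\<nu>\<close> is the image of the product of \<open>\<mu>\<close> and
  \<open>Q\<close> under \<open>X\<close>. It serves for invariance and for the splitting of a
  step.\<close>

lemma test_integral_disintegrate:
  fixes \<nu> \<mu> :: "('a \<times> 'a) measure"
  assumes f: "test f" and Q: "prob_space Q" and \<nu>: "prob_space \<nu>" "sets \<nu> = sets borel" and \<mu>: "prob_space \<mu>" "sets \<mu> = sets borel"
    and X: "(\<lambda>(z, x). X z x) \<in> measurable (borel \<Otimes>\<^sub>M Q) borel"
    and eq: "\<And>g. g \<in> borel_measurable borel \<Longrightarrow> (\<integral>\<^sup>+z. g z \<partial>\<nu>) = (\<integral>\<^sup>+z. \<integral>\<^sup>+x. g (X z x) \<partial>Q \<partial>\<mu>)"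
  shows "(\<integral>z. f z \<partial>\<nu>) = (\<integral>z. (\<integral>x. f (X z x) \<partial>Q) \<partial>\<mu>)"
proof -
  note [measurable] = testD(1)[OF f]
  note [measurable_cong] = \<nu>(2) \<mu>(2)
  have Xz: "X z \<in> measurable Q borel" for z
    using measurable_compose[OF measurable_Pair1'[of z borel Q] X] by simp
  define h where "h z = (\<integral>x. f (X z x) \<partial>Q)" for z
  have h: "test h" unfolding h_def[abs_def] by (rule test_integral[OF f Q X])
  have "ennreal (\<integral>z. f z \<partial>\<nu>) = (\<integral>\<^sup>+z. ennreal (f z) \<partial>\<nu>)"
    using testD[OF f] by (intro nn_integral_eq_integral[symmetric] integrable_test[OF f \<nu>(1)] AE_I2) auto
  also have "\<dots> = (\<integral>\<^sup>+z. \<integral>\<^sup>+x. ennreal (f (X z x)) \<partial>Q \<partial>\<mu>)" by (rule eq) simp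
  also have "\<dots> = (\<integral>\<^sup>+z. ennreal (h z) \<partial>\<mu>)"
    unfolding h_def
    using testD[OF f] by (intro nn_integral_cong nn_integral_eq_integral integrable_test[OF f Q Xz] AE_I2) auto
  also have "\<dots> = ennreal (\<integral>z. h z \<partial>\<mu>)"
    using testD[OF h] by (intro nn_integral_eq_integral integrable_test[OF h \<mu>(1)] AE_I2) auto
  finally have "ennreal (\<integral>z. f z \<partial>\<nu>) = ennreal (\<integral>z. h z \<partial>\<mu>)" .
  then show ?thesis using testD[OF f] testD[OF h] unfolding h_def by (subst (asm) ennreal_inj) auto
qed

lemma integral_P_invariant:
  assumes inv: "invariant_prob kernel \<nu>" and f: "test f"
  shows "(\<integral>z. P f z \<partial>\<nu>) = (\<integral>z. f z \<partial>\<nu>)"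
proof -
  have \<nu>: "prob_space \<nu>" "sets \<nu> = sets borel" using inv by (auto simp: invariant_prob_def)
  have "(\<integral>z. f z \<partial>\<nu>) = (\<integral>z. (\<integral>\<omega>. f (step z \<omega>) \<partial>noise) \<partial>\<nu>)"
  proof (rule test_integral_disintegrate[OF f prob_space_std_gaussian \<nu> \<nu>, where X=step])
    show "case_prod step \<in> measurable (borel \<Otimes>\<^sub>M noise) borel" by (simp add: case_prod_unfold)
  qed (rule nn_integral_invariant[OF inv])
  then show ?thesis by (simp add: P_def)
qed

lemma integral_P_pow_invariant:
  assumes inv: "invariant_prob kernel \<nu>" and f: "test f"
  shows "(\<integral>z. (P ^^ n) f z \<partial>\<nu>) = (\<integral>z. f z \<partial>\<nu>)"
  by (induction n) (simp_all add: integral_P_invariant[OF inv test_P_pow[OF f]])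

section \<open>The target measure\<close>

lemma continuous_U: "continuous_on A U"
proof (intro continuous_at_imp_continuous_on ballI)
  fix x show "isCont U x" using gderiv[of x] unfolding gderiv_def by (rule has_derivative_continuous)
qed

lemma measurable_U [measurable]: "U \<in> borel_measurable borel"
  by (intro borel_measurable_continuous_onI continuous_U)

text \<open>Strong convexity at the origin; Young's inequality absorbs the linear term at the cost
  of half of the coefficient \<open>m / 2\<close>.\<close>

lemma U_lower: "U 0 - (norm (grad U 0))\<^sup>2 / m + m / 4 * (norm x)\<^sup>2 \<le> U x"
proof -
  have "U 0 + x \<bullet> grad U 0 + m / 2 * (norm x)\<^sup>2 \<le> U x"
    using strongly_convex_lower_bound[OF gderiv mono, of 0 x] by simp
  moreover have "(-1) * (grad U 0 \<bullet> x) \<le> m / 4 * (norm x)\<^sup>2 + 1\<^sup>2 / (4 * (m / 4)) * (norm (grad U 0))\<^sup>2"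
    using m by (intro weighted_cauchy_schwarz) auto
  ultimately show ?thesis by (simp add: inner_commute)
qed

definition weight :: "'a \<times> 'a \<Rightarrow> real" where
  "weight z = exp (- U (fst z) - (norm (snd z))\<^sup>2 / 2)"

lemma weight_pos: "0 < weight z" by (simp add: weight_def)

lemma measurable_weight [measurable]: "weight \<in> borel_measurable borel"
  unfolding weight_def[abs_def] borel_prod[symmetric] by measurable

text \<open>Domination by a Gaussian makes the weight normalisable and gives the target moments of
  all orders.\<close>

lemma weight_le: "\<exists>K c. 0 < c \<and> 0 \<le> K \<and> (\<forall>z. weight z \<le> K * exp (- c * (norm z)\<^sup>2))"
proof (intro exI conjI allI)
  let ?c = "min (m / 4) (1 / 2)" and ?K = "exp (- (U 0 - (norm (grad U 0))\<^sup>2 / m))"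
  show "0 < ?c" using m by simp
  show "0 \<le> ?K" by simp
  fix z :: "'a \<times> 'a"
  have "?c * (norm (fst z))\<^sup>2 \<le> m / 4 * (norm (fst z))\<^sup>2" "?c * (norm (snd z))\<^sup>2 \<le> 1 / 2 * (norm (snd z))\<^sup>2"
    by (intro mult_right_mono; simp)+
  moreover have "(norm z)\<^sup>2 = (norm (fst z))\<^sup>2 + (norm (snd z))\<^sup>2" by (simp add: norm_prod_def)
  ultimately have "- U (fst z) - (norm (snd z))\<^sup>2 / 2 \<le> - (U 0 - (norm (grad U 0))\<^sup>2 / m) + - ?c * (norm z)\<^sup>2"
    using U_lower[of "fst z"] by (simp only: distrib_left mult_minus_left)
  then show "weight z \<le> ?K * exp (- ?c * (norm z)\<^sup>2)"
    unfolding weight_def exp_add[symmetric] by simp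
qed

lemma integrable_weight: "integrable lborel weight"
proof (rule integrableI_nonneg)
  obtain K c where c: "0 < c" "0 \<le> K" "\<And>z. weight z \<le> K * exp (- c * (norm z)\<^sup>2)" using weight_le by blast
  have "(\<integral>\<^sup>+z. ennreal (weight z) \<partial>lborel) \<le> (\<integral>\<^sup>+z. ennreal K * ennreal (exp (- c * (norm (z :: 'a \<times> 'a))\<^sup>2)) \<partial>lborel)"
    using c by (intro nn_integral_mono) (simp add: ennreal_mult[symmetric] ennreal_leI)
  also have "\<dots> < \<infinity>"
    using nn_integral_exp_neg_norm_sq[OF c(1), where 'a="'a \<times> 'a"] by (subst nn_integral_cmult) (auto simp: ennreal_mult_less_top)
  finally show "(\<integral>\<^sup>+z. ennreal (weight z) \<partial>lborel) < \<infinity>" .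
qed (auto intro!: AE_I2 less_imp_le weight_pos)

definition Z :: real where "Z = (\<integral>z. weight z \<partial>lborel)"

lemma Z_pos: "0 < Z"
proof -
  have "Z \<noteq> 0"
  proof
    assume "Z = 0"
    then have "AE z in lborel. weight z = 0"
      unfolding Z_def using integrable_weight weight_pos
      by (subst (asm) integral_nonneg_eq_0_iff_AE) (auto intro!: AE_I2 less_imp_le[OF weight_pos])
    then have "AE z in (lborel :: ('a \<times> 'a) measure). False"
      by eventually_elim (metis weight_pos less_irrefl)
    then show False by (simp add: AE_iff_measurable[where N=UNIV])
  qed
  moreover have "0 \<le> Z" unfolding Z_def by (intro integral_nonneg_AE AE_I2) (simp add: weight_pos less_imp_le)
  ultimately show ?thesis by simp
qed

abbreviation target :: "('a \<times> 'a) measure" where "target \<equiv> target_measure U"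

lemma target_eq: "target = density lborel (\<lambda>z. ennreal (weight z / Z))"
  by (simp add: target_measure_def Let_def Z_def weight_def case_prod_unfold)

lemma sets_target [simp, measurable_cong]: "sets target = sets borel"
  by (simp add: target_eq)

lemma prob_space_target: "prob_space target"
proof
  have "emeasure target (space target) = (\<integral>\<^sup>+z. ennreal (weight z / Z) \<partial>lborel)"
    by (simp add: target_eq emeasure_density)
  also have "\<dots> = ennreal (\<integral>z. weight z / Z \<partial>lborel)"
    using integrable_weight Z_pos by (intro nn_integral_eq_integral AE_I2) (auto simp: weight_pos less_imp_le)
  also have "(\<integral>z. weight z / Z \<partial>lborel) = 1" using Z_pos by (simp add: Z_def)
  finally show "emeasure target (space target) = 1" by simp
qed

text \<open>Under the target the velocity is standard Gaussian and independent of the position;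
  \<open>sqrt (2 * pi) ^ DIM('a)\<close> compensates its normalisation. Operations on the velocity
  alone act on the inner integral.\<close>

lemma nn_integral_target:
  assumes [measurable]: "f \<in> borel_measurable borel"
  shows "(\<integral>\<^sup>+z. f z \<partial>target) = (\<integral>\<^sup>+x. ennreal (exp (- U x) * sqrt (2 * pi) ^ DIM('a) / Z) * (\<integral>\<^sup>+v. f (x, v) \<partial>std_gaussian) \<partial>lborel)"
proof -
  let ?q = "\<lambda>x. exp (- U x) * sqrt (2 * pi) ^ DIM('a) / Z"
  have w: "weight (x, v) / Z = ?q x * gaussian_density v" for x v
  proof -
    have "exp (- U x - (norm v)\<^sup>2 / 2) = exp (- U x) * exp (- (norm v)\<^sup>2 / 2)" by (simp flip: exp_add)
    then show ?thesis by (simp add: weight_def gaussian_density_def power_divide)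
  qed
  have f': "f \<in> borel_measurable (borel \<Otimes>\<^sub>M borel)" by (simp add: borel_prod)
  have "(\<integral>\<^sup>+z. f z \<partial>target) = (\<integral>\<^sup>+z. ennreal (weight z / Z) * f z \<partial>(lborel \<Otimes>\<^sub>M lborel))"
    by (simp add: target_eq nn_integral_density lborel_prod)
  also have "\<dots> = (\<integral>\<^sup>+x. \<integral>\<^sup>+v. ennreal (weight (x, v) / Z) * f (x, v) \<partial>lborel \<partial>lborel)"
    by (subst lborel.nn_integral_fst[symmetric]) (simp_all add: lborel_prod)
  also have "\<dots> = (\<integral>\<^sup>+x. ennreal (?q x) * (\<integral>\<^sup>+v. f (x, v) \<partial>std_gaussian) \<partial>lborel)"
  proof (intro nn_integral_cong)
    fix x :: 'a
    have fx: "(\<lambda>v. f (x, v)) \<in> borel_measurable borel" using f' by (rule measurable_compose[rotated]) simp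
    have "(\<integral>\<^sup>+v. ennreal (weight (x, v) / Z) * f (x, v) \<partial>lborel) = (\<integral>\<^sup>+v. ennreal (?q x) * (ennreal (gaussian_density v) * f (x, v)) \<partial>lborel)"
    proof (intro nn_integral_cong)
      fix v :: 'a
      have "ennreal (weight (x, v) / Z) = ennreal (?q x) * ennreal (gaussian_density v)"
        unfolding w using Z_pos by (intro ennreal_mult) (auto simp: gaussian_density_pos less_imp_le)
      then show "ennreal (weight (x, v) / Z) * f (x, v) = ennreal (?q x) * (ennreal (gaussian_density v) * f (x, v))"
        by (simp only: mult.assoc)
    qed
    also have "\<dots> = ennreal (?q x) * (\<integral>\<^sup>+v. f (x, v) \<partial>std_gaussian)"
      using fx by (simp add: nn_integral_cmult std_gaussian_eq nn_integral_density)
    finally show "(\<integral>\<^sup>+v. ennreal (weight (x, v) / Z) * f (x, v) \<partial>lborel) = ennreal (?q x) * (\<integral>\<^sup>+v. f (x, v) \<partial>std_gaussian)" .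
  qed
  finally show ?thesis .
qed

section \<open>Splitting of a step into Ornstein--Uhlenbeck and Verlet stages\<close>

definition ou :: "'a \<times> 'a \<Rightarrow> 'a \<Rightarrow> 'a \<times> 'a" where
  "ou z g = (fst z, \<eta> *\<^sub>R snd z + s *\<^sub>R g)"

lemma measurable_ou [measurable (raw)]:
  "f \<in> measurable Q borel \<Longrightarrow> g \<in> measurable Q borel \<Longrightarrow> (\<lambda>x. ou (f x) (g x)) \<in> measurable Q borel"
proof -
  assume fg: "f \<in> measurable Q borel" "g \<in> measurable Q borel"
  have "(\<lambda>p. ou (fst p) (snd p)) \<in> measurable (borel \<Otimes>\<^sub>M borel) borel"
    unfolding borel_prod ou_def by (intro borel_measurable_continuous_onI continuous_intros)
  from measurable_compose[OF measurable_Pair[OF fg] this] show ?thesis by simp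
qed

lemma measurable_verlet [measurable]: "verlet \<delta> U \<in> measurable borel borel"
proof -
  have "verlet \<delta> U z = (let x' = fst z + \<delta> *\<^sub>R snd z - (\<delta>\<^sup>2 / 2) *\<^sub>R grad U (fst z)
     in (x', snd z - (\<delta> / 2) *\<^sub>R (grad U (fst z) + grad U x')))" for z by (cases z) simp
  then have "verlet \<delta> U = (\<lambda>z. let x' = fst z + \<delta> *\<^sub>R snd z - (\<delta>\<^sup>2 / 2) *\<^sub>R grad U (fst z)
     in (x', snd z - (\<delta> / 2) *\<^sub>R (grad U (fst z) + grad U x')))" by auto
  then show ?thesis
    by (auto simp: Let_def intro!: borel_measurable_continuous_onI continuous_intros)
qed

text \<open>O, then BAB, then O: \<open>G\<close> drives the first friction half-step and
  \<open>G'\<close> the second, and the deterministic part between them is the Verlet map.\<close>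

lemma step_eq: "step z \<omega> = ou (verlet \<delta> U (ou z (fst \<omega>))) (snd \<omega>)"
  by (cases z; cases \<omega>; simp add: Let_def ou_def \<eta>_def s_def algebra_simps power2_eq_square)

text \<open>At each fixed position the Gaussian law of the velocity is preserved, because
  \<open>\<eta>\<^sup>2 + s\<^sup>2 = 1\<close>.\<close>

lemma ou_invariant:
  assumes [measurable]: "f \<in> borel_measurable borel"
  shows "(\<integral>\<^sup>+z. \<integral>\<^sup>+g. f (ou z g) \<partial>std_gaussian \<partial>target) = (\<integral>\<^sup>+z. f z \<partial>target)"
proof -
  have fx: "(\<lambda>v. f (x, v)) \<in> borel_measurable borel" for x
    by (rule measurable_compose[of _ _ "borel \<Otimes>\<^sub>M borel"]) (simp_all add: borel_prod)
  have "(\<lambda>p. f (ou (fst p) (snd p))) \<in> borel_measurable (borel \<Otimes>\<^sub>M std_gaussian)" by measurable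
  then have m: "(\<lambda>z. \<integral>\<^sup>+g. f (ou z g) \<partial>std_gaussian) \<in> borel_measurable borel"
    by (intro std_gaussian.borel_measurable_nn_integral) (simp add: case_prod_unfold)
  show ?thesis
    unfolding nn_integral_target[OF m] nn_integral_target[OF assms]
    using std_gaussian_rotation[OF fx, of \<eta> s] s2 s_pos by (simp add: ou_def)
qed

text \<open>The first friction half-step preserves the target and so disappears; the Verlet map and
  the second half-step remain.\<close>

lemma nn_integral_step_target:
  assumes [measurable]: "f \<in> borel_measurable borel"
  shows "(\<integral>\<^sup>+z. \<integral>\<^sup>+\<omega>. f (step z \<omega>) \<partial>noise \<partial>target) = (\<integral>\<^sup>+z. \<integral>\<^sup>+g. f (ou (verlet \<delta> U z) g) \<partial>std_gaussian \<partial>target)"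
proof -
  have [measurable]: "(\<lambda>z. \<integral>\<^sup>+g. f (ou (verlet \<delta> U z) g) \<partial>std_gaussian) \<in> borel_measurable borel"
    by (intro std_gaussian.borel_measurable_nn_integral) measurable
  have "(\<integral>\<^sup>+\<omega>. f (step z \<omega>) \<partial>noise) = (\<integral>\<^sup>+g. \<integral>\<^sup>+g'. f (ou (verlet \<delta> U (ou z g)) g') \<partial>std_gaussian \<partial>std_gaussian)" for z
    unfolding pair_std_gaussian[symmetric] step_eq
    by (subst std_gaussian.nn_integral_fst[symmetric]) auto
  then show ?thesis using ou_invariant[of "\<lambda>z. \<integral>\<^sup>+g. f (ou (verlet \<delta> U z) g) \<partial>std_gaussian"] by simp
qed

lemma target_moment:
  assumes p: "0 \<le> p"
  shows "(\<integral>\<^sup>+z. ennreal (norm z powr p) \<partial>target) < \<infinity>"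
proof -
  obtain K c where c: "0 < c" "0 \<le> K" "\<And>z. weight z \<le> K * exp (- c * (norm z)\<^sup>2)" using weight_le by blast
  \<comment> \<open>Half of the Gaussian rate \<open>c\<close> is spent on the power.\<close>
  define B where "B = K * exp (p\<^sup>2 / (4 * (c / 2))) / Z"
  have B: "0 \<le> B" using c Z_pos by (simp add: B_def)
  have "(\<integral>\<^sup>+z. ennreal (norm z powr p) \<partial>target) = (\<integral>\<^sup>+z. ennreal (weight z / Z * norm z powr p) \<partial>lborel)"
    unfolding target_eq
  proof (subst nn_integral_density)
    show "(\<integral>\<^sup>+z. ennreal (weight z / Z) * ennreal (norm z powr p) \<partial>lborel) = (\<integral>\<^sup>+z. ennreal (weight z / Z * norm z powr p) \<partial>lborel)"
      using Z_pos by (intro nn_integral_cong ennreal_mult[symmetric] divide_nonneg_pos less_imp_le[OF weight_pos]) auto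
  qed measurable
  also have "\<dots> \<le> (\<integral>\<^sup>+z. ennreal B * ennreal (exp (- (c / 2) * (norm (z :: 'a \<times> 'a))\<^sup>2)) \<partial>lborel)"
  proof (intro nn_integral_mono)
    fix z :: "'a \<times> 'a"
    have "weight z * norm z powr p \<le> (K * exp (- c * (norm z)\<^sup>2)) * (exp (p\<^sup>2 / (4 * (c / 2))) * exp (c / 2 * (norm z)\<^sup>2))"
      using c p by (intro mult_mono c(3) powr_le_exp_sq) (auto simp: weight_pos less_imp_le)
    also have "\<dots> = K * exp (p\<^sup>2 / (4 * (c / 2))) * (exp (- c * (norm z)\<^sup>2) * exp (c / 2 * (norm z)\<^sup>2))"
      by (simp only: mult_ac)
    also have "exp (- c * (norm z)\<^sup>2) * exp (c / 2 * (norm z)\<^sup>2) = exp (- (c / 2) * (norm z)\<^sup>2)"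
      unfolding exp_add[symmetric] by (simp add: field_simps)
    finally have "weight z * norm z powr p / Z \<le> K * exp (p\<^sup>2 / (4 * (c / 2))) * exp (- (c / 2) * (norm z)\<^sup>2) / Z"
      using Z_pos by (intro divide_right_mono) auto
    then have "weight z / Z * norm z powr p \<le> B * exp (- (c / 2) * (norm z)\<^sup>2)" by (simp add: B_def)
    then show "ennreal (weight z / Z * norm z powr p) \<le> ennreal B * ennreal (exp (- (c / 2) * (norm z)\<^sup>2))"
      using B by (simp add: ennreal_mult[symmetric] ennreal_leI)
  qed
  also have "\<dots> < \<infinity>"
    using nn_integral_exp_neg_norm_sq[of "c / 2", where 'a="'a \<times> 'a"] c
    by (subst nn_integral_cmult) (auto simp: ennreal_mult_less_top)
  finally show ?thesis .
qed

end

subsection \<open>The total variation estimate\<close>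

context obabo_chain
begin

abbreviation pushed :: "('a \<times> 'a) measure" where "pushed \<equiv> verlet_push \<delta> U target"

lemma sets_pushed [simp, measurable_cong]: "sets pushed = sets borel"
  by (simp add: verlet_push_def)

lemma prob_space_pushed: "prob_space pushed"
  unfolding verlet_push_def by (rule prob_space.prob_space_distr[OF prob_space_target]) simp

definition OU :: "('a \<times> 'a \<Rightarrow> real) \<Rightarrow> 'a \<times> 'a \<Rightarrow> real" where
  "OU f z = (\<integral>g. f (ou z g) \<partial>std_gaussian)"

lemma test_OU: "test f \<Longrightarrow> test (OU f)"
  unfolding OU_def by (rule test_integral[OF _ prob_space_std_gaussian]) (simp_all add: case_prod_unfold)

text \<open>Both integrals are integrals of \<open>OU f\<close>, one against the pushed target and
  one against the target: the last friction half-step is moved onto the test function. Hence the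
  Verlet defect bounds the defect of a whole step.\<close>

lemma one_step_defect:
  assumes f: "test f"
  shows "2 * ennreal ((\<integral>z. P f z \<partial>target) - (\<integral>z. f z \<partial>target)) \<le> tv_dist pushed target"
proof -
  have g: "test (OU f)" by (rule test_OU[OF f])
  have 1: "(\<integral>z. f z \<partial>target) = (\<integral>z. OU f z \<partial>target)"
    unfolding OU_def
    by (rule test_integral_disintegrate[OF f prob_space_std_gaussian prob_space_target _ prob_space_target])
       (simp_all add: case_prod_unfold ou_invariant)
  define \<mu> where "\<mu> = distr (target \<Otimes>\<^sub>M noise) borel (\<lambda>p. step (fst p) (snd p))"
  have m\<mu>: "(\<lambda>p. step (fst p) (snd p)) \<in> measurable (target \<Otimes>\<^sub>M noise) borel" by measurable
  have \<mu>: "prob_space \<mu>" "sets \<mu> = sets borel"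
  proof -
    interpret t: prob_space target by (rule prob_space_target)
    interpret pair_prob_space target noise ..
    show "prob_space \<mu>" unfolding \<mu>_def by (rule prob_space_distr[OF m\<mu>])
  qed (simp add: \<mu>_def)
  have nn: "(\<integral>\<^sup>+z. h z \<partial>\<mu>) = (\<integral>\<^sup>+z. \<integral>\<^sup>+\<omega>. h (step z \<omega>) \<partial>noise \<partial>target)" if "h \<in> borel_measurable borel" for h
    unfolding \<mu>_def by (rule nn_integral_distr_pair[OF std_gaussian.sigma_finite_measure_axioms m\<mu> that])
  have "(\<integral>z. P f z \<partial>target) = (\<integral>z. f z \<partial>\<mu>)"
    unfolding P_def
    by (rule test_integral_disintegrate[symmetric, OF f prob_space_std_gaussian \<mu> prob_space_target, where X=step])
       (simp_all add: case_prod_unfold nn)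
  also have "\<dots> = (\<integral>z. (\<integral>g. f (ou (verlet \<delta> U z) g) \<partial>std_gaussian) \<partial>target)"
    by (rule test_integral_disintegrate[OF f prob_space_std_gaussian \<mu> prob_space_target, where X="\<lambda>z. ou (verlet \<delta> U z)"])
       (simp_all add: case_prod_unfold nn nn_integral_step_target)
  also have "\<dots> = (\<integral>z. OU f z \<partial>pushed)"
    using testD(1)[OF g] unfolding verlet_push_def OU_def[symmetric] by (simp add: integral_distr)
  finally show ?thesis unfolding 1
    using integral_diff_le_tv_dist[OF prob_space_pushed sets_pushed sets_target, of "OU f"] testD[OF g] by simp
qed

text \<open>Telescoping: each summand is the one-step defect of a test function
  \<open>(P ^^ k) f\<close>.\<close>

lemma n_step_defect:
  assumes f: "test f" and t: "tv_dist pushed target = ennreal t" "0 \<le> t"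
  shows "2 * ((\<integral>z. (P ^^ n) f z \<partial>target) - (\<integral>z. f z \<partial>target)) \<le> real n * t"
proof (induction n)
  case (Suc n)
  have "2 * ((\<integral>z. P ((P ^^ n) f) z \<partial>target) - (\<integral>z. (P ^^ n) f z \<partial>target)) \<le> t"
    using one_step_defect[OF test_P_pow[OF f, of n]] t by (intro ennreal_double_le) auto
  with Suc show ?case by (simp add: algebra_simps)
qed simp

text \<open>By invariance the \<open>\<nu>\<close>-measure of a set is the integral of
  \<open>g = (P ^^ n) f\<close>, with \<open>f\<close> its indicator. Inserting the integral of
  \<open>g\<close> against the target leaves a term governed by the Lipschitz constant of
  \<open>g\<close> and the n-step defect of the target.\<close>

lemma tv_bound:
  assumes inv: "invariant_prob kernel \<nu>" and n: "1 \<le> n"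
  shows "tv_dist \<nu> target \<le> ennreal (2 * c0 * (sqrt 3 * M * \<rho> ^ (n - 1))) * wasserstein 1 \<nu> target
      + of_nat n * tv_dist pushed target"
proof -
  have \<nu>: "prob_space \<nu>" "sets \<nu> = sets borel" using inv by (auto simp: invariant_prob_def)
  define C where "C = c0 * (sqrt 3 * M * \<rho> ^ (n - 1))"
  have C: "0 < C" using c0_pos M_ge \<rho>_bounds by (simp add: C_def)
  show ?thesis
  \<comment> \<open>If one of the two distances is infinite, so is the bound, because both
    coefficients are nonzero; otherwise all quantities are real.\<close>
  proof (cases "wasserstein 1 \<nu> target = \<top> \<or> tv_dist pushed target = \<top>")
    case True
    have "ennreal (2 * C) \<noteq> 0" "(of_nat n :: ennreal) \<noteq> 0" using C n by auto
    with True have "ennreal (2 * C) * wasserstein 1 \<nu> target + of_nat n * tv_dist pushed target = \<top>"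
      by (auto simp: ennreal_mult_eq_top_iff)
    moreover have "2 * c0 * (sqrt 3 * M * \<rho> ^ (n - 1)) = 2 * C" by (simp add: C_def)
    ultimately show ?thesis by (simp only: top_greatest)
  next
    case False
    then obtain w t where w: "wasserstein 1 \<nu> target = ennreal w" "0 \<le> w" and t: "tv_dist pushed target = ennreal t" "0 \<le> t"
      by (metis ennreal_cases)
    have "tv_dist \<nu> target \<le> 2 * ennreal (C * w + real n * t / 2)"
    proof (rule tv_dist_le[OF \<nu>(1) prob_space_target \<nu>(2) sets_target])
      fix A :: "('a \<times> 'a) set" assume A: "A \<in> sets borel"
      define f :: "'a \<times> 'a \<Rightarrow> real" where "f = indicator A"
      have f: "test f" using A by (auto simp: f_def test_def indicator_def)
      define g where "g = (P ^^ n) f"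
      have g: "test g" unfolding g_def by (rule test_P_pow[OF f])
      have "ennreal (((\<integral>z. g z \<partial>\<nu>) - (\<integral>z. g z \<partial>target)) / C) \<le> ennreal w"
        unfolding w(1)[symmetric]
      proof (rule kantorovich_bound[OF \<nu>(1) \<nu>(2) sets_target])
        show "g x - g y \<le> C * norm (x - y)" for x y
          unfolding g_def C_def using P_pow_lipschitz[OF f n] by (simp add: mult.assoc)
      qed (use testD[OF g] C in auto)
      then have "((\<integral>z. g z \<partial>\<nu>) - (\<integral>z. g z \<partial>target)) / C \<le> w" using w by (simp add: ennreal_le_iff)
      then have 1: "(\<integral>z. g z \<partial>\<nu>) - (\<integral>z. g z \<partial>target) \<le> C * w" using C by (simp add: field_simps)
      have 2: "(\<integral>z. g z \<partial>target) - (\<integral>z. f z \<partial>target) \<le> real n * t / 2"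
        using n_step_defect[OF f t, of n] by (simp add: g_def)
      have "measure \<nu> A = (\<integral>z. g z \<partial>\<nu>)" "measure target A = (\<integral>z. f z \<partial>target)"
        unfolding g_def integral_P_pow_invariant[OF inv f] using A \<nu> by (simp_all add: f_def)
      with 1 2 show "measure \<nu> A - measure target A \<le> C * w + real n * t / 2" by simp
    qed
    also have "\<dots> = ennreal (2 * C) * ennreal w + of_nat n * ennreal t"
      using C w t n by (simp add: ennreal_of_nat_eq_real_of_nat ennreal_mult[symmetric] ennreal_plus[symmetric] distrib_left
          ennreal_numeral[symmetric] del: ennreal_plus ennreal_numeral)
    finally show ?thesis unfolding w t by (simp add: C_def mult.assoc)
  qed
qed

end

subsection \<open>The Wasserstein estimate\<close>

context obabo_chain
begin

definition Cn :: real where "Cn = sqrt (3 / 2) * max 1 (1 / sqrt L)"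

lemma Cn_pos: "0 < Cn"
  unfolding Cn_def by (intro mult_pos_pos) (auto simp: less_max_iff_disj)

lemma N_le_Cn: "N z \<le> Cn * norm z"
  using N_le_norm[of z] by (simp add: Cn_def)

lemma N_minus: "N (- z) = N z"
proof -
  have "T (- z) = - T z" by (simp add: T_def)
  then show ?thesis by (simp add: N_def)
qed

text \<open>The noise can be absorbed into the velocity, before the step for \<open>G\<close> and after it for \<open>G'\<close>;
  hence the contraction property already gives the linear growth in the noise.\<close>

lemma noise_growth: "\<exists>A B. 0 \<le> A \<and> 0 \<le> B \<and> (\<forall>\<omega>. N (step 0 \<omega>) \<le> A + B * norm \<omega>)"
proof -
  define A B where "A = N (step 0 0)" and "B = \<rho> * (Cn * (s / \<eta>)) + Cn * s"
  have pos: "0 < s" "0 < \<eta>" "0 < Cn" "0 < \<rho>" using s_pos \<eta>_bounds Cn_pos \<rho>_bounds by auto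
  have "N (step 0 \<omega>) \<le> A + B * norm \<omega>" for \<omega>
  proof -
    \<comment> \<open>\<open>G\<close> enters a step only through
      \<open>\<eta> *\<^sub>R v + s *\<^sub>R G\<close>, so starting at velocity
      \<open>(s / \<eta>) *\<^sub>R G\<close> with no noise has the same effect.\<close>
    define z where "z = (0 :: 'a, (s / \<eta>) *\<^sub>R fst \<omega>)"
    have f: "fst (step 0 \<omega>) = fst (step z 0)" using pos by (simp add: fst_step z_def)
    have "snd (step 0 \<omega>) = snd (step z 0) + s *\<^sub>R snd \<omega>"
      unfolding snd_step f using pos by (simp add: z_def power2_eq_square algebra_simps)
    with f have e: "step 0 \<omega> = (step z 0 - step 0 0) + step 0 0 + (0, s *\<^sub>R snd \<omega>)" by (simp add: prod_eq_iff)
    have "N (step 0 \<omega>) \<le> N (step z 0 - step 0 0) + N (step 0 0) + N (0, s *\<^sub>R snd \<omega>)"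
      by (subst e, rule order_trans[OF N_triangle add_right_mono[OF N_triangle]])
    also have "N (step z 0 - step 0 0) \<le> \<rho> * N z" using step_contraction[of z 0 0] by simp
    also have "\<rho> * N z \<le> \<rho> * (Cn * (s / \<eta>) * norm \<omega>)"
    proof (intro mult_left_mono)
      have "N z \<le> Cn * (s / \<eta> * norm (fst \<omega>))" using N_le_Cn[of z] pos by (simp add: z_def norm_Pair)
      also have "\<dots> \<le> Cn * (s / \<eta> * norm \<omega>)"
        using pos norm_fst_le[of "fst \<omega>" "snd \<omega>"] by (intro mult_left_mono) auto
      finally show "N z \<le> Cn * (s / \<eta>) * norm \<omega>" by simp
    qed (use pos in auto)
    also have "N (0, s *\<^sub>R snd \<omega>) \<le> Cn * (s * norm (snd \<omega>))"
      using N_le_Cn[of "(0, s *\<^sub>R snd \<omega>)"] pos by (simp add: norm_Pair)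
    also have "\<dots> \<le> Cn * (s * norm \<omega>)"
      using pos norm_snd_le[of "snd \<omega>" "fst \<omega>"] by (intro mult_left_mono) auto
    finally show ?thesis by (simp add: A_def B_def algebra_simps)
  qed
  moreover have "0 \<le> A" "0 \<le> B" using pos by (simp_all add: A_def B_def)
  ultimately show ?thesis by blast
qed

section \<open>Moments of the noise and of the invariant law\<close>

lemma noise_moment:
  assumes p: "0 \<le> p"
  shows "(\<integral>\<^sup>+\<omega>. ennreal (N (step 0 \<omega>) powr p) \<partial>noise) < \<infinity>"
proof -
  obtain A B where AB: "0 \<le> A" "0 \<le> B" "\<And>\<omega>. N (step 0 \<omega>) \<le> A + B * norm \<omega>" using noise_growth by blast
  have "(\<integral>\<^sup>+\<omega>. ennreal (N (step 0 \<omega>) powr p) \<partial>noise)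
     \<le> (\<integral>\<^sup>+\<omega>. ennreal (2 powr p * A powr p) + ennreal (2 powr p * B powr p) * ennreal (norm \<omega> powr p) \<partial>noise)"
  proof (intro nn_integral_mono)
    fix \<omega> :: "'a \<times> 'a"
    have "N (step 0 \<omega>) powr p \<le> (A + B * norm \<omega>) powr p" using AB p by (intro powr_mono2) auto
    also have "\<dots> \<le> 2 powr p * (A powr p + (B * norm \<omega>) powr p)" using AB p by (intro powr_add_le) auto
    also have "\<dots> = 2 powr p * A powr p + 2 powr p * B powr p * norm \<omega> powr p"
      using AB by (simp add: powr_mult distrib_left)
    finally show "ennreal (N (step 0 \<omega>) powr p)
        \<le> ennreal (2 powr p * A powr p) + ennreal (2 powr p * B powr p) * ennreal (norm \<omega> powr p)"
      by (simp add: ennreal_mult[symmetric] ennreal_plus[symmetric] ennreal_leI del: ennreal_plus)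
  qed
  also have "\<dots> = ennreal (2 powr p * A powr p) + ennreal (2 powr p * B powr p) * (\<integral>\<^sup>+\<omega>. ennreal (norm \<omega> powr p) \<partial>noise)"
    using std_gaussian.emeasure_space_1[where 'a="'a \<times> 'a"] by (simp add: nn_integral_add nn_integral_cmult)
  also have "\<dots> < \<infinity>"
    using std_gaussian_moment[OF p, where 'a="'a \<times> 'a"] by (simp add: ennreal_mult_less_top)
  finally show ?thesis .
qed

text \<open>The drift inequality \<open>P F \<le> \<rho> F + C\<close> for \<open>F = N\<^sup>p\<close> is integrated against \<open>\<nu>\<close> after truncation,
  and the truncation is removed by Fatou's lemma.\<close>

lemma invariant_moment:
  assumes inv: "invariant_prob kernel \<nu>" and p: "1 \<le> p"
  shows "(\<integral>\<^sup>+z. ennreal (N z powr p) \<partial>\<nu>) < \<infinity>"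
proof -
  have \<nu>: "prob_space \<nu>" and S [measurable_cong]: "sets \<nu> = sets borel" using inv by (auto simp: invariant_prob_def)
  interpret \<nu>: prob_space \<nu> by fact
  define F where "F z = N z powr p" for z
  have F0: "0 \<le> F z" for z by (simp add: F_def)
  have Fm [measurable]: "F \<in> borel_measurable borel" unfolding F_def[abs_def] by measurable
  \<comment> \<open>The weight left over by \<open>\<rho>\<close>, halved because the convexity
    inequality takes three weights; the third summand is zero.\<close>
  define e where "e = (1 - \<rho>) / 2"
  have e: "0 < e" "\<rho> + e + e = 1" "0 < \<rho>" using \<rho>_bounds by (auto simp: e_def)
  define Y where "Y \<omega> = e * (N (step 0 \<omega>) / e) powr p" for \<omega>
  have Y0: "0 \<le> Y \<omega>" for \<omega> using e by (simp add: Y_def)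
  have Ym [measurable]: "Y \<in> borel_measurable borel" unfolding Y_def[abs_def] by measurable
  have drift: "F (step z \<omega>) \<le> \<rho> * F z + Y \<omega>" for z \<omega>
  proof -
    have "N (step z \<omega>) \<le> N (step z \<omega> - step 0 \<omega>) + N (step 0 \<omega>)"
      using N_triangle[of "step z \<omega> - step 0 \<omega>" "step 0 \<omega>"] by simp
    also have "\<dots> \<le> \<rho> * N z + N (step 0 \<omega>) + 0" using step_contraction[of z \<omega> 0] by simp
    finally have "F (step z \<omega>) \<le> (\<rho> * N z + N (step 0 \<omega>) + 0) powr p" unfolding F_def using p by (intro powr_mono2) auto
    also have "\<dots> \<le> \<rho> * (\<rho> * N z / \<rho>) powr p + e * (N (step 0 \<omega>) / e) powr p + e * (0 / e) powr p"
      using p e by (intro powr_convex3) auto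
    finally show ?thesis using e p by (simp add: F_def Y_def)
  qed
  have Yi: "integrable noise Y"
  proof (rule integrableI_nonneg)
    have "(\<integral>\<^sup>+\<omega>. ennreal (Y \<omega>) \<partial>noise) = (\<integral>\<^sup>+\<omega>. ennreal (e * (1 / e) powr p) * ennreal (N (step 0 \<omega>) powr p) \<partial>noise)"
      using e by (intro nn_integral_cong) (simp add: Y_def powr_divide ennreal_mult[symmetric])
    also have "\<dots> < \<infinity>" using noise_moment[of p] p
      by (subst nn_integral_cmult) (auto simp: ennreal_mult_less_top)
    finally show "(\<integral>\<^sup>+\<omega>. ennreal (Y \<omega>) \<partial>noise) < \<infinity>" .
  qed (use Y0 in auto)
  define C where "C = (\<integral>\<omega>. Y \<omega> \<partial>noise)"
  have C0: "0 \<le> C" unfolding C_def using Y0 by simp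
  \<comment> \<open>Truncating \<open>F\<close> and the drift bound at the same level avoids a
    difference of infinite integrals. The added \<open>C\<close> makes \<open>u\<close> nonnegative,
    its integral is at most \<open>C\<close> by invariance, and for large \<open>n\<close> it equals
    \<open>(1 - \<rho>) * F z\<close>.\<close>
  define u where "u n z = min (F z) (real n + 1) - min (\<rho> * F z + C) (real n + 1) + C" for n z
  have u0: "0 \<le> u n z" for n z
  proof -
    have "\<rho> * F z \<le> F z" using \<rho>_bounds F0[of z] by (simp add: mult_left_le_one_le)
    then show ?thesis using C0 by (simp add: u_def min_def)
  qed
  have bound: "(\<integral>\<^sup>+z. ennreal (u n z) \<partial>\<nu>) \<le> ennreal C" for n
  proof -
    define a where "a = real n + 1"
    have a: "0 < a" by (simp add: a_def)
    define f where "f z = min (F z) a / a" for z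
    have f: "test f" unfolding test_def f_def using a F0 by (auto simp: divide_le_eq)
    have Pf: "P f z \<le> min (\<rho> * F z + C) a / a" for z
    proof -
      have fi: "integrable noise (\<lambda>\<omega>. f (step z \<omega>))" by (rule integrable_test[OF f prob_space_std_gaussian]) simp
      have "P f z \<le> 1" using testD[OF test_P[OF f]] by simp
      moreover have "P f z \<le> (\<integral>\<omega>. (\<rho> * F z + Y \<omega>) / a \<partial>noise)"
        unfolding P_def
      proof (rule integral_mono[OF fi])
        show "f (step z \<omega>) \<le> (\<rho> * F z + Y \<omega>) / a" for \<omega>
          using drift[of z \<omega>] a by (simp add: f_def divide_right_mono min.coboundedI1)
      qed (use Yi in simp)
      moreover have "(\<integral>\<omega>. (\<rho> * F z + Y \<omega>) / a \<partial>noise) = (\<rho> * F z + C) / a"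
        using Yi by (simp add: C_def std_gaussian.prob_space[simplified])
      ultimately show ?thesis using a by (simp add: min_def)
    qed
    have i1: "integrable \<nu> f" using integrable_test[OF f \<nu>, of "\<lambda>z. z"] by simp
    have i2: "integrable \<nu> (\<lambda>z. min (\<rho> * F z + C) a / a)"
      using a C0 F0 e by (intro \<nu>.integrable_const_bound[where B=1]) (auto simp: abs_le_iff divide_le_eq le_divide_eq)
    have "(\<integral>z. f z \<partial>\<nu>) = (\<integral>z. P f z \<partial>\<nu>)" by (rule integral_P_invariant[OF inv f, symmetric])
    also have "\<dots> \<le> (\<integral>z. min (\<rho> * F z + C) a / a \<partial>\<nu>)"
    proof (rule integral_mono)
      show "integrable \<nu> (P f)" using integrable_test[OF test_P[OF f] \<nu>, of "\<lambda>z. z"] by simp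
    qed (use i2 Pf in auto)
    finally have le: "(\<integral>z. f z \<partial>\<nu>) \<le> (\<integral>z. min (\<rho> * F z + C) a / a \<partial>\<nu>)" .
    have u: "u n z = a * (f z - min (\<rho> * F z + C) a / a) + C" for z
      using a by (simp add: u_def f_def a_def[symmetric] right_diff_distrib)
    have "(\<integral>\<^sup>+z. ennreal (u n z) \<partial>\<nu>) = ennreal (\<integral>z. u n z \<partial>\<nu>)"
      unfolding u using i1 i2 u0[of n, unfolded u] by (intro nn_integral_eq_integral) auto
    also have "(\<integral>z. u n z \<partial>\<nu>) = a * ((\<integral>z. f z \<partial>\<nu>) - (\<integral>z. min (\<rho> * F z + C) a / a \<partial>\<nu>)) + C"
      unfolding u using i1 i2 by (simp add: \<nu>.prob_space)
    also have "\<dots> \<le> C" using le a by (simp add: mult_nonneg_nonpos)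
    finally show ?thesis by (simp add: ennreal_leI)
  qed
  have lim: "liminf (\<lambda>n. ennreal (u n z)) = ennreal ((1 - \<rho>) * F z)" for z
  proof (rule lim_imp_Liminf)
    have "\<forall>\<^sub>F n in sequentially. ennreal (u n z) = ennreal ((1 - \<rho>) * F z)"
    proof (rule eventually_sequentiallyI[of "nat \<lceil>max (F z) (\<rho> * F z + C)\<rceil>"])
      fix n assume "nat \<lceil>max (F z) (\<rho> * F z + C)\<rceil> \<le> n"
      then have "max (F z) (\<rho> * F z + C) \<le> real n" by linarith
      then show "ennreal (u n z) = ennreal ((1 - \<rho>) * F z)" by (simp add: u_def min_def algebra_simps)
    qed
    then show "(\<lambda>n. ennreal (u n z)) \<longlonglongrightarrow> ennreal ((1 - \<rho>) * F z)" by (rule tendsto_eventually)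
  qed simp
  have "ennreal (1 - \<rho>) * (\<integral>\<^sup>+z. ennreal (F z) \<partial>\<nu>) = (\<integral>\<^sup>+z. liminf (\<lambda>n. ennreal (u n z)) \<partial>\<nu>)"
    unfolding lim using \<rho>_bounds F0 by (simp add: nn_integral_cmult[symmetric] ennreal_mult)
  also have "\<dots> \<le> liminf (\<lambda>n. \<integral>\<^sup>+z. ennreal (u n z) \<partial>\<nu>)"
    by (rule nn_integral_liminf) (simp add: u_def[abs_def])
  also have "\<dots> \<le> liminf (\<lambda>n. ennreal C)" by (intro Liminf_mono always_eventually allI bound)
  also have "\<dots> < \<infinity>" by (simp add: Liminf_const)
  finally show ?thesis using \<rho>_bounds unfolding F_def by (auto simp: ennreal_mult_less_top)
qed

section \<open>Optimal cost in the modified norm\<close>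

definition cost :: "real \<Rightarrow> (('a \<times> 'a) \<times> ('a \<times> 'a)) measure \<Rightarrow> ennreal" where
  "cost p \<Gamma> = (\<integral>\<^sup>+z. ennreal (N (fst z - snd z) powr p) \<partial>\<Gamma>)"

text \<open>The recursion for the optimal cost says nothing about an infinite value. Since both laws
  have finite moments, the independent coupling has finite cost.\<close>

lemma finite_cost_coupling:
  assumes inv: "invariant_prob kernel \<nu>" and p: "1 \<le> p"
  shows "\<exists>\<Gamma>\<in>couplings \<nu> target. cost p \<Gamma> < \<infinity>"
proof (intro bexI)
  have \<nu>: "prob_space \<nu>" and S [measurable_cong]: "sets \<nu> = sets borel" using inv by (auto simp: invariant_prob_def)
  show c: "\<nu> \<Otimes>\<^sub>M target \<in> couplings \<nu> target" by (rule pair_measure_coupling[OF \<nu> prob_space_target])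
  have "cost p (\<nu> \<Otimes>\<^sub>M target) \<le> (\<integral>\<^sup>+z. ennreal (2 powr p) * (ennreal (N (fst z) powr p) + ennreal (Cn powr p) * ennreal (norm (snd z) powr p)) \<partial>(\<nu> \<Otimes>\<^sub>M target))"
    unfolding cost_def
  proof (intro nn_integral_mono)
    fix z :: "('a \<times> 'a) \<times> ('a \<times> 'a)"
    have "N (fst z - snd z) \<le> N (fst z) + Cn * norm (snd z)"
      using N_triangle[of "fst z" "- snd z"] N_le_Cn[of "snd z"] by (simp add: N_minus)
    then have "N (fst z - snd z) powr p \<le> (N (fst z) + Cn * norm (snd z)) powr p" using p by (intro powr_mono2) auto
    also have "\<dots> \<le> 2 powr p * (N (fst z) powr p + (Cn * norm (snd z)) powr p)" using p Cn_pos by (intro powr_add_le) auto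
    also have "(Cn * norm (snd z)) powr p = Cn powr p * norm (snd z) powr p" using Cn_pos by (simp add: powr_mult)
    finally show "ennreal (N (fst z - snd z) powr p)
       \<le> ennreal (2 powr p) * (ennreal (N (fst z) powr p) + ennreal (Cn powr p) * ennreal (norm (snd z) powr p))"
      by (simp add: ennreal_mult[symmetric] ennreal_plus[symmetric] ennreal_leI del: ennreal_plus)
  qed
  also have "\<dots> = ennreal (2 powr p) * ((\<integral>\<^sup>+z. ennreal (N (fst z) powr p) \<partial>(\<nu> \<Otimes>\<^sub>M target))
      + ennreal (Cn powr p) * (\<integral>\<^sup>+z. ennreal (norm (snd z) powr p) \<partial>(\<nu> \<Otimes>\<^sub>M target)))"
    by (simp add: nn_integral_cmult nn_integral_add)
  also have "(\<integral>\<^sup>+z. ennreal (N (fst z) powr p) \<partial>(\<nu> \<Otimes>\<^sub>M target)) = (\<integral>\<^sup>+z. ennreal (N z powr p) \<partial>\<nu>)"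
    by (rule couplings_nn_integral(1)[OF c]) measurable
  also have "(\<integral>\<^sup>+z. ennreal (norm (snd z) powr p) \<partial>(\<nu> \<Otimes>\<^sub>M target)) = (\<integral>\<^sup>+z. ennreal (norm z powr p) \<partial>target)"
    by (rule couplings_nn_integral(2)[OF c]) measurable
  also have "ennreal (2 powr p) * ((\<integral>\<^sup>+z. ennreal (N z powr p) \<partial>\<nu>) + ennreal (Cn powr p) * (\<integral>\<^sup>+z. ennreal (norm z powr p) \<partial>target)) < \<infinity>"
    using invariant_moment[OF inv p] target_moment[of p] p by (simp add: ennreal_mult_less_top)
  finally show "cost p (\<nu> \<Otimes>\<^sub>M target) < \<infinity>" .
qed

text \<open>Weights for Jensen's inequality: \<open>\<rho>\<close> for the contraction,
  \<open>\<tau>\<close> for the Verlet defect, and the small positive remainder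
  \<open>\<theta>\<close> for the gluing error. The value of \<open>\<tau>\<close> is the origin of
  \<open>2 / (\<delta> * \<kappa>)\<close>.\<close>

definition \<tau> :: real where "\<tau> = \<delta> * \<kappa> / 2"
definition \<theta> :: real where "\<theta> = 1 - \<rho> - \<tau>"

lemma \<tau>\<theta>: "0 < \<tau>" "0 < \<theta>" "\<rho> + \<theta> + \<tau> = 1" "0 < \<rho>"
  using \<delta>\<kappa>_bounds \<rho>_bounds by (auto simp: \<tau>_def \<theta>_def)

text \<open>One round of the triangle inequality between \<open>\<nu>\<close>, the law
  \<open>\<mu>\<close> of one step from the target, and the target: the first leg contracts
  \<open>\<Gamma>0\<close>, the second carries \<open>\<Gamma>1\<close> through a friction
  half-step, and the two are glued at \<open>\<mu>\<close> up to \<open>\<epsilon>\<close>.\<close>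

lemma improved_coupling:
  assumes inv: "invariant_prob kernel \<nu>" and p: "1 \<le> p"
    and \<Gamma>0: "\<Gamma>0 \<in> couplings \<nu> target" and \<Gamma>1: "\<Gamma>1 \<in> couplings target pushed" and \<epsilon>: "0 < \<epsilon>"
  shows "\<exists>\<Gamma>\<in>couplings \<nu> target. cost p \<Gamma> \<le> ennreal \<rho> * cost p \<Gamma>0 + ennreal (\<theta> * (Cn * \<epsilon> / \<theta>) powr p)
    + ennreal \<tau> * (ennreal ((Cn / \<tau>) powr p) * (\<integral>\<^sup>+ (x, y). ennreal (dist x y powr p) \<partial>\<Gamma>1))"
proof -
  have \<nu>: "prob_space \<nu>" and S [measurable_cong]: "sets \<nu> = sets borel" using inv by (auto simp: invariant_prob_def)
  have s0 [measurable_cong]: "sets \<Gamma>0 = sets (borel \<Otimes>\<^sub>M borel)"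
    unfolding couplingsD[OF \<Gamma>0] by (intro sets_pair_measure_cong S sets_target)
  have s1 [measurable_cong]: "sets \<Gamma>1 = sets (borel \<Otimes>\<^sub>M borel)"
    unfolding couplingsD[OF \<Gamma>1] by (intro sets_pair_measure_cong sets_pushed sets_target)
  interpret \<Gamma>0: prob_space \<Gamma>0 by (rule couplings_prob_space[OF \<Gamma>0 \<nu>])
  interpret \<Gamma>1: prob_space \<Gamma>1 by (rule couplings_prob_space[OF \<Gamma>1 prob_space_target])
  interpret tg: prob_space target by (rule prob_space_target)
  note sf = std_gaussian.sigma_finite_measure_axioms
  define \<mu> where "\<mu> = distr (target \<Otimes>\<^sub>M noise) borel (\<lambda>p. step (fst p) (snd p))"
  have m\<mu>: "(\<lambda>p. step (fst p) (snd p)) \<in> measurable (target \<Otimes>\<^sub>M noise) borel" by measurable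
  have S\<mu>: "sets \<mu> = sets borel" by (simp add: \<mu>_def)
  have P\<mu>: "prob_space \<mu>"
  proof -
    interpret pair_prob_space target noise ..
    show ?thesis unfolding \<mu>_def by (rule prob_space_distr[OF m\<mu>])
  qed
  have nn\<mu>: "(\<integral>\<^sup>+z. f z \<partial>\<mu>) = (\<integral>\<^sup>+z. \<integral>\<^sup>+\<omega>. f (step z \<omega>) \<partial>noise \<partial>target)" if "f \<in> borel_measurable borel" for f
    unfolding \<mu>_def by (rule nn_integral_distr_pair[OF sf m\<mu> that])
  have ms: "(\<lambda>z. \<integral>\<^sup>+\<omega>. f (step z \<omega>) \<partial>noise) \<in> borel_measurable borel" if [measurable]: "f \<in> borel_measurable borel" for f :: "_ \<Rightarrow> ennreal"
    by (intro std_gaussian.borel_measurable_nn_integral) measurable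
  have mo: "(\<lambda>z. \<integral>\<^sup>+g. f (ou z g) \<partial>std_gaussian) \<in> borel_measurable borel" if [measurable]: "f \<in> borel_measurable borel" for f :: "_ \<Rightarrow> ennreal"
    by (intro std_gaussian.borel_measurable_nn_integral) measurable
  \<comment> \<open>A step from both components of \<open>\<Gamma>0\<close> with common noise:
    \<open>X\<close> keeps the law \<open>\<nu>\<close> by invariance, and \<open>Y\<close> has law
    \<open>\<mu>\<close>.\<close>
  define X Y where "X q = step (fst (fst q)) (snd q)" and "Y q = step (snd (fst q)) (snd q)"
    for q :: "(('a \<times> 'a) \<times> ('a \<times> 'a)) \<times> ('a \<times> 'a)"
  have mXY [measurable]: "X \<in> measurable (\<Gamma>0 \<Otimes>\<^sub>M noise) borel" "Y \<in> measurable (\<Gamma>0 \<Otimes>\<^sub>M noise) borel"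
    unfolding X_def[abs_def] Y_def[abs_def] by measurable
  define \<Gamma>0' where "\<Gamma>0' = distr (\<Gamma>0 \<Otimes>\<^sub>M noise) (borel \<Otimes>\<^sub>M borel) (\<lambda>q. (X q, Y q))"
  have \<Gamma>0': "\<Gamma>0' \<in> couplings \<nu> \<mu>"
    unfolding \<Gamma>0'_def
  proof (rule distr_coupling[OF mXY])
    show "distr (\<Gamma>0 \<Otimes>\<^sub>M noise) borel X = \<nu>"
    proof (rule distr_eqI_nn_integral)
      fix f :: "'a \<times> 'a \<Rightarrow> ennreal" assume f [measurable]: "f \<in> borel_measurable borel"
      have "(\<integral>\<^sup>+q. f (X q) \<partial>(\<Gamma>0 \<Otimes>\<^sub>M noise)) = (\<integral>\<^sup>+q. \<integral>\<^sup>+\<omega>. f (step (fst q) \<omega>) \<partial>noise \<partial>\<Gamma>0)"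
        unfolding X_def[abs_def]
        by (rule nn_integral_pair[OF sf _ f, where X="\<lambda>q. step (fst q)"]) measurable
      also have "\<dots> = (\<integral>\<^sup>+z. \<integral>\<^sup>+\<omega>. f (step z \<omega>) \<partial>noise \<partial>\<nu>)"
        by (rule couplings_nn_integral(1)[OF \<Gamma>0]) (use ms[OF f] in \<open>simp cong: measurable_cong_sets add: S\<close>)
      also have "\<dots> = (\<integral>\<^sup>+z. f z \<partial>\<nu>)" by (rule nn_integral_invariant[OF inv f, symmetric])
      finally show "(\<integral>\<^sup>+q. f (X q) \<partial>(\<Gamma>0 \<Otimes>\<^sub>M noise)) = (\<integral>\<^sup>+z. f z \<partial>\<nu>)" .
    qed (use S mXY in simp_all)
    show "distr (\<Gamma>0 \<Otimes>\<^sub>M noise) borel Y = \<mu>"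
    proof (rule distr_eqI_nn_integral)
      fix f :: "'a \<times> 'a \<Rightarrow> ennreal" assume f [measurable]: "f \<in> borel_measurable borel"
      have "(\<integral>\<^sup>+q. f (Y q) \<partial>(\<Gamma>0 \<Otimes>\<^sub>M noise)) = (\<integral>\<^sup>+q. \<integral>\<^sup>+\<omega>. f (step (snd q) \<omega>) \<partial>noise \<partial>\<Gamma>0)"
        unfolding Y_def[abs_def]
        by (rule nn_integral_pair[OF sf _ f, where X="\<lambda>q. step (snd q)"]) measurable
      also have "\<dots> = (\<integral>\<^sup>+z. \<integral>\<^sup>+\<omega>. f (step z \<omega>) \<partial>noise \<partial>target)"
        by (rule couplings_nn_integral(2)[OF \<Gamma>0]) (use ms[OF f] in \<open>simp cong: measurable_cong_sets\<close>)
      also have "\<dots> = (\<integral>\<^sup>+z. f z \<partial>\<mu>)" by (rule nn\<mu>[OF f, symmetric])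
      finally show "(\<integral>\<^sup>+q. f (Y q) \<partial>(\<Gamma>0 \<Otimes>\<^sub>M noise)) = (\<integral>\<^sup>+z. f z \<partial>\<mu>)" .
    qed (use S\<mu> mXY in simp_all)
  qed
  \<comment> \<open>A friction half-step with a common Gaussian from both components of
    \<open>\<Gamma>1\<close>: \<open>V\<close>, started from the pushed target, has law
    \<open>\<mu>\<close>, and \<open>W\<close> has the target as its law.\<close>
  define V W where "V q = ou (snd (fst q)) (snd q)" and "W q = ou (fst (fst q)) (snd q)"
    for q :: "(('a \<times> 'a) \<times> ('a \<times> 'a)) \<times> 'a"
  have mVW [measurable]: "V \<in> measurable (\<Gamma>1 \<Otimes>\<^sub>M std_gaussian) borel" "W \<in> measurable (\<Gamma>1 \<Otimes>\<^sub>M std_gaussian) borel"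
    unfolding V_def[abs_def] W_def[abs_def] by measurable
  define \<Gamma>1' where "\<Gamma>1' = distr (\<Gamma>1 \<Otimes>\<^sub>M std_gaussian) (borel \<Otimes>\<^sub>M borel) (\<lambda>q. (V q, W q))"
  have \<Gamma>1': "\<Gamma>1' \<in> couplings \<mu> target"
    unfolding \<Gamma>1'_def
  proof (rule distr_coupling[OF mVW])
    show "distr (\<Gamma>1 \<Otimes>\<^sub>M std_gaussian) borel V = \<mu>"
    proof (rule distr_eqI_nn_integral)
      fix f :: "'a \<times> 'a \<Rightarrow> ennreal" assume f [measurable]: "f \<in> borel_measurable borel"
      have "(\<integral>\<^sup>+q. f (V q) \<partial>(\<Gamma>1 \<Otimes>\<^sub>M std_gaussian)) = (\<integral>\<^sup>+q. \<integral>\<^sup>+g. f (ou (snd q) g) \<partial>std_gaussian \<partial>\<Gamma>1)"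
        unfolding V_def[abs_def]
        by (rule nn_integral_pair[OF sf _ f, where X="\<lambda>q. ou (snd q)"]) measurable
      also have "\<dots> = (\<integral>\<^sup>+z. \<integral>\<^sup>+g. f (ou z g) \<partial>std_gaussian \<partial>pushed)"
        by (rule couplings_nn_integral(2)[OF \<Gamma>1]) (use mo[OF f] in \<open>simp cong: measurable_cong_sets\<close>)
      also have "\<dots> = (\<integral>\<^sup>+z. \<integral>\<^sup>+g. f (ou (verlet \<delta> U z) g) \<partial>std_gaussian \<partial>target)"
        unfolding verlet_push_def using mo[OF f] by (subst nn_integral_distr) auto
      also have "\<dots> = (\<integral>\<^sup>+z. f z \<partial>\<mu>)" unfolding nn\<mu>[OF f] by (rule nn_integral_step_target[OF f, symmetric])
      finally show "(\<integral>\<^sup>+q. f (V q) \<partial>(\<Gamma>1 \<Otimes>\<^sub>M std_gaussian)) = (\<integral>\<^sup>+z. f z \<partial>\<mu>)" .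
    qed (use S\<mu> mVW in simp_all)
    show "distr (\<Gamma>1 \<Otimes>\<^sub>M std_gaussian) borel W = target"
    proof (rule distr_eqI_nn_integral)
      fix f :: "'a \<times> 'a \<Rightarrow> ennreal" assume f [measurable]: "f \<in> borel_measurable borel"
      have "(\<integral>\<^sup>+q. f (W q) \<partial>(\<Gamma>1 \<Otimes>\<^sub>M std_gaussian)) = (\<integral>\<^sup>+q. \<integral>\<^sup>+g. f (ou (fst q) g) \<partial>std_gaussian \<partial>\<Gamma>1)"
        unfolding W_def[abs_def]
        by (rule nn_integral_pair[OF sf _ f, where X="\<lambda>q. ou (fst q)"]) measurable
      also have "\<dots> = (\<integral>\<^sup>+z. \<integral>\<^sup>+g. f (ou z g) \<partial>std_gaussian \<partial>target)"
        by (rule couplings_nn_integral(1)[OF \<Gamma>1]) (use mo[OF f] in \<open>simp cong: measurable_cong_sets\<close>)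
      also have "\<dots> = (\<integral>\<^sup>+z. f z \<partial>target)" by (rule ou_invariant[OF f])
      finally show "(\<integral>\<^sup>+q. f (W q) \<partial>(\<Gamma>1 \<Otimes>\<^sub>M std_gaussian)) = (\<integral>\<^sup>+z. f z \<partial>target)" .
    qed (use mVW in simp_all)
  qed
  obtain T where T: "T \<in> couplings \<Gamma>0' \<Gamma>1'" "AE z in T. dist (snd (fst z)) (fst (snd z)) < \<epsilon>"
    using approximate_gluing[OF \<nu> P\<mu> S S\<mu> sets_target \<Gamma>0' \<Gamma>1' \<epsilon>] by blast
  have sT [measurable_cong]: "sets T = sets ((borel \<Otimes>\<^sub>M borel) \<Otimes>\<^sub>M (borel \<Otimes>\<^sub>M borel))"
    unfolding couplingsD[OF T(1)] by (intro sets_pair_measure_cong) (simp_all add: \<Gamma>0'_def \<Gamma>1'_def)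
  have PT: "emeasure T (space T) = 1"
    by (intro prob_space.emeasure_space_1 couplings_prob_space[OF T(1)] couplings_prob_space[OF \<Gamma>0' \<nu>])
  have nT0: "(\<integral>\<^sup>+t. f (fst t) \<partial>T) = (\<integral>\<^sup>+z. f z \<partial>\<Gamma>0')"
    and nT1: "(\<integral>\<^sup>+t. f (snd t) \<partial>T) = (\<integral>\<^sup>+z. f z \<partial>\<Gamma>1')" if "f \<in> borel_measurable (borel \<Otimes>\<^sub>M borel)" for f
    using that by (intro couplings_nn_integral[OF T(1)]; simp add: \<Gamma>0'_def \<Gamma>1'_def)+
  define \<Gamma> where "\<Gamma> = distr T (borel \<Otimes>\<^sub>M borel) (\<lambda>t. (fst (fst t), snd (snd t)))"
  have m1: "(\<lambda>t. fst (fst t)) \<in> measurable T borel" "(\<lambda>t. snd (snd t)) \<in> measurable T borel" by measurable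
  have "\<Gamma> \<in> couplings \<nu> target"
    unfolding \<Gamma>_def
  proof (rule distr_coupling[OF m1])
    show "distr T borel (\<lambda>t. fst (fst t)) = \<nu>"
    proof (rule distr_eqI_nn_integral)
      fix f :: "'a \<times> 'a \<Rightarrow> ennreal" assume f [measurable]: "f \<in> borel_measurable borel"
      have "(\<integral>\<^sup>+t. f (fst (fst t)) \<partial>T) = (\<integral>\<^sup>+z. f (fst z) \<partial>\<Gamma>0')" by (rule nT0) measurable
      also have "\<dots> = (\<integral>\<^sup>+z. f z \<partial>\<nu>)" by (rule couplings_nn_integral(1)[OF \<Gamma>0']) measurable
      finally show "(\<integral>\<^sup>+t. f (fst (fst t)) \<partial>T) = (\<integral>\<^sup>+z. f z \<partial>\<nu>)" .
    qed (use S m1 in simp_all)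
    show "distr T borel (\<lambda>t. snd (snd t)) = target"
    proof (rule distr_eqI_nn_integral)
      fix f :: "'a \<times> 'a \<Rightarrow> ennreal" assume f [measurable]: "f \<in> borel_measurable borel"
      have "(\<integral>\<^sup>+t. f (snd (snd t)) \<partial>T) = (\<integral>\<^sup>+z. f (snd z) \<partial>\<Gamma>1')" by (rule nT1) measurable
      also have "\<dots> = (\<integral>\<^sup>+z. f z \<partial>target)" by (rule couplings_nn_integral(2)[OF \<Gamma>1']) measurable
      finally show "(\<integral>\<^sup>+t. f (snd (snd t)) \<partial>T) = (\<integral>\<^sup>+z. f z \<partial>target)" .
    qed (use m1 in simp_all)
  qed
  moreover have "cost p \<Gamma> \<le> ennreal \<rho> * cost p \<Gamma>0 + ennreal (\<theta> * (Cn * \<epsilon> / \<theta>) powr p)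
    + ennreal \<tau> * (ennreal ((Cn / \<tau>) powr p) * (\<integral>\<^sup>+ (x, y). ennreal (dist x y powr p) \<partial>\<Gamma>1))"
  proof -
    let ?f = "\<lambda>z. ennreal ((N (fst z - snd z) / \<rho>) powr p)" and ?g = "\<lambda>z. ennreal ((N (fst z - snd z) / \<tau>) powr p)"
    have fg [measurable]: "?f \<in> borel_measurable (borel \<Otimes>\<^sub>M borel)" "?g \<in> borel_measurable (borel \<Otimes>\<^sub>M borel)" by measurable
    have fgT: "(\<lambda>t. ?f (fst t)) \<in> borel_measurable T" "(\<lambda>t. ?g (snd t)) \<in> borel_measurable T"
      by (rule measurable_compose[OF _ fg(1)] measurable_compose[OF _ fg(2)]; measurable)+
    have "cost p \<Gamma> = (\<integral>\<^sup>+t. ennreal (N (fst (fst t) - snd (snd t)) powr p) \<partial>T)"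
      unfolding cost_def \<Gamma>_def by (subst nn_integral_distr) (auto intro!: measurable_Pair m1)
    also have "\<dots> \<le> (\<integral>\<^sup>+t. (ennreal \<rho> * ?f (fst t) + ennreal (\<theta> * (Cn * \<epsilon> / \<theta>) powr p)) + ennreal \<tau> * ?g (snd t) \<partial>T)"
    proof (rule nn_integral_mono_AE)
      show "AE t in T. ennreal (N (fst (fst t) - snd (snd t)) powr p)
         \<le> (ennreal \<rho> * ?f (fst t) + ennreal (\<theta> * (Cn * \<epsilon> / \<theta>) powr p)) + ennreal \<tau> * ?g (snd t)"
        using T(2)
      proof eventually_elim
        case (elim t)
        define a b c where "a = N (fst (fst t) - snd (fst t))" and "b = snd (fst t) - fst (snd t)" and "c = N (fst (snd t) - snd (snd t))"
        have "N (fst (fst t) - snd (snd t)) \<le> N ((fst (fst t) - snd (fst t)) + b) + c"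
          using N_triangle[of "(fst (fst t) - snd (fst t)) + b" "fst (snd t) - snd (snd t)"] by (simp add: b_def c_def)
        also have "N ((fst (fst t) - snd (fst t)) + b) \<le> a + N b"
          using N_triangle[of "fst (fst t) - snd (fst t)" b] by (simp add: a_def)
        also have "N b \<le> Cn * norm b" by (rule N_le_Cn)
        also have "\<dots> \<le> Cn * \<epsilon>" using elim Cn_pos by (intro mult_left_mono) (auto simp: b_def dist_norm)
        finally have "N (fst (fst t) - snd (snd t)) powr p \<le> (a + Cn * \<epsilon> + c) powr p" using p by (intro powr_mono2) auto
        also have "\<dots> \<le> \<rho> * (a / \<rho>) powr p + \<theta> * (Cn * \<epsilon> / \<theta>) powr p + \<tau> * (c / \<tau>) powr p"
          using p \<tau>\<theta> Cn_pos \<epsilon> by (intro powr_convex3) (auto simp: a_def c_def)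
        finally have "ennreal (N (fst (fst t) - snd (snd t)) powr p)
           \<le> ennreal (\<rho> * (a / \<rho>) powr p + \<theta> * (Cn * \<epsilon> / \<theta>) powr p + \<tau> * (c / \<tau>) powr p)" by (rule ennreal_leI)
        also have "\<dots> = ennreal \<rho> * ennreal ((a / \<rho>) powr p) + ennreal (\<theta> * (Cn * \<epsilon> / \<theta>) powr p) + ennreal \<tau> * ennreal ((c / \<tau>) powr p)"
          using \<tau>\<theta> by (simp add: ennreal_plus ennreal_mult)
        finally show ?case by (simp add: a_def c_def)
      qed
    qed
    also have "\<dots> = ennreal \<rho> * (\<integral>\<^sup>+t. ?f (fst t) \<partial>T) + ennreal (\<theta> * (Cn * \<epsilon> / \<theta>) powr p) * emeasure T (space T) + ennreal \<tau> * (\<integral>\<^sup>+t. ?g (snd t) \<partial>T)"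
      by (rule nn_integral_linear_combination[OF fgT])
    also have "(\<integral>\<^sup>+t. ?f (fst t) \<partial>T) = (\<integral>\<^sup>+z. ?f z \<partial>\<Gamma>0')" by (rule nT0[OF fg(1)])
    also have "\<dots> \<le> cost p \<Gamma>0"
    proof -
      have "(\<integral>\<^sup>+z. ?f z \<partial>\<Gamma>0') = (\<integral>\<^sup>+q. ?f (X q, Y q) \<partial>(\<Gamma>0 \<Otimes>\<^sub>M noise))"
        unfolding \<Gamma>0'_def by (rule nn_integral_distr) measurable
      also have "\<dots> \<le> (\<integral>\<^sup>+q. ennreal (N (fst (fst q) - snd (fst q)) powr p) \<partial>(\<Gamma>0 \<Otimes>\<^sub>M noise))"
      proof (intro nn_integral_mono ennreal_leI powr_mono2)
        fix q show "N (fst (X q, Y q) - snd (X q, Y q)) / \<rho> \<le> N (fst (fst q) - snd (fst q))"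
          using step_contraction[of "fst (fst q)" "snd q" "snd (fst q)"] \<tau>\<theta> by (simp add: X_def Y_def field_simps)
      qed (use p \<tau>\<theta> in auto)
      also have "\<dots> = (\<integral>\<^sup>+q. ennreal (N (fst q - snd q) powr p) \<partial>\<Gamma>0)"
        by (rule nn_integral_pair_prob[OF prob_space_std_gaussian, where f="\<lambda>q. ennreal (N (fst q - snd q) powr p)"]) measurable
      finally show ?thesis by (simp add: cost_def)
    qed
    also have "(\<integral>\<^sup>+t. ?g (snd t) \<partial>T) = (\<integral>\<^sup>+z. ?g z \<partial>\<Gamma>1')" by (rule nT1[OF fg(2)])
    also have "\<dots> \<le> ennreal ((Cn / \<tau>) powr p) * (\<integral>\<^sup>+ (x, y). ennreal (dist x y powr p) \<partial>\<Gamma>1)"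
    proof -
      have "(\<integral>\<^sup>+z. ?g z \<partial>\<Gamma>1') = (\<integral>\<^sup>+q. ?g (V q, W q) \<partial>(\<Gamma>1 \<Otimes>\<^sub>M std_gaussian))"
        unfolding \<Gamma>1'_def by (rule nn_integral_distr) measurable
      also have "\<dots> \<le> (\<integral>\<^sup>+q. ennreal ((Cn / \<tau>) powr p) * ennreal (dist (fst (fst q)) (snd (fst q)) powr p) \<partial>(\<Gamma>1 \<Otimes>\<^sub>M (std_gaussian :: 'a measure)))"
      proof (intro nn_integral_mono)
        fix q :: "(('a \<times> 'a) \<times> ('a \<times> 'a)) \<times> 'a"
        \<comment> \<open>The half-step keeps the position gap and multiplies the velocity gap by
          \<open>\<eta> \<le> 1\<close>.\<close>
        have "norm (V q - W q) \<le> dist (fst (fst q)) (snd (fst q))"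
        proof -
          define d where "d = snd (fst q) - fst (fst q)"
          have "V q - W q = (fst d, \<eta> *\<^sub>R snd d)"
            by (simp add: V_def W_def ou_def d_def algebra_simps)
          moreover have "norm (fst d, \<eta> *\<^sub>R snd d) \<le> norm d"
          proof -
            have "(\<eta> * norm (snd d))\<^sup>2 \<le> (norm (snd d))\<^sup>2"
              using \<eta>_bounds by (intro power_mono) (auto simp: mult_left_le_one_le)
            then show ?thesis by (simp add: norm_prod_def power_mult_distrib)
          qed
          ultimately show ?thesis by (simp add: d_def dist_norm norm_minus_commute)
        qed
        then have "Cn * norm (V q - W q) \<le> Cn * dist (fst (fst q)) (snd (fst q))"
          using Cn_pos by (intro mult_left_mono) auto
        then have "N (V q - W q) / \<tau> \<le> Cn / \<tau> * dist (fst (fst q)) (snd (fst q))"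
          using N_le_Cn[of "V q - W q"] \<tau>\<theta> by (simp add: divide_right_mono)
        then have "(N (V q - W q) / \<tau>) powr p \<le> (Cn / \<tau> * dist (fst (fst q)) (snd (fst q))) powr p"
          using p \<tau>\<theta> by (intro powr_mono2) auto
        also have "\<dots> = (Cn / \<tau>) powr p * dist (fst (fst q)) (snd (fst q)) powr p"
          using Cn_pos \<tau>\<theta> by (intro powr_mult)
        finally show "?g (V q, W q) \<le> ennreal ((Cn / \<tau>) powr p) * ennreal (dist (fst (fst q)) (snd (fst q)) powr p)"
          by (simp add: ennreal_mult[symmetric] ennreal_leI)
      qed
      also have "\<dots> = ennreal ((Cn / \<tau>) powr p) * (\<integral>\<^sup>+q. ennreal (dist (fst (fst q)) (snd (fst q)) powr p) \<partial>(\<Gamma>1 \<Otimes>\<^sub>M (std_gaussian :: 'a measure)))"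
        by (rule nn_integral_cmult) measurable
      also have "(\<integral>\<^sup>+q. ennreal (dist (fst (fst q)) (snd (fst q)) powr p) \<partial>(\<Gamma>1 \<Otimes>\<^sub>M (std_gaussian :: 'a measure)))
          = (\<integral>\<^sup>+q. ennreal (dist (fst q) (snd q) powr p) \<partial>\<Gamma>1)"
        by (rule nn_integral_pair_prob[OF prob_space_std_gaussian, where f="\<lambda>q. ennreal (dist (fst q) (snd q) powr p)"]) measurable
      finally show ?thesis by (simp add: case_prod_unfold)
    qed
    finally show ?thesis by (simp add: PT add_mono mult_left_mono)
  qed
  ultimately show ?thesis by blast
qed

text \<open>Near-optimal couplings, with an error \<open>e\<close> tending to zero, give
  \<open>D \<le> \<rho> * D + \<tau> * (c * B)\<close> for \<open>c = (Cn / \<tau>) powr p\<close>.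
  As \<open>D\<close> is finite and \<open>\<tau> \<le> 1 - \<rho>\<close>, the weight
  \<open>\<tau>\<close> cancels.\<close>

lemma optimal_cost_bound:
  assumes inv: "invariant_prob kernel \<nu>" and p: "1 \<le> p"
  shows "(INF \<Gamma>\<in>couplings \<nu> target. cost p \<Gamma>)
    \<le> ennreal ((Cn / \<tau>) powr p) * (INF \<Gamma>\<in>couplings target pushed. \<integral>\<^sup>+ (x, y). ennreal (dist x y powr p) \<partial>\<Gamma>)"
    (is "?D \<le> ennreal ?c * ?B")
proof (cases "?B = \<top>")
  case True
  have "0 < ?c" using Cn_pos \<tau>\<theta> by simp
  then show ?thesis unfolding True by (simp add: ennreal_mult_top)
next
  case False
  obtain \<Gamma> where \<Gamma>: "\<Gamma> \<in> couplings \<nu> target" "cost p \<Gamma> < \<infinity>" using finite_cost_coupling[OF inv p] by blast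
  have "?D \<le> cost p \<Gamma>" by (rule INF_lower[OF \<Gamma>(1)])
  also note \<Gamma>(2)
  finally have Dfin: "?D < \<infinity>" .
  obtain D where D: "?D = ennreal D" "0 \<le> D"
    by (rule ennreal_cases[of ?D]) (use Dfin in auto)
  obtain B where B: "?B = ennreal B" "0 \<le> B"
    by (rule ennreal_cases[of ?B]) (use False in auto)
  have c: "0 < ?c" using Cn_pos \<tau>\<theta> by simp
  \<comment> \<open>Collects the coefficients of \<open>e\<close>; for the middle one,
    \<open>e powr p \<le> e\<close> relies on \<open>e \<le> 1\<close>.\<close>
  define K where "K = \<rho> + \<theta> * (Cn / \<theta>) powr p + \<tau> * ?c"
  have K: "0 < K" using \<tau>\<theta> c by (auto simp: K_def intro!: add_pos_nonneg add_nonneg_nonneg)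
  have step: "D \<le> (\<rho> * D + \<tau> * (?c * B)) + K * e" if e: "0 < e" "e \<le> 1" for e
  proof -
    have "?D < ennreal (D + e)" "?B < ennreal (B + e)"
      unfolding D(1) B(1) using D B e by (simp_all add: ennreal_less_iff)
    then obtain \<Gamma>0 \<Gamma>1 where \<Gamma>0: "\<Gamma>0 \<in> couplings \<nu> target" "cost p \<Gamma>0 < ennreal (D + e)"
      and \<Gamma>1: "\<Gamma>1 \<in> couplings target pushed" "(\<integral>\<^sup>+ (x, y). ennreal (dist x y powr p) \<partial>\<Gamma>1) < ennreal (B + e)"
      unfolding INF_less_iff by blast
    obtain \<Gamma>' where \<Gamma>': "\<Gamma>' \<in> couplings \<nu> target" "cost p \<Gamma>' \<le> ennreal \<rho> * cost p \<Gamma>0 + ennreal (\<theta> * (Cn * e / \<theta>) powr p)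
       + ennreal \<tau> * (ennreal ?c * (\<integral>\<^sup>+ (x, y). ennreal (dist x y powr p) \<partial>\<Gamma>1))"
      using improved_coupling[OF inv p \<Gamma>0(1) \<Gamma>1(1) e(1)] by blast
    have "ennreal D \<le> cost p \<Gamma>'" unfolding D(1)[symmetric] by (rule INF_lower[OF \<Gamma>'(1)])
    also note \<Gamma>'(2)
    also have "ennreal \<rho> * cost p \<Gamma>0 + ennreal (\<theta> * (Cn * e / \<theta>) powr p)
       + ennreal \<tau> * (ennreal ?c * (\<integral>\<^sup>+ (x, y). ennreal (dist x y powr p) \<partial>\<Gamma>1))
      \<le> ennreal \<rho> * ennreal (D + e) + ennreal (\<theta> * (Cn * e / \<theta>) powr p) + ennreal \<tau> * (ennreal ?c * ennreal (B + e))"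
      using \<Gamma>0(2) \<Gamma>1(2) by (intro add_mono mult_left_mono order_refl) auto
    also have "\<dots> = ennreal (\<rho> * (D + e) + \<theta> * (Cn * e / \<theta>) powr p + \<tau> * (?c * (B + e)))"
      using \<tau>\<theta> D B e by (simp add: ennreal_mult[symmetric] ennreal_plus[symmetric] del: ennreal_plus)
    finally have "D \<le> \<rho> * (D + e) + \<theta> * (Cn * e / \<theta>) powr p + \<tau> * (?c * (B + e))"
      using \<tau>\<theta> D B e c by (subst (asm) ennreal_le_iff) (auto intro!: add_nonneg_nonneg mult_nonneg_nonneg)
    also have "(Cn * e / \<theta>) powr p \<le> (Cn / \<theta>) powr p * e"
    proof -
      have "(Cn * e / \<theta>) powr p = (Cn / \<theta>) powr p * e powr p"
        using Cn_pos \<tau>\<theta> e by (subst powr_mult[symmetric]) auto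
      moreover have "e powr p \<le> e" using powr_mono'[of 1 p e] e p by simp
      ultimately show ?thesis by (simp add: mult_left_mono)
    qed
    finally show ?thesis using \<tau>\<theta> by (simp add: K_def algebra_simps mult_left_mono)
  qed
  have "D \<le> \<rho> * D + \<tau> * (?c * B)"
  proof (rule field_le_epsilon)
    fix e' :: real assume e': "0 < e'"
    define e where "e = min 1 (e' / K)"
    have "0 < e" "e \<le> 1" "K * e \<le> e'" using e' K by (auto simp: e_def min_def field_simps)
    then show "D \<le> \<rho> * D + \<tau> * (?c * B) + e'" using step[of e] by simp
  qed
  then have "(1 - \<rho>) * D \<le> \<tau> * (?c * B)" by (simp add: algebra_simps)
  moreover have "\<tau> * D \<le> (1 - \<rho>) * D" using \<tau>\<theta> D by (intro mult_right_mono) auto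
  ultimately have "\<tau> * D \<le> \<tau> * (?c * B)" by simp
  then have "D \<le> ?c * B" using \<tau>\<theta> by simp
  then show ?thesis unfolding D B using B by (simp add: ennreal_mult[symmetric] ennreal_leI)
qed

text \<open>Return to the Euclidean norm: \<open>Cn\<close> came in with the defect,
  \<open>c1\<close> comes in here, and their product is \<open>sqrt 3 * M\<close>.\<close>

lemma wasserstein_bound:
  assumes inv: "invariant_prob kernel \<nu>" and p: "1 \<le> p"
  shows "wasserstein p \<nu> target \<le> ennreal (2 * (sqrt 3 * M) / (\<delta> * \<kappa>)) * wasserstein p target pushed"
proof -
  let ?B = "INF \<Gamma>\<in>couplings target pushed. \<integral>\<^sup>+ (x, y). ennreal (dist x y powr p) \<partial>\<Gamma>"
  define c1 where "c1 = sqrt 2 * max 1 (sqrt L)"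
  have c1: "0 < c1" unfolding c1_def by (intro mult_pos_pos) (auto simp: less_max_iff_disj)
  have k: "c1 * (Cn / \<tau>) = 2 * (sqrt 3 * M) / (\<delta> * \<kappa>)"
  proof -
    have "sqrt 2 * sqrt (3 / 2) = sqrt 3" by (simp flip: real_sqrt_mult)
    then have "c1 * Cn = sqrt 3 * M" unfolding c1_def Cn_def M_eq[symmetric] by (metis mult.assoc mult.left_commute mult.commute)
    then show ?thesis by (simp add: \<tau>_def)
  qed
  let ?A = "INF \<Gamma>\<in>couplings \<nu> target. \<integral>\<^sup>+ (x, y). ennreal (dist x y powr p) \<partial>\<Gamma>"
  \<comment> \<open>Multiplying by \<open>c1 powr p\<close> and back carries the constant across the
    infimum.\<close>
  have cancel: "ennreal (1 / c1 powr p) * (ennreal (c1 powr p) * x) = x"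
    "ennreal (c1 powr p) * (ennreal (1 / c1 powr p) * x) = x" for x
    using c1 by (simp_all add: mult.assoc[symmetric] ennreal_mult[symmetric])
  have "ennreal (1 / c1 powr p) * ?A \<le> (INF \<Gamma>\<in>couplings \<nu> target. cost p \<Gamma>)"
  proof (rule INF_greatest)
    fix \<Gamma> assume \<Gamma>: "\<Gamma> \<in> couplings \<nu> target"
    have S: "sets \<nu> = sets borel" using inv by (auto simp: invariant_prob_def)
    have [measurable_cong]: "sets \<Gamma> = sets (borel \<Otimes>\<^sub>M borel)"
      unfolding couplingsD[OF \<Gamma>] by (intro sets_pair_measure_cong S sets_target)
    have "(\<integral>\<^sup>+ (x, y). ennreal (dist x y powr p) \<partial>\<Gamma>) \<le> (\<integral>\<^sup>+z. ennreal (c1 powr p) * ennreal (N (fst z - snd z) powr p) \<partial>\<Gamma>)"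
    proof (intro nn_integral_mono)
      fix z :: "('a \<times> 'a) \<times> ('a \<times> 'a)"
      have "dist (fst z) (snd z) powr p \<le> (c1 * N (fst z - snd z)) powr p"
        using norm_le_N[of "fst z - snd z"] p by (intro powr_mono2) (auto simp: c1_def dist_norm)
      then show "(case z of (x, y) \<Rightarrow> ennreal (dist x y powr p)) \<le> ennreal (c1 powr p) * ennreal (N (fst z - snd z) powr p)"
        using c1 by (simp add: case_prod_unfold ennreal_mult[symmetric] ennreal_leI powr_mult)
    qed
    also have "\<dots> = ennreal (c1 powr p) * cost p \<Gamma>" unfolding cost_def by (rule nn_integral_cmult) measurable
    finally have "?A \<le> ennreal (c1 powr p) * cost p \<Gamma>" by (rule INF_lower2[OF \<Gamma>])
    then have "ennreal (1 / c1 powr p) * ?A \<le> ennreal (1 / c1 powr p) * (ennreal (c1 powr p) * cost p \<Gamma>)"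
      by (intro mult_left_mono) auto
    then show "ennreal (1 / c1 powr p) * ?A \<le> cost p \<Gamma>" by (simp only: cancel)
  qed
  then have "ennreal (c1 powr p) * (ennreal (1 / c1 powr p) * ?A) \<le> ennreal (c1 powr p) * (INF \<Gamma>\<in>couplings \<nu> target. cost p \<Gamma>)"
    by (intro mult_left_mono) auto
  then have "?A \<le> ennreal (c1 powr p) * (INF \<Gamma>\<in>couplings \<nu> target. cost p \<Gamma>)" by (simp only: cancel)
  also have "\<dots> \<le> ennreal (c1 powr p) * (ennreal ((Cn / \<tau>) powr p) * ?B)"
    by (intro mult_left_mono optimal_cost_bound inv p) simp
  also have "\<dots> = ennreal ((c1 * (Cn / \<tau>)) powr p) * ?B"
    using c1 Cn_pos \<tau>\<theta> by (subst powr_mult) (auto simp: ennreal_mult mult.assoc)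
  finally have "wasserstein p \<nu> target \<le> ennroot p (ennreal ((c1 * (Cn / \<tau>)) powr p) * ?B)"
    unfolding wasserstein_def using p by (intro ennroot_mono) auto
  also have "\<dots> = ennreal (c1 * (Cn / \<tau>)) * wasserstein p target pushed"
    unfolding wasserstein_def using p c1 Cn_pos \<tau>\<theta> by (intro ennroot_mult) auto
  finally show ?thesis unfolding k .
qed

end

section \<open>The constants in their stated form\<close>

theorem proposition9:
  fixes U :: "real ^ 'n \<Rightarrow> real"
    and m L \<gamma> \<delta> \<eta> \<kappa> K1 K2 :: real
    and \<pi>\<delta> :: "((real ^ 'n) \<times> (real ^ 'n)) measure"
  assumes "C2 U"
    and "0 < m" and "m \<le> L"
    and "\<And>x y. norm (grad U x - grad U y) \<le> L * norm (x - y)"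
    and "\<And>x y. (x - y) \<bullet> (grad U x - grad U y) \<ge> m * (norm (x - y))\<^sup>2"
    and "\<gamma> \<ge> 2 * sqrt L"
    and "0 < \<delta>" and "\<delta> \<le> m / (33 * \<gamma> ^ 3)"
    and "invariant_prob (obabo_kernel \<delta> \<gamma> U) \<pi>\<delta>"
    and "\<eta> = eta \<delta> \<gamma>"
    and "\<kappa> = m / (3 * \<gamma>)"
    and "K1 = sqrt 3 * max (L powr (1 / 2)) (L powr (- 1 / 2))"
    and "K2 = sqrt (\<delta> / (2 * pi * (1 - \<eta>\<^sup>2))) * max (2 + 3 * \<delta>\<^sup>2 * L / 2) (3 * \<delta>)"
  shows "(\<forall>p::real. p \<ge> 1 \<longrightarrow>
            wasserstein p \<pi>\<delta> (target_measure U)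
              \<le> ennreal (2 * K1 / (\<delta> * \<kappa>)) *
                  wasserstein p (target_measure U) (verlet_push \<delta> U (target_measure U)))
       \<and> (\<forall>n::nat. n \<ge> 1 \<longrightarrow>
            tv_dist \<pi>\<delta> (target_measure U)
              \<le> ennreal (K1 * K2 / \<delta> powr (3 / 2) * (1 - \<delta> * \<kappa>) powr ((real n - 1) / 2)) *
                  wasserstein 1 \<pi>\<delta> (target_measure U)
                + of_nat n * tv_dist (verlet_push \<delta> U (target_measure U)) (target_measure U))"
proof -
  interpret C: obabo_chain U m L \<gamma> \<delta>
    using assms by unfold_locales auto
  have \<eta>: "C.\<eta> = \<eta>" and \<kappa>: "C.\<kappa> = \<kappa>" by (simp_all add: C.\<eta>_def C.\<kappa>_def assms)
  have K1: "K1 = sqrt 3 * C.M"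
    using C.L by (simp add: assms(12) C.M_def powr_half_sqrt powr_minus_divide)
  have first: "wasserstein p \<pi>\<delta> (target_measure U) \<le> ennreal (2 * K1 / (\<delta> * \<kappa>)) *
      wasserstein p (target_measure U) (verlet_push \<delta> U (target_measure U))" if "1 \<le> p" for p
    using C.wasserstein_bound[OF assms(9) that] by (simp only: K1 \<kappa>)
  have second: "tv_dist \<pi>\<delta> (target_measure U)
      \<le> ennreal (K1 * K2 / \<delta> powr (3 / 2) * (1 - \<delta> * \<kappa>) powr ((real n - 1) / 2)) * wasserstein 1 \<pi>\<delta> (target_measure U)
        + of_nat n * tv_dist (verlet_push \<delta> U (target_measure U)) (target_measure U)" if n: "1 \<le> n" for n
  proof -
    have "2 * C.c0 * (sqrt 3 * C.M * C.\<rho> ^ (n - 1)) \<le> K1 * K2 / \<delta> powr (3 / 2) * (1 - \<delta> * \<kappa>) powr ((real n - 1) / 2)"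
    proof -
      \<comment> \<open>\<open>n - 1\<close> is a difference of naturals on the left and of reals on
        the right; they agree for \<open>n \<ge> 1\<close>.\<close>
      have \<rho>: "C.\<rho> ^ (n - 1) = (1 - \<delta> * \<kappa>) powr ((real n - 1) / 2)"
      proof -
        have "C.\<rho> = (1 - \<delta> * \<kappa>) powr (1 / 2)"
          using C.\<delta>\<kappa>_bounds by (simp add: C.\<rho>_def powr_half_sqrt \<kappa>)
        moreover have "0 < C.\<rho>" using C.\<rho>_bounds by simp
        ultimately show ?thesis using n by (simp add: powr_realpow[symmetric] powr_powr of_nat_diff)
      qed
      have d32: "\<delta> powr (3 / 2) = \<delta> * sqrt \<delta>"
      proof -
        have "\<delta> powr (3 / 2) = \<delta> powr (1 + 1 / 2)" by simp
        also have "\<dots> = \<delta> * sqrt \<delta>" using assms(7) by (simp only: powr_add powr_half_sqrt less_imp_le powr_one)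
        finally show ?thesis .
      qed
      have "sqrt (\<delta> / (2 * pi * (1 - \<eta>\<^sup>2))) / \<delta> powr (3 / 2) = C.c0"
      proof -
        define q where "q = 1 - \<eta>\<^sup>2"
        show ?thesis unfolding C.c0_def C.s_def \<eta> d32 q_def[symmetric]
          using assms(7) by (simp add: real_sqrt_mult real_sqrt_divide mult_ac)
      qed
      then have "K2 / \<delta> powr (3 / 2) = C.c0 * max (2 + 3 * \<delta>\<^sup>2 * L / 2) (3 * \<delta>)"
        unfolding assms(13) by (metis times_divide_eq_left)
      \<comment> \<open>The \<open>2\<close> to be covered comes from the normalisation of total
        variation.\<close>
      moreover have "2 \<le> max (2 + 3 * \<delta>\<^sup>2 * L / 2) (3 * \<delta>)" using C.L by (simp add: le_max_iff_disj)
      ultimately have "C.c0 * 2 \<le> K2 / \<delta> powr (3 / 2)" using C.c0_pos by (simp add: mult_left_mono)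
      then have "K1 * C.\<rho> ^ (n - 1) * (C.c0 * 2) \<le> K1 * C.\<rho> ^ (n - 1) * (K2 / \<delta> powr (3 / 2))"
        using C.M_ge C.\<rho>_bounds by (intro mult_left_mono) (auto simp: K1)
      then show ?thesis unfolding \<rho>[symmetric] K1 by (simp add: mult_ac)
    qed
    then have "ennreal (2 * C.c0 * (sqrt 3 * C.M * C.\<rho> ^ (n - 1))) * wasserstein 1 \<pi>\<delta> (target_measure U)
      \<le> ennreal (K1 * K2 / \<delta> powr (3 / 2) * (1 - \<delta> * \<kappa>) powr ((real n - 1) / 2)) * wasserstein 1 \<pi>\<delta> (target_measure U)"
      by (intro mult_right_mono ennreal_leI) auto
    then show ?thesis using C.tv_bound[OF assms(9) n] by (meson add_right_mono order_trans)
  qed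
  show ?thesis using first second by blast
qed

end
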